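(* Let $K$ be an algebraic number field with ring of integers $\mathcal{O}_K$, let $\mathfrak{n}$ be a non-zero ideal of $\mathcal{O}_K$, and let $k\ge 1$ and $s\ge 0$ be integers. Let $\chi$ be a Dirichlet character modulo $\mathfrak{n}$ with conductor $\mathfrak{d}$, and let $\psi$ be the primitive character modulo $\mathfrak{d}$ that induces $\chi$. Let $\mathfrak{n}_0$ be the divisor of $\mathfrak{n}$ having the same prime ideal factors as $\mathfrak{d}$ and satisfying $\gcd(\mathfrak{n}_0,\mathfrak{n}/\mathfrak{n}_0)=1$. Then for every fixed $r\in\mathcal{O}_K$ with $\gcd(r,\mathfrak{n})=1$ and every arithmetical function $f$ on $I(\mathcal{O}_K)$, $$\sum_{\substack{a_1,\ldots,a_k\in(\mathcal{O}_K/\mathfrak{n})^*\\ a_1+\cdots+a_k\in(\mathcal{O}_K/\mathfrak{n})^*\\ b_1,\ldots,b_s\in\mathcal{O}_K/\mathfrak{n}}} f\big(\gcd(a_1+\cdots+a_k-r,b_1,\ldots,b_s,\mathfrak{n})\big)\chi(a_1) = \mu(\mathfrak{d})^{k-1}\psi(r)\,\varphi\!\left(\frac{\mathfrak{n}_0^{k}}{\mathfrak{d}^{k-1}}\right)\varphi_k\!\left(\frac{\mathfrak{n}}{\mathfrak{n}_0}\right)\sum_{\mathfrak{d}\mid\mathfrak{e}\mid\mathfrak{n}}\frac{(\mu\ast f)(\mathfrak{e})}{\varphi(\mathfrak{e})}\,N\!\left(\frac{\mathfrak{n}}{\mathfrak{e}}\right)^{s},$$ where $\mu(\mathfrak{d})^0$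 is interpreted as $1$.
   Context: $I(\mathcal{O}_K)$ is the set of nonzero integral ideals of $\mathcal{O}_K$; an arithmetical function is a complex-valued function on $I(\mathcal{O}_K)$. For $\alpha\in\mathcal{O}_K$, $\gcd(\alpha,\ldots)$ means the gcd (sum) of the ideals $\langle\alpha\rangle=\alpha\mathcal{O}_K$ and the others; $\gcd(\cdot,\cdot)=1$ means the ideals are coprime. $N(\mathfrak{a})=|\mathcal{O}_K/\mathfrak{a}|$; $\varphi(\mathfrak{a})=|(\mathcal{O}_K/\mathfrak{a})^*|$; $\mu$ is the Möbius function on ideals ($\mu(\mathcal{O}_K)=1$, $\mu(\mathfrak{p}_1\cdots\mathfrak{p}_t)=(-1)^t$ for distinct primes, $0$ otherwise); $(f\ast g)(\mathfrak{n})=\sum_{\mathfrak{d}\mid\mathfrak{n}}f(\mathfrak{d})g(\mathfrak{n}/\mathfrak{d})$. $\varphi_k(\mathfrak{m})$ is the number of $(a_1,\ldots,a_k)\in((\mathcal{O}_K/\mathfrak{m})^* )^k$ with $a_1+\cdots+a_k\in(\mathcal{O}_K/\mathfrak{m})^*$. A divisor $\mathfrak{d}'$ of $\mathfrak{n}$ is an induced modulus for a character $\chi$ modulo $\mathfrak{n}$ (a character of $(\mathcal{O}_K/\mathfrak{n})^*$) if $\chi(a)=\chi(b)$ whenever $a,b\in(\mathcal{O}_K/\mathfrak{n})^*$ and $a\equiv b\pmod{\mathfrak{d}'}$; the conductor is the induced modulus dividing all induced moduli; $\chi$ is primitive if its only induced modulus is $\mathfrak{n}$; the primitive character $\psi$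 modulo the conductor $\mathfrak{d}$ inducing $\chi$ satisfies $\chi(a)=\psi(a)$ for all $a\in(\mathcal{O}_K/\mathfrak{n})^*$. *)

theory Defs
  imports Complex_Main "HOL-Algebra.Algebra" "HOL-Algebra.Algebraic_Closure_Type"
begin

section \<open>Number fields and their rings of integers\<close>

text \<open>
  A number field is a subfield of some ambient field of characteristic 0 (for instance of the
  complex numbers, or the whole ambient field) that has finite dimension over the rationals.
\<close>

definition number_field :: "'a::field_char_0 set \<Rightarrow> bool" where
  "number_field K \<longleftrightarrow>
     subfield K ring_of_type_algebra \<and> ring.finite_dimension ring_of_type_algebra \<rat> K"

definition ring_of_integers :: "'a::field_char_0 set \<Rightarrow> 'a ring" where
  "ring_of_integers K = ring_of_type_algebra \<lparr>carrier := {x \<in> K. algebraic_int x}\<rparr>"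


section \<open>Arithmetic of ideals\<close>

text \<open>
  Divisibility, powers and sums of ideals are those of the semiring \<^const>\<open>ideals_set\<close>.
\<close>

definition nonzero_ideals :: "('a, 'b) ring_scheme \<Rightarrow> 'a set set" where
  "nonzero_ideals R = {I. ideal I R \<and> I \<noteq> {\<zero>\<^bsub>R\<^esub>}}"

definition nonzero_primes :: "('a, 'b) ring_scheme \<Rightarrow> 'a set set" where
  "nonzero_primes R = {p. primeideal p R \<and> p \<noteq> {\<zero>\<^bsub>R\<^esub>}}"

abbreviation ideal_divides :: "('a, 'b) ring_scheme \<Rightarrow> 'a set \<Rightarrow> 'a set \<Rightarrow> bool" where
  "ideal_divides R d n \<equiv> d divides\<^bsub>ideals_set R\<^esub> n"

abbreviation ideal_power :: "('a, 'b) ring_scheme \<Rightarrow> 'a set \<Rightarrow> nat \<Rightarrow> 'a set" where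
  "ideal_power R I m \<equiv> I [^]\<^bsub>ideals_set R\<^esub> m"

text \<open>The quotient \<open>a/b\<close>; only meaningful when \<open>b\<close> is nonzero and divides \<open>a\<close>.\<close>

definition ideal_quotient :: "('a, 'b) ring_scheme \<Rightarrow> 'a set \<Rightarrow> 'a set \<Rightarrow> 'a set" where
  "ideal_quotient R a b = (THE c. ideal c R \<and> a = ideal_prod R b c)"

definition ideal_norm :: "('a, 'b) ring_scheme \<Rightarrow> 'a set \<Rightarrow> nat" where
  "ideal_norm R a = card (carrier (R Quot a))"

definition ideal_totient :: "('a, 'b) ring_scheme \<Rightarrow> 'a set \<Rightarrow> nat" where
  "ideal_totient R a = card (Units (R Quot a))"

text \<open>The \<open>k\<close>-tuples of units of a ring whose sum is again a unit.\<close>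

definition unit_sum_tuples :: "('a, 'b) ring_scheme \<Rightarrow> nat \<Rightarrow> (nat \<Rightarrow> 'a) set" where
  "unit_sum_tuples Q k =
     {a \<in> {1..k} \<rightarrow>\<^sub>E Units Q. (\<Oplus>\<^bsub>Q\<^esub>i\<in>{1..k}. a i) \<in> Units Q}"

definition ideal_totient_k :: "nat \<Rightarrow> ('a, 'b) ring_scheme \<Rightarrow> 'a set \<Rightarrow> nat" where
  "ideal_totient_k k R m = card (unit_sum_tuples (R Quot m) k)"

definition prime_product :: "('a, 'b) ring_scheme \<Rightarrow> 'a set set \<Rightarrow> 'a set \<Rightarrow> bool" where
  "prime_product R P a \<longleftrightarrow>
     finite P \<and> P \<subseteq> nonzero_primes R \<and> a = (\<Otimes>\<^bsub>ideals_set R\<^esub>p\<in>P. p)"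

definition ideal_moebius :: "('a, 'b) ring_scheme \<Rightarrow> 'a set \<Rightarrow> complex" where
  "ideal_moebius R a =
     (if \<exists>P. prime_product R P a then (-1) ^ card (THE P. prime_product R P a) else 0)"

definition ideal_convolution ::
    "('a, 'b) ring_scheme \<Rightarrow> ('a set \<Rightarrow> complex) \<Rightarrow> ('a set \<Rightarrow> complex) \<Rightarrow> 'a set \<Rightarrow> complex" where
  "ideal_convolution R f g n =
     (\<Sum>d \<in> {d \<in> nonzero_ideals R. ideal_divides R d n}. f d * g (ideal_quotient R n d))"


section \<open>The gcd attached to residue classes\<close>

definition class_rep :: "'a set \<Rightarrow> 'a" where
  "class_rep A = (SOME x. x \<in> A)"

text \<open>
  The gcd of residue classes \<open>A\<close>, \<open>b 1\<close>, ..., \<open>b s\<close> modulo \<open>n\<close> together with \<open>n\<close> is formed from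
  representatives. As \<open>n\<close> is one of the summands, it does not depend on their choice:
\<close>

lemma (in cring) gcd_representative:
  assumes n: "ideal n R" and x: "x \<in> carrier R" and y: "y \<in> carrier R"
    and xy: "n +> x = n +> y"
  shows "PIdl x <+>\<^bsub>R\<^esub> n = PIdl y <+>\<^bsub>R\<^esub> n"
proof -
  have *: "PIdl x <+>\<^bsub>R\<^esub> n \<subseteq> PIdl y <+>\<^bsub>R\<^esub> n"
    if x: "x \<in> carrier R" and y: "y \<in> carrier R" and xy: "n +> x = n +> y" for x y
  proof -
    interpret n: ideal n R by (rule n)
    have "x \<in> n +> y" using n.a_rcos_self[OF x] xy by simp
    then obtain h where h: "h \<in> n" "x = h \<oplus> y" by (auto simp: a_r_coset_def')
    have "z \<otimes> x \<oplus> m \<in> PIdl y <+>\<^bsub>R\<^esub> n" if "z \<in> carrier R" "m \<in> n" for z m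
    proof -
      have "z \<otimes> x \<oplus> m = z \<otimes> y \<oplus> (z \<otimes> h \<oplus> m)"
        using that h y by (simp add: r_distr a_ac n.Icarr)
      moreover have "z \<otimes> h \<oplus> m \<in> n"
        using that h by (simp add: n.I_l_closed n.a_closed)
      ultimately show ?thesis
        using that y unfolding set_add_def' cgenideal_def by blast
    qed
    then show ?thesis unfolding set_add_def' cgenideal_def by blast
  qed
  show ?thesis using *[OF x y xy] *[OF y x xy[symmetric]] by blast
qed

definition class_gcd ::
    "('a, 'b) ring_scheme \<Rightarrow> 'a set \<Rightarrow> nat \<Rightarrow> 'a set \<Rightarrow> (nat \<Rightarrow> 'a set) \<Rightarrow> 'a set" where
  "class_gcd R n s A b =
     PIdl\<^bsub>R\<^esub> (class_rep A) <+>\<^bsub>R\<^esub> (\<Oplus>\<^bsub>ideals_set R\<^esub>j\<in>{1..s}. PIdl\<^bsub>R\<^esub> (class_rep (b j))) <+>\<^bsub>R\<^esub> n"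


section \<open>Dirichlet characters modulo an ideal\<close>

text \<open>
  Characters are defined on the cosets that are units of \<open>R Quot n\<close>; their values on other sets
  are irrelevant.
\<close>

definition dirichlet_char :: "('a, 'b) ring_scheme \<Rightarrow> 'a set \<Rightarrow> ('a set \<Rightarrow> complex) \<Rightarrow> bool" where
  "dirichlet_char R n \<chi> \<longleftrightarrow>
     \<chi> \<in> hom (units_of (R Quot n)) (units_of (ring_of_type_algebra :: complex ring))"

definition induced_modulus ::
    "('a, 'b) ring_scheme \<Rightarrow> 'a set \<Rightarrow> ('a set \<Rightarrow> complex) \<Rightarrow> 'a set \<Rightarrow> bool" where
  "induced_modulus R n \<chi> d \<longleftrightarrow> ideal d R \<and> ideal_divides R d n \<and>
     (\<forall>x\<in>carrier R. \<forall>y\<in>carrier R.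
        n +>\<^bsub>R\<^esub> x \<in> Units (R Quot n) \<longrightarrow> n +>\<^bsub>R\<^esub> y \<in> Units (R Quot n) \<longrightarrow> x \<ominus>\<^bsub>R\<^esub> y \<in> d \<longrightarrow>
        \<chi> (n +>\<^bsub>R\<^esub> x) = \<chi> (n +>\<^bsub>R\<^esub> y))"

definition conductor ::
    "('a, 'b) ring_scheme \<Rightarrow> 'a set \<Rightarrow> ('a set \<Rightarrow> complex) \<Rightarrow> 'a set \<Rightarrow> bool" where
  "conductor R n \<chi> d \<longleftrightarrow>
     induced_modulus R n \<chi> d \<and> (\<forall>d'. induced_modulus R n \<chi> d' \<longrightarrow> ideal_divides R d d')"

definition primitive_char :: "('a, 'b) ring_scheme \<Rightarrow> 'a set \<Rightarrow> ('a set \<Rightarrow> complex) \<Rightarrow> bool" where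
  "primitive_char R n \<chi> \<longleftrightarrow> dirichlet_char R n \<chi> \<and> {d. induced_modulus R n \<chi> d} = {n}"

definition induces ::
    "('a, 'b) ring_scheme \<Rightarrow> 'a set \<Rightarrow> ('a set \<Rightarrow> complex) \<Rightarrow> 'a set \<Rightarrow> ('a set \<Rightarrow> complex) \<Rightarrow> bool" where
  "induces R d \<psi> n \<chi> \<longleftrightarrow>
     (\<forall>x\<in>carrier R. n +>\<^bsub>R\<^esub> x \<in> Units (R Quot n) \<longrightarrow> \<chi> (n +>\<^bsub>R\<^esub> x) = \<psi> (d +>\<^bsub>R\<^esub> x))"

end

theory Submission
  imports Defs "Jordan_Normal_Form.Char_Poly"
begin

text \<open>
  Moebius inversion \<open>f(g) = \<Sum>e | g. (\<mu> * f)(e)\<close> turns the left-hand side into a sum over \<open>e | n\<close> of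
  \<open>(\<mu> * f)(e) N(n/e)^s S(e)\<close>, where \<open>S(e)\<close> is the sum of \<open>\<chi>(a\<^sub>1)\<close> over the admissible tuples with
  \<open>a\<^sub>1 + \<dots> + a\<^sub>k \<equiv> r\<close> modulo \<open>e\<close>. Letting the units modulo \<open>n\<close> act on the tuples by scaling gives
  \<open>\<phi>(n) S(e) = J(n) \<Sum>{\<chi>(t). t \<equiv> r (mod e)}\<close> with the Jacobi sum
  \<open>J(n) = \<Sum>\<chi>(a\<^sub>1) / \<chi>(a\<^sub>1 + \<dots> + a\<^sub>k)\<close>; the sum over \<open>t\<close> vanishes unless \<open>d | e\<close>, and is
  \<open>\<psi>(r) \<phi>(n) / \<phi>(e)\<close> in that case. Since \<open>n\<close> and \<open>d (n/n\<^sub>0)\<close> have the same prime factors, counting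
  the fibres of the reduction to the residue rings of \<open>d\<close> and \<open>n/n\<^sub>0\<close> yields
  \<open>J(n) = N(n\<^sub>0/d)^k \<phi>\<^sub>k(n/n\<^sub>0) J(d)\<close>. Finally, for primitive \<open>\<psi>\<close> detecting units by
  \<open>\<Sum>\<delta> | (u, d). \<mu>(\<delta>)\<close> shows that the sum of \<open>\<psi>(a\<^sub>1)\<close> over the tuples with \<open>a\<^sub>1 + \<dots> + a\<^sub>k = u\<close> is
  \<open>\<mu>(d)^(k-1) \<psi>(u)\<close>, so that \<open>J(d) = \<phi>(d) \<mu>(d)^(k-1)\<close>.

  The facts on ideals needed here follow from three properties of a ring of integers: nonzero ideals
  have finite quotients, they can be cancelled, and they divide the ideals that they contain.
\<close>

section \<open>Algebraic integers\<close>

text \<open>The quotient \<chi>(a_1)/\<chi>(a_1 + ... + a_k) in J(n) is unchanged when the whole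
  tuple is multiplied by a unit, so averaging over scalings separates the tuples from the condition
  modulo e. J(n) is compared with the residue rings of d and n/n_0 rather than those of n_0 and
  n/n_0: \<open>\<chi>\<close> depends on classes modulo d only, so one fibre count covers both the
  splitting and the descent from n_0 to d. That c = n_0/d makes sense follows as d divides n and is
  coprime to n/n_0. The totient on the right is \<phi>(d) N(c)^k in another form: n_0^k/d^(k-1) = d
  c^k, and c has no primes beyond those of d. On the algebraic side everything starts from finite
  dimension. More elements of K than its degree satisfy an integral relation that is nontrivial
  modulo a given prime p, so the residue ring modulo p is finite, and no integral basis or
  discriminant enters. Finiteness of residue rings then takes over from chain conditions: it
  supplies maximal ideals, smallest choices and the pigeonhole argument behind the inversion of
  ideals.\<close>

definition int_span :: "'a::comm_ring_1 set \<Rightarrow> 'a set" where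
  "int_span S = range (\<lambda>c. \<Sum>t\<in>S. of_int (c t) * t)"

lemma int_spanI: "x = (\<Sum>t\<in>S. of_int (c t) * t) \<Longrightarrow> x \<in> int_span S"
  unfolding int_span_def by blast

lemma int_span_base:
  assumes "finite S" "s \<in> S"
  shows "s \<in> int_span S"
proof -
  have "(\<Sum>t\<in>S. of_int (if t = s then 1 else 0) * t) = (\<Sum>t\<in>S. if t = s then t else 0)"
    by (rule sum.cong) auto
  also have "\<dots> = s"
    using assms by simp
  finally show ?thesis
    by (intro int_spanI) (rule sym)
qed

lemma int_span_add: "x \<in> int_span S \<Longrightarrow> y \<in> int_span S \<Longrightarrow> x + y \<in> int_span S"
proof -
  assume "x \<in> int_span S" "y \<in> int_span S"
  then obtain c c' where "x = (\<Sum>t\<in>S. of_int (c t) * t)" "y = (\<Sum>t\<in>S. of_int (c' t) * t)"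
    unfolding int_span_def by auto
  then have "x + y = (\<Sum>t\<in>S. of_int (c t + c' t) * t)"
    by (simp add: sum.distrib algebra_simps)
  then show ?thesis
    by (rule int_spanI)
qed

lemma int_span_scale: "x \<in> int_span S \<Longrightarrow> of_int m * x \<in> int_span S"
proof -
  assume "x \<in> int_span S"
  then obtain c where "x = (\<Sum>t\<in>S. of_int (c t) * t)"
    unfolding int_span_def by auto
  then have "of_int m * x = (\<Sum>t\<in>S. of_int (m * c t) * t)"
    by (simp add: sum_distrib_left algebra_simps)
  then show ?thesis
    by (rule int_spanI)
qed

lemma int_span_zero: "0 \<in> int_span S"
proof -
  have "0 = (\<Sum>t\<in>S. of_int ((\<lambda>_. 0) t) * t)"
    by simp
  then show ?thesis
    by (rule int_spanI)
qed

lemma int_span_sum: "(\<And>i. i \<in> I \<Longrightarrow> g i \<in> int_span S) \<Longrightarrow> sum g I \<in> int_span S"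
  by (induction I rule: infinite_finite_induct) (auto intro: int_span_zero int_span_add)

lemma int_span_mult_closed:
  assumes "\<And>s. s \<in> S \<Longrightarrow> z * s \<in> int_span S" and "x \<in> int_span S"
  shows "z * x \<in> int_span S"
proof -
  obtain c where "x = (\<Sum>t\<in>S. of_int (c t) * t)"
    using assms(2) unfolding int_span_def by auto
  then have "z * x = (\<Sum>t\<in>S. of_int (c t) * (z * t))"
    by (simp add: sum_distrib_left algebra_simps)
  also have "\<dots> \<in> int_span S"
    by (intro int_span_sum int_span_scale assms(1))
  finally show ?thesis .
qed

text \<open>Multiplication by z acts on the elements of S through an integer matrix, so z is an
  eigenvalue of that matrix and a root of its monic characteristic polynomial. The eigenvector lists
  the elements of S; w makes it nonzero.\<close>

lemma algebraic_int_if_int_span_stable: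
  fixes z :: "'a::field_char_0"
  assumes fin: "finite S" and w: "w \<in> S" "w \<noteq> 0"
    and stable: "\<And>s. s \<in> S \<Longrightarrow> z * s \<in> int_span S"
  shows "algebraic_int z"
proof -
  define n where "n = card S"
  obtain v where v: "bij_betw v {..<n} S"
    using ex_bij_betw_nat_finite[OF fin] unfolding n_def atLeast0LessThan by blast
  have "\<forall>s\<in>S. \<exists>c. z * s = (\<Sum>t\<in>S. of_int (c t) * t)"
    using stable unfolding int_span_def by blast
  then obtain c where c: "\<And>s. s \<in> S \<Longrightarrow> z * s = (\<Sum>t\<in>S. of_int (c s t) * t)"
    by metis
  define B :: "int mat" where "B = mat n n (\<lambda>(i, j). c (v i) (v j))"
  define A :: "'a mat" where "A = map_mat of_int B"
  have B: "B \<in> carrier_mat n n" and A: "A \<in> carrier_mat n n"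
    by (auto simp: A_def B_def)
  have "A *\<^sub>v vec n v = z \<cdot>\<^sub>v vec n v"
  proof (rule eq_vecI)
    fix i assume i: "i < dim_vec (z \<cdot>\<^sub>v vec n v)"
    then have vi: "v i \<in> S"
      using bij_betwE[OF v] by simp
    have "(A *\<^sub>v vec n v) $ i = (\<Sum>j<n. of_int (c (v i) (v j)) * v j)"
      using i by (simp add: A_def B_def scalar_prod_def atLeast0LessThan)
    also have "\<dots> = (\<Sum>t\<in>S. of_int (c (v i) t) * t)"
      by (rule sum.reindex_bij_betw[OF v])
    also have "\<dots> = z * v i"
      using c[OF vi] by simp
    finally show "(A *\<^sub>v vec n v) $ i = (z \<cdot>\<^sub>v vec n v) $ i"
      using i by simp
  qed (use A in auto)
  moreover have "vec n v \<noteq> 0\<^sub>v n"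
  proof
    assume eq: "vec n v = 0\<^sub>v n"
    obtain i where "i < n" "v i = w"
      using w(1) v by (auto simp: bij_betw_def)
    then show False
      using w(2) eq by (metis index_vec index_zero_vec(1))
  qed
  ultimately have "eigenvalue A z"
    using A unfolding eigenvalue_def eigenvector_def by (intro exI[of _ "vec n v"]) auto
  then have "poly (char_poly A) z = 0"
    using eigenvalue_root_char_poly[OF A] by blast
  moreover have "char_poly A = map_poly of_int (char_poly B)"
    unfolding A_def by (rule of_int_hom.char_poly_hom[OF B])
  moreover have "lead_coeff (char_poly A) = 1"
    using degree_monic_char_poly[OF A] by metis
  ultimately show ?thesis
    by (intro algebraic_int.intros[of "char_poly A"]) (auto simp: coeff_map_poly)
qed

text \<open>One set stable under both x and y serves for their sum and their product alike. The
  monomials x^i y^j below the degrees of monic equations work, because these equations rewrite the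
  top powers; 1 in S is the nonzero element that the eigenvalue argument asks for.\<close>

lemma algebraic_int_pair_stable_set:
  fixes x y :: "'a::field_char_0"
  assumes "algebraic_int x" "algebraic_int y"
  obtains S where "finite S" "1 \<in> S"
    "\<And>s. s \<in> S \<Longrightarrow> x * s \<in> int_span S" "\<And>s. s \<in> S \<Longrightarrow> y * s \<in> int_span S"
proof -
  obtain p q :: "int poly" where p: "lead_coeff p = 1" "poly (map_poly of_int p) x = 0"
    and q: "lead_coeff q = 1" "poly (map_poly of_int q) y = 0"
    using assms unfolding algebraic_int_altdef_ipoly by blast
  have reduce: "z ^ degree r = (\<Sum>i<degree r. of_int (- coeff r i) * z ^ i)" "degree r > 0"
    if r: "lead_coeff r = 1" "poly (map_poly of_int r) z = 0" for r :: "int poly" and z :: 'a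
  proof -
    have "0 = (\<Sum>i\<le>degree r. of_int (coeff r i) * z ^ i)"
      using r(2) by (simp add: poly_altdef coeff_map_poly degree_map_poly)
    also have "\<dots> = (\<Sum>i<degree r. of_int (coeff r i) * z ^ i) + z ^ degree r"
      using r(1) by (simp add: lessThan_Suc_atMost[symmetric])
    finally show "z ^ degree r = (\<Sum>i<degree r. of_int (- coeff r i) * z ^ i)"
      by (simp add: sum_negf eq_neg_iff_add_eq_0 add.commute)
    \<comment> \<open>A monic constant is 1 and has no root. Positive degrees are what puts the
      monomial x^0 y^0 into the set below.\<close>
    show "degree r > 0"
    proof (rule ccontr)
      assume "\<not> degree r > 0"
      then have "r = 1"
        using r(1) by (metis degree_0_id gr0I of_nat_0 one_pCons one_poly_eq_simps(1) degree_eq_zeroE lead_coeff_pCons(2))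
      with r(2) show False by simp
    qed
  qed
  define S where "S = (\<lambda>(i, j). x ^ i * y ^ j) ` ({..<degree p} \<times> {..<degree q})"
  have fin: "finite S"
    by (simp add: S_def)
  have mem: "x ^ i * y ^ j \<in> int_span S" if "i < degree p" "j < degree q" for i j
    using that by (intro int_span_base[OF fin]) (auto simp: S_def)
  have xs: "x * s \<in> int_span S" if s_in: "s \<in> S" for s
  proof -
    obtain i j where s: "s = x ^ i * y ^ j" "i < degree p" "j < degree q"
      using s_in by (auto simp: S_def)
    show ?thesis
    proof (cases "Suc i < degree p")
      case True
      then show ?thesis using mem[of "Suc i" j] s by (simp add: mult.assoc)
    next
      case False
      then have "degree p = Suc i" using s by simp
      then have "x * s = x ^ degree p * y ^ j" using s by simp
      also have "\<dots> = (\<Sum>i<degree p. of_int (- coeff p i) * (x ^ i * y ^ j))"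
        by (simp add: reduce(1)[OF p] sum_distrib_right mult.assoc)
      also have "\<dots> \<in> int_span S"
        using s by (intro int_span_sum int_span_scale mem) auto
      finally show ?thesis .
    qed
  qed
  have ys: "y * s \<in> int_span S" if s_in: "s \<in> S" for s
  proof -
    obtain i j where s: "s = x ^ i * y ^ j" "i < degree p" "j < degree q"
      using s_in by (auto simp: S_def)
    show ?thesis
    proof (cases "Suc j < degree q")
      case True
      then show ?thesis using mem[of i "Suc j"] s by (simp add: mult_ac)
    next
      case False
      then have "degree q = Suc j" using s by simp
      then have "y * s = x ^ i * y ^ degree q" using s by simp
      also have "\<dots> = (\<Sum>j<degree q. of_int (- coeff q j) * (x ^ i * y ^ j))"
        by (simp add: reduce(1)[OF q] sum_distrib_left mult_ac)
      also have "\<dots> \<in> int_span S"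
        using s by (intro int_span_sum int_span_scale mem) auto
      finally show ?thesis .
    qed
  qed
  have "1 \<in> S"
    using reduce(2)[OF p] reduce(2)[OF q] unfolding S_def
    by (intro image_eqI[of _ _ "(0, 0)"]) auto
  with fin xs ys that show thesis by blast
qed

lemma algebraic_int_plus:
  fixes x y :: "'a::field_char_0"
  assumes "algebraic_int x" "algebraic_int y"
  shows "algebraic_int (x + y)"
proof -
  obtain S where S: "finite S" "1 \<in> S"
    "\<And>s. s \<in> S \<Longrightarrow> x * s \<in> int_span S" "\<And>s. s \<in> S \<Longrightarrow> y * s \<in> int_span S"
    using algebraic_int_pair_stable_set[OF assms] by metis
  show ?thesis
    by (rule algebraic_int_if_int_span_stable[OF S(1,2)])
      (auto simp: distrib_right intro: int_span_add S)
qed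

lemma algebraic_int_times:
  fixes x y :: "'a::field_char_0"
  assumes "algebraic_int x" "algebraic_int y"
  shows "algebraic_int (x * y)"
proof -
  obtain S where S: "finite S" "1 \<in> S"
    "\<And>s. s \<in> S \<Longrightarrow> x * s \<in> int_span S" "\<And>s. s \<in> S \<Longrightarrow> y * s \<in> int_span S"
    using algebraic_int_pair_stable_set[OF assms] by metis
  show ?thesis
    by (rule algebraic_int_if_int_span_stable[OF S(1,2)])
      (auto simp: mult.assoc intro: int_span_mult_closed S)
qed

text \<open>Substituting X^j - X^i into a monic equation of g^j - g^i gives an equation of g, monic
  since i < j. A pigeonhole coincidence between powers of g becomes integrality in this way.\<close>

lemma algebraic_int_power_diff_imp_algebraic_int:
  fixes g :: "'a::field_char_0"
  assumes "algebraic_int (g ^ j - g ^ i)" and "i < j"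
  shows "algebraic_int g"
proof -
  obtain p :: "int poly" where p: "lead_coeff p = 1" "poly (map_poly of_int p) (g ^ j - g ^ i) = 0"
    using assms(1) unfolding algebraic_int_altdef_ipoly by blast
  define q :: "int poly" where "q = monom 1 j - monom 1 i"
  have deg: "degree q = j" and lead: "lead_coeff q = 1"
  proof -
    have "degree (monom (- 1) i :: int poly) < degree (monom 1 j :: int poly)"
      using assms(2) by (simp add: degree_monom_eq)
    moreover have "q = monom 1 j + monom (- 1) i"
      by (simp add: q_def minus_monom[symmetric])
    ultimately show "degree q = j"
      by (simp add: degree_add_eq_left degree_monom_eq)
    then show "lead_coeff q = 1"
      using assms(2) by (simp add: q_def)
  qed
  have "poly (map_poly of_int (pcompose p q)) g = poly (map_poly of_int p) (g ^ j - g ^ i)"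
    by (simp add: of_int_hom.map_poly_pcompose poly_pcompose q_def of_int_poly_hom.hom_minus poly_monom of_int_hom.map_poly_hom_monom)
  moreover have "lead_coeff (pcompose p q) = 1"
    using deg assms(2) lead p lead_coeff_comp[of q p] by simp
  ultimately show ?thesis
    unfolding algebraic_int_altdef_ipoly using p(2) by auto
qed

section \<open>Finite quotients of rings of integers\<close>

lemma ring_of_type_algebra_simps [simp]:
  "carrier (ring_of_type_algebra :: 'a::field ring) = UNIV"
  "x \<otimes>\<^bsub>(ring_of_type_algebra :: 'a ring)\<^esub> y = x * y"
  "x \<oplus>\<^bsub>(ring_of_type_algebra :: 'a ring)\<^esub> y = x + y"
  "\<one>\<^bsub>(ring_of_type_algebra :: 'a ring)\<^esub> = 1"
  "\<zero>\<^bsub>(ring_of_type_algebra :: 'a ring)\<^esub> = 0"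
  by (auto simp: ring_of_type_algebra_def)

lemma minus_ring_of_type_algebra [simp]:
  "\<ominus>\<^bsub>(ring_of_type_algebra :: 'a::field ring)\<^esub> x = - x"
proof -
  interpret field "ring_of_type_algebra :: 'a ring" by rule
  show ?thesis
    by (rule minus_equality) auto
qed

lemma inv_ring_of_type_algebra [simp]:
  assumes "x \<noteq> 0"
  shows "inv\<^bsub>(ring_of_type_algebra :: 'a::field ring)\<^esub> x = inverse x"
proof -
  interpret field "ring_of_type_algebra :: 'a ring" by rule
  show ?thesis
    using assms by (intro comm_inv_char) auto
qed

lemma subfield_Rats: "subfield \<rat> (ring_of_type_algebra :: 'a::field_char_0 ring)"
proof -
  interpret field "ring_of_type_algebra :: 'a ring" by rule
  show ?thesis
    by (intro subfieldI' subringI) auto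
qed

lemma combine_ring_of_type_algebra:
  assumes "length qs = length xs"
  shows "ring.combine (ring_of_type_algebra :: 'a::field ring) qs xs = (\<Sum>i<length xs. qs ! i * xs ! i)"
proof -
  interpret field "ring_of_type_algebra :: 'a ring" by rule
  show ?thesis
    using assms by (induction qs xs rule: list_induct2) (simp_all add: sum.lessThan_Suc_shift del: sum.lessThan_Suc)
qed

text \<open>The bound n is the dimension, uniform in x. Since x is a family, repeated elements are
  covered as well: a list with repetitions is dependent.\<close>

lemma number_field_rational_dependence:
  fixes K :: "'a::field_char_0 set"
  assumes "number_field K"
  shows "\<exists>n. \<forall>x :: nat \<Rightarrow> 'a. (\<forall>i\<le>n. x i \<in> K) \<longrightarrow>
    (\<exists>q. (\<forall>i. q i \<in> \<rat>) \<and> (\<exists>i\<le>n. q i \<noteq> 0) \<and> (\<Sum>i\<le>n. q i * x i) = 0)"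
proof -
  interpret field "ring_of_type_algebra :: 'a ring" by rule
  obtain n where n: "dimension n \<rat> K"
    using assms unfolding number_field_def finite_dimension_def by blast
  have main: "\<exists>q. (\<forall>i. q i \<in> \<rat>) \<and> (\<exists>i\<le>n. q i \<noteq> 0) \<and> (\<Sum>i\<le>n. q i * x i) = 0"
    if x: "\<forall>i\<le>n. x i \<in> K" for x :: "nat \<Rightarrow> 'a"
  proof -
    define xs where "xs = map x [0..<Suc n]"
    have "\<not> independent \<rat> xs"
      using independent_length_le_dimension[OF subfield_Rats n, of xs] x by (force simp: xs_def)
    then obtain qs where qs: "length qs = length xs" "combine qs xs = 0" "set qs \<subseteq> \<rat>" "set qs \<noteq> {0}"
      using dependent_imp_non_trivial_combine[OF subfield_Rats, of xs] by auto
    \<comment> \<open>Zero beyond n keeps every value rational, where \<open>qs ! i\<close> would be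
      unspecified.\<close>
    define q where "q i = (if i \<le> n then qs ! i else 0)" for i
    have len: "length qs = Suc n"
      using qs(1) by (simp add: xs_def)
    have "\<forall>i. q i \<in> \<rat>"
      using qs(3) len by (auto simp: q_def)
    moreover have "\<exists>i\<le>n. q i \<noteq> 0"
    proof (rule ccontr)
      assume "\<not> ?thesis"
      then have "\<forall>i<length qs. qs ! i = 0"
        using len by (auto simp: q_def less_Suc_eq_le)
      then have "set qs \<subseteq> {0}" by (auto simp: in_set_conv_nth)
      moreover have "set qs \<noteq> {}" using len by auto
      ultimately show False using qs(4) by (simp add: subset_singleton_iff)
    qed
    moreover have "(\<Sum>i\<le>n. q i * x i) = 0"
    proof -
      have "(\<Sum>i\<le>n. q i * x i) = (\<Sum>i<length xs. qs ! i * xs ! i)"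
        by (rule sum.cong) (auto simp: xs_def q_def nth_append less_Suc_eq_le simp del: upt_Suc)
      then show ?thesis
        using qs(1,2) combine_ring_of_type_algebra[of qs xs] by simp
    qed
    ultimately show ?thesis by blast
  qed
  show ?thesis
    by (intro exI[of _ n] allI impI) (rule main)
qed

lemma Rats_common_denominator:
  assumes "finite I" "\<And>i. i \<in> I \<Longrightarrow> q i \<in> (\<rat> :: 'a::field_char_0 set)"
  obtains D :: int where "D \<noteq> 0" "\<And>i. i \<in> I \<Longrightarrow> of_int D * q i \<in> \<int>"
proof -
  have "\<exists>D::int. D \<noteq> 0 \<and> (\<forall>i\<in>I. of_int D * q i \<in> \<int>)"
    using assms
  proof (induction I rule: finite_induct)
    case empty
    show ?case by (intro exI[of _ 1]) auto
  next
    case (insert j I)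
    then obtain D :: int where D: "D \<noteq> 0" "\<forall>i\<in>I. of_int D * q i \<in> \<int>" by auto
    obtain a b :: int where ab: "b > 0" "q j = of_int a / of_int b"
      using insert.prems[of j] by (auto elim: Rats_cases')
    have "of_int (D * b) * q i \<in> \<int>" if "i \<in> insert j I" for i
    proof (cases "i = j")
      case True
      then have "of_int (D * b) * q i = of_int (D * a)"
        using ab by simp
      then show ?thesis by (metis Ints_of_int)
    next
      case False
      then have "of_int D * q i \<in> \<int>"
        using D that by simp
      then have "of_int b * (of_int D * q i) \<in> \<int>"
        by (rule Ints_mult[OF Ints_of_int])
      moreover have "of_int (D * b) * q i = of_int b * (of_int D * q i)"
        by simp
      ultimately show ?thesis by (simp only:)
    qed
    then show ?case
      using D ab by (intro exI[of _ "D * b"]) auto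
  qed
  then show thesis using that by blast
qed

text \<open>Dividing an integral relation by the gcd of its coefficients makes one of them prime to \<open>p\<close>.\<close>

lemma number_field_dependence_mod_prime:
  fixes K :: "'a::field_char_0 set"
  assumes "number_field K"
  shows "\<exists>n. \<forall>(x :: nat \<Rightarrow> 'a) p. (\<forall>i\<le>n. x i \<in> K) \<longrightarrow> Factorial_Ring.prime p \<longrightarrow>
    (\<exists>c :: nat \<Rightarrow> int. (\<exists>i\<le>n. \<not> p dvd c i) \<and> (\<Sum>i\<le>n. of_int (c i) * x i) = 0)"
proof -
  obtain n where n: "\<forall>x :: nat \<Rightarrow> 'a. (\<forall>i\<le>n. x i \<in> K) \<longrightarrow>
    (\<exists>q. (\<forall>i. q i \<in> \<rat>) \<and> (\<exists>i\<le>n. q i \<noteq> 0) \<and> (\<Sum>i\<le>n. q i * x i) = 0)"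
    using number_field_rational_dependence[OF assms] by blast
  have main: "\<exists>c :: nat \<Rightarrow> int. (\<exists>i\<le>n. \<not> p dvd c i) \<and> (\<Sum>i\<le>n. of_int (c i) * x i) = 0"
    if x: "\<forall>i\<le>n. x i \<in> K" and p: "Factorial_Ring.prime p" for x :: "nat \<Rightarrow> 'a" and p :: int
  proof -
    obtain q where q: "\<forall>i. q i \<in> \<rat>" "\<exists>i\<le>n. q i \<noteq> 0" "(\<Sum>i\<le>n. q i * x i) = 0"
      using n x by blast
    obtain D where D: "D \<noteq> 0" "\<And>i. i \<in> {..n} \<Longrightarrow> of_int D * q i \<in> \<int>"
      using Rats_common_denominator[of "{..n}" q] q(1) by auto
    then have "\<forall>i\<in>{..n}. \<exists>m. of_int D * q i = of_int m"
      by (meson Ints_cases)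
    then obtain m where m: "\<And>i. i \<le> n \<Longrightarrow> of_int D * q i = of_int (m i)"
      by (metis atMost_iff)
    define g where "g = Gcd (m ` {..n})"
    obtain j where j: "j \<le> n" "m j \<noteq> 0"
      using q(2) D(1) m by (metis mult_eq_0_iff of_int_0 of_int_eq_0_iff)
    then have g0: "g \<noteq> 0"
      unfolding g_def by (auto simp: Gcd_0_iff)
    have gm: "m i = g * (m i div g)" if "i \<le> n" for i
      using that by (auto simp: g_def intro!: dvd_mult_div_cancel[symmetric] Gcd_dvd)
    have "\<exists>i\<le>n. \<not> p dvd m i div g"
    proof (rule ccontr)
      assume "\<not> ?thesis"
      then have "g * p dvd m i" if "i \<le> n" for i
        using gm[OF that] that by (metis dvd_refl mult_dvd_mono)
      then have "g * p dvd g"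
        unfolding g_def by (intro Gcd_greatest) (auto simp: g_def)
      then show False
        using g0 p not_prime_unit by (metis dvd_mult_cancel_left mult.right_neutral)
    qed
    moreover have "(\<Sum>i\<le>n. of_int (m i div g) * x i) = 0"
    proof -
      have "of_int g * (\<Sum>i\<le>n. of_int (m i div g) * x i) = (\<Sum>i\<le>n. of_int (m i) * x i)"
        unfolding sum_distrib_left
        by (rule sum.cong) (auto simp: mult.assoc[symmetric] of_int_mult[symmetric] gm[symmetric] simp del: of_int_mult)
      also have "\<dots> = of_int D * (\<Sum>i\<le>n. q i * x i)"
        unfolding sum_distrib_left
        by (rule sum.cong) (auto simp: m[symmetric])
      finally show ?thesis using q(3) g0 by simp
    qed
    ultimately show ?thesis by (intro exI[of _ "\<lambda>i. m i div g"]) auto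
  qed
  show ?thesis
    by (intro exI[of _ n] allI impI) (rule main)
qed

section \<open>The ring of integers and its residues modulo rational integers\<close>

locale number_field_integers =
  fixes K :: "'a::field_char_0 set"
  assumes number_field: "number_field K"
begin

definition ints :: "'a set" where
  "ints = {x \<in> K. algebraic_int x}"

lemma subfield_K: "subfield K ring_of_type_algebra"
  using number_field by (simp add: number_field_def)

lemma K_closed:
  "0 \<in> K" "1 \<in> K" "x \<in> K \<Longrightarrow> - x \<in> K" "x \<in> K \<Longrightarrow> y \<in> K \<Longrightarrow> x + y \<in> K"
  "x \<in> K \<Longrightarrow> y \<in> K \<Longrightarrow> x * y \<in> K" "x \<in> K \<Longrightarrow> inverse x \<in> K"
proof -
  note E = subringE[OF subfieldE(1)[OF subfield_K], simplified]
  interpret R: field "ring_of_type_algebra :: 'a ring" by rule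
  show "0 \<in> K" "1 \<in> K" "x \<in> K \<Longrightarrow> - x \<in> K" "x \<in> K \<Longrightarrow> y \<in> K \<Longrightarrow> x + y \<in> K"
    "x \<in> K \<Longrightarrow> y \<in> K \<Longrightarrow> x * y \<in> K"
    using E by blast+
  show "x \<in> K \<Longrightarrow> inverse x \<in> K"
    using R.subfield_m_inv(1)[OF subfield_K, of x] E(2) by (cases "x = 0") auto
qed

lemma ints_closed:
  "0 \<in> ints" "1 \<in> ints" "x \<in> ints \<Longrightarrow> - x \<in> ints" "x \<in> ints \<Longrightarrow> y \<in> ints \<Longrightarrow> x + y \<in> ints"
  "x \<in> ints \<Longrightarrow> y \<in> ints \<Longrightarrow> x * y \<in> ints" "x \<in> ints \<Longrightarrow> y \<in> ints \<Longrightarrow> x - y \<in> ints"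
proof -
  show "0 \<in> ints" "1 \<in> ints" "x \<in> ints \<Longrightarrow> - x \<in> ints" "x \<in> ints \<Longrightarrow> y \<in> ints \<Longrightarrow> x + y \<in> ints"
    "x \<in> ints \<Longrightarrow> y \<in> ints \<Longrightarrow> x * y \<in> ints"
    by (auto simp: ints_def K_closed algebraic_int_plus algebraic_int_times)
  then show "x \<in> ints \<Longrightarrow> y \<in> ints \<Longrightarrow> x - y \<in> ints"
    by (metis (no_types, lifting) K_closed(3,4) algebraic_int_minus algebraic_int_plus diff_conv_add_uminus
        ints_def mem_Collect_eq)
qed

lemma ints_sum: "(\<And>i. i \<in> A \<Longrightarrow> f i \<in> ints) \<Longrightarrow> sum f A \<in> ints"
  by (induction A rule: infinite_finite_induct) (auto intro: ints_closed)

lemma ints_of_int: "of_int m \<in> ints"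
proof -
  have nat: "of_nat k \<in> ints" for k
    by (induction k) (auto intro: ints_closed)
  show ?thesis
    by (cases m rule: int_cases2) (auto intro: ints_closed nat)
qed

lemma integers_simps [simp]:
  "carrier (ring_of_integers K) = ints"
  "x \<otimes>\<^bsub>ring_of_integers K\<^esub> y = x * y"
  "x \<oplus>\<^bsub>ring_of_integers K\<^esub> y = x + y"
  "\<one>\<^bsub>ring_of_integers K\<^esub> = 1"
  "\<zero>\<^bsub>ring_of_integers K\<^esub> = 0"
  by (auto simp: ring_of_integers_def ints_def ring_of_type_algebra_def)

sublocale domain "ring_of_integers K"
proof
  show "carrier (add_monoid (ring_of_integers K)) \<subseteq> Units (add_monoid (ring_of_integers K))"
  proof
    fix x assume "x \<in> carrier (add_monoid (ring_of_integers K))"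
    then show "x \<in> Units (add_monoid (ring_of_integers K))"
      using ints_closed(3)[of x] by (auto simp: Units_def intro!: bexI[of _ "- x"])
  qed
qed (auto simp: algebra_simps intro: ints_closed)

lemma a_inv_integers [simp]: "x \<in> ints \<Longrightarrow> \<ominus>\<^bsub>ring_of_integers K\<^esub> x = - x"
  by (rule minus_equality) (auto intro: ints_closed)

lemma a_minus_integers [simp]: "x \<in> ints \<Longrightarrow> y \<in> ints \<Longrightarrow> x \<ominus>\<^bsub>ring_of_integers K\<^esub> y = x - y"
  by (simp add: a_minus_def)

text \<open>Finiteness of the residue ring modulo m, put in terms of representatives because these
  combine directly when moduli are multiplied.\<close>

definition finite_residues :: "int \<Rightarrow> bool" where
  "finite_residues m \<longleftrightarrow> (\<exists>F. finite F \<and> F \<subseteq> ints \<and> (\<forall>x\<in>ints. \<exists>y\<in>F. \<exists>z\<in>ints. x = y + of_int m * z))"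

text \<open>Modulo p the ring of integers is a vector space over the field of p elements. An
  integral relation with a coefficient prime to p stays nontrivial there, so the dimension is at
  most n, and a largest independent set spans.\<close>

lemma finite_residues_prime:
  assumes p: "Factorial_Ring.prime p"
  shows "finite_residues p"
proof -
  obtain n where n: "\<forall>(x :: nat \<Rightarrow> 'a) p. (\<forall>i\<le>n. x i \<in> K) \<longrightarrow> Factorial_Ring.prime p \<longrightarrow>
    (\<exists>c :: nat \<Rightarrow> int. (\<exists>i\<le>n. \<not> p dvd c i) \<and> (\<Sum>i\<le>n. of_int (c i) * x i) = 0)"
    using number_field_dependence_mod_prime[OF number_field] by blast
  \<comment> \<open>Linear independence of the classes of S modulo p over the field of p
    elements.\<close>
  define indep where "indep S \<longleftrightarrow> finite S \<and> S \<subseteq> ints \<and>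
    (\<forall>c :: 'a \<Rightarrow> int. \<forall>z\<in>ints. (\<Sum>s\<in>S. of_int (c s) * s) = of_int p * z \<longrightarrow> (\<forall>s\<in>S. p dvd c s))" for S
  have card_le: "card S \<le> n" if S: "indep S" for S
  proof (rule ccontr)
    assume "\<not> card S \<le> n"
    then obtain T where T: "T \<subseteq> S" "card T = Suc n" "finite T"
      using obtain_subset_with_card_n[of "Suc n" S] by auto
    obtain x where x: "bij_betw x {..n} T"
      using ex_bij_betw_nat_finite[OF T(3)] T(2) by (auto simp: atLeast0LessThan lessThan_Suc_atMost)
    have "x i \<in> K" if "i \<le> n" for i
      using bij_betwE[OF x] that T(1) S by (auto simp: indep_def ints_def)
    then obtain c :: "nat \<Rightarrow> int" where c: "\<exists>i\<le>n. \<not> p dvd c i" "(\<Sum>i\<le>n. of_int (c i) * x i) = 0"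
      using n p by blast
    define y where "y = inv_into {..n} x"
    have y: "y (x i) = i" if "i \<le> n" for i
      using that bij_betw_inv_into_left[OF x] by (simp add: y_def)
    \<comment> \<open>The relation found for the family x, carried over to T and extended by zero to
      S.\<close>
    define d where "d s = (if s \<in> T then c (y s) else 0)" for s
    have "(\<Sum>s\<in>S. of_int (d s) * s) = (\<Sum>s\<in>T. of_int (d s) * s)"
      using T S by (intro sum.mono_neutral_right) (auto simp: indep_def d_def)
    also have "\<dots> = (\<Sum>i\<le>n. of_int (d (x i)) * x i)"
      by (rule sum.reindex_bij_betw[OF x, symmetric])
    also have "\<dots> = (\<Sum>i\<le>n. of_int (c i) * x i)"
      using bij_betwE[OF x] by (intro sum.cong) (auto simp: d_def y)
    finally have "(\<Sum>s\<in>S. of_int (d s) * s) = of_int p * 0"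
      using c(2) by simp
    then have "\<forall>s\<in>S. p dvd d s"
      using S ints_closed(1) unfolding indep_def by blast
    moreover obtain i where i: "i \<le> n" "\<not> p dvd c i"
      using c(1) by blast
    moreover have "x i \<in> T"
      using bij_betwE[OF x] i(1) by simp
    ultimately show False
      using T(1) y[OF i(1)] by (metis (no_types) d_def subsetD)
  qed
  have "indep {}" by (simp add: indep_def)
  then have "\<exists>S. indep S \<and> (\<forall>T. indep T \<longrightarrow> card T \<le> card S)"
    by (rule Lattices_Big.ex_has_greatest_nat[where b = "Suc n"]) (auto dest: card_le simp: less_Suc_eq_le)
  then obtain S where S: "indep S" and max: "\<And>T. indep T \<Longrightarrow> card T \<le> card S"
    by blast
  have fin: "finite S" and S_ints: "S \<subseteq> ints"
    using S by (auto simp: indep_def)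
  \<comment> \<open>The candidates for representatives: combinations of the largest independent set
    with digits below p.\<close>
  define F where "F = (\<lambda>c. \<Sum>s\<in>S. of_int (c s) * s) ` (S \<rightarrow>\<^sub>E {0..<p})"
  have reduce: "\<exists>y\<in>F. \<exists>z\<in>ints. (\<Sum>s\<in>S. of_int (c s) * s) = y + of_int p * z" for c :: "'a \<Rightarrow> int"
  proof (intro bexI)
    show "(\<Sum>s\<in>S. of_int (c s) * s) =
        (\<Sum>s\<in>S. of_int (restrict (\<lambda>s. c s mod p) S s) * s) + of_int p * (\<Sum>s\<in>S. of_int (c s div p) * s)"
    proof -
      have "(of_int (c s) :: 'a) = of_int (c s mod p) + of_int p * of_int (c s div p)" for s
        by (simp add: of_int_mult[symmetric] of_int_add[symmetric] del: of_int_mult of_int_add)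
      then have "(\<Sum>s\<in>S. of_int (c s) * s) = (\<Sum>s\<in>S. of_int (c s mod p) * s + of_int p * (of_int (c s div p) * s))"
        by (simp add: algebra_simps)
      then show ?thesis
        by (simp add: sum.distrib sum_distrib_left)
    qed
    show "(\<Sum>s\<in>S. of_int (restrict (\<lambda>s. c s mod p) S s) * s) \<in> F"
      unfolding F_def using prime_gt_0_int[OF p] by (intro imageI) auto
    show "(\<Sum>s\<in>S. of_int (c s div p) * s) \<in> ints"
      using S_ints by (intro ints_sum ints_closed ints_of_int) auto
  qed
  have "\<exists>y\<in>F. \<exists>z\<in>ints. x = y + of_int p * z" if x: "x \<in> ints" for x
  proof (cases "x \<in> S")
    case True
    have "(\<Sum>s\<in>S. of_int (if s = x then 1 else 0) * s) = (\<Sum>s\<in>S. if s = x then s else 0)"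
      by (rule sum.cong) auto
    also have "\<dots> = x"
      using True fin by simp
    finally show ?thesis
      using reduce[of "\<lambda>s. if s = x then 1 else 0"] by simp
  next
    case False
    then have "\<not> indep (insert x S)"
      using max[of "insert x S"] fin by auto
    then obtain c z s where c: "z \<in> ints" "(\<Sum>s\<in>insert x S. of_int (c s) * s) = of_int p * z"
      "s \<in> insert x S" "\<not> p dvd c s"
      using fin S_ints x unfolding indep_def by blast
    have eq: "of_int (c x) * x + (\<Sum>s\<in>S. of_int (c s) * s) = of_int p * z"
      using c(2) False fin by simp
    \<comment> \<open>Otherwise the term of x moves to the right-hand side and leaves a relation
      within S, whose coefficients are all divisible by p.\<close>
    have "\<not> p dvd c x"
    proof
      assume "p dvd c x"
      then obtain m where m: "c x = p * m" ..
      have "(\<Sum>s\<in>S. of_int (c s) * s) = of_int p * (z - of_int m * x)"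
        using eq m by (simp add: algebra_simps)
      moreover have "z - of_int m * x \<in> ints"
        using c(1) x by (intro ints_closed ints_of_int)
      ultimately have "\<forall>s\<in>S. p dvd c s"
        using S unfolding indep_def by blast
      then show False using c(3,4) \<open>p dvd c x\<close> by blast
    qed
    then have "coprime p (c x)"
      using p by (simp add: prime_imp_coprime)
    \<comment> \<open>u inverts the coefficient of x modulo p, so that the relation can be solved
      for x modulo p.\<close>
    then obtain u w where "u * c x + w * p = 1"
      using bezout_int[of "c x" p] by (auto simp: coprime_iff_gcd_eq_1 gcd.commute)
    then obtain v where uv: "u * c x = 1 + p * v"
      by (metis add_diff_cancel_right' diff_conv_add_uminus mult.commute mult_minus_left)
    have "x = of_int (u * c x) * x - of_int p * (of_int v * x)"
      by (simp add: uv algebra_simps)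
    also have "of_int (u * c x) * x = of_int u * (of_int (c x) * x)"
      by simp
    also have "of_int (c x) * x = of_int p * z - (\<Sum>s\<in>S. of_int (c s) * s)"
      using eq by (simp add: eq_diff_eq)
    finally have "x = (\<Sum>s\<in>S. of_int (- u * c s) * s) + of_int p * (of_int u * z - of_int v * x)"
      by (simp add: right_diff_distrib sum_distrib_left sum_negf mult_ac diff_diff_eq add.commute)
    moreover obtain y z' where "y \<in> F" "z' \<in> ints" "(\<Sum>s\<in>S. of_int (- u * c s) * s) = y + of_int p * z'"
      using reduce[of "\<lambda>s. - u * c s"] by blast
    ultimately have "x = y + of_int p * (z' + (of_int u * z - of_int v * x))"
      by (simp add: algebra_simps)
    moreover have "z' + (of_int u * z - of_int v * x) \<in> ints"
      using \<open>z' \<in> ints\<close> c(1) x by (intro ints_closed ints_of_int)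
    ultimately show ?thesis using \<open>y \<in> F\<close> by blast
  qed
  moreover have "finite F"
    unfolding F_def using fin by (intro finite_imageI finite_PiE) auto
  moreover have "F \<subseteq> ints"
    unfolding F_def using S_ints by (auto intro!: ints_sum ints_closed ints_of_int)
  ultimately show ?thesis
    unfolding finite_residues_def by blast
qed

text \<open>Two-digit expansions y + a y', with y taken modulo a and y' modulo b, represent the
  residues modulo a b.\<close>

lemma finite_residues_mult:
  assumes "finite_residues a" "finite_residues b"
  shows "finite_residues (a * b)"
proof -
  obtain F where F: "finite F" "F \<subseteq> ints" "\<forall>x\<in>ints. \<exists>y\<in>F. \<exists>z\<in>ints. x = y + of_int a * z"
    using assms(1) unfolding finite_residues_def by blast
  obtain G where G: "finite G" "G \<subseteq> ints" "\<forall>x\<in>ints. \<exists>y\<in>G. \<exists>z\<in>ints. x = y + of_int b * z"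
    using assms(2) unfolding finite_residues_def by blast
  define H where "H = (\<lambda>(y, y'). y + of_int a * y') ` (F \<times> G)"
  have "\<exists>w\<in>H. \<exists>z\<in>ints. x = w + of_int (a * b) * z" if x: "x \<in> ints" for x
  proof -
    obtain y z where y: "y \<in> F" "z \<in> ints" "x = y + of_int a * z" using F(3) x by blast
    obtain y' z' where y': "y' \<in> G" "z' \<in> ints" "z = y' + of_int b * z'" using G(3) y(2) by blast
    have "x = (y + of_int a * y') + of_int (a * b) * z'" using y y' by (simp add: algebra_simps)
    moreover have "y + of_int a * y' \<in> H" using y y' by (auto simp: H_def)
    ultimately show ?thesis using y' by blast
  qed
  moreover have "finite H" using F G by (simp add: H_def)
  moreover have "H \<subseteq> ints" using F G by (auto simp: H_def intro!: ints_closed ints_of_int)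
  ultimately show ?thesis unfolding finite_residues_def by blast
qed

lemma finite_residues_nonzero:
  assumes "m \<noteq> 0"
  shows "finite_residues m"
proof -
  have pos: "finite_residues (int k)" if "k > 0" for k
    using that
  proof (induction k rule: less_induct)
    case (less k)
    show ?case
    proof (cases "k = 1")
      case True
      have "finite {0}" "{0} \<subseteq> ints" "\<forall>x\<in>ints. \<exists>y\<in>{0}. \<exists>z\<in>ints. x = y + of_int (int 1) * z"
        by (auto intro: ints_closed)
      then show ?thesis using True unfolding finite_residues_def by blast
    next
      case False
      then obtain p where p: "Factorial_Ring.prime p" "p dvd k"
        using prime_factor_nat by blast
      then obtain l where l: "k = p * l" by auto
      then have "l < k" "l > 0"
        using less.prems p prime_gt_1_nat[OF p(1)] by auto
      then show ?thesis
        using less.IH[of l] finite_residues_prime[of "int p"] p(1) l finite_residues_mult by simp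
    qed
  qed
  have neg: "finite_residues (- m)" if m: "finite_residues m" for m
  proof -
    obtain F where F: "finite F" "F \<subseteq> ints" "\<forall>x\<in>ints. \<exists>y\<in>F. \<exists>z\<in>ints. x = y + of_int m * z"
      using m unfolding finite_residues_def by blast
    have "\<exists>y\<in>F. \<exists>z\<in>ints. x = y + of_int (- m) * z" if x: "x \<in> ints" for x
    proof -
      obtain y z where "y \<in> F" "z \<in> ints" "x = y + of_int m * z" using F(3) x by blast
      then have "x = y + of_int (- m) * (- z)" "- z \<in> ints" by (auto intro: ints_closed)
      then show ?thesis using \<open>y \<in> F\<close> by blast
    qed
    then show ?thesis using F unfolding finite_residues_def by blast
  qed
  show ?thesis
    using assms pos[of "nat m"] neg[OF pos[of "nat (- m)"]] by (cases "m > 0") auto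
qed

text \<open>The constant term of an equation of x is a multiple of x. Factors X are stripped off by
  the induction as long as the constant term vanishes, which is legitimate for nonzero x.\<close>

lemma root_divides_integer:
  fixes p :: "int poly"
  assumes x: "x \<in> ints" "x \<noteq> 0" and "p \<noteq> 0" "poly (map_poly of_int p) x = 0"
  shows "\<exists>m\<noteq>0. \<exists>y\<in>ints. of_int m = x * y"
  using assms(3,4)
proof (induction p)
  case 0
  then show ?case by simp
next
  case (pCons a q)
  have "poly (map_poly of_int q) x \<in> ints" for q :: "int poly"
    by (induction q) (auto simp: map_poly_pCons intro: ints_closed ints_of_int x)
  then have closed: "- poly (map_poly of_int q) x \<in> ints"
    by (intro ints_closed)
  have eq: "of_int a + x * poly (map_poly of_int q) x = 0"
    using pCons.prems(2) pCons.hyps by (simp add: map_poly_pCons)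
  show ?case
  proof (cases "a = 0")
    case True
    then show ?thesis
      using eq x(2) pCons by auto
  next
    case False
    have "of_int a = x * (- poly (map_poly of_int q) x)"
      using eq by (simp add: add_eq_0_iff2)
    then show ?thesis using False closed by blast
  qed
qed

lemma ints_divide_integer:
  assumes "x \<in> ints" "x \<noteq> 0"
  obtains m y where "m \<noteq> 0" "y \<in> ints" "of_int m = x * y"
proof -
  obtain p :: "int poly" where "lead_coeff p = 1" "poly (map_poly of_int p) x = 0"
    using assms(1) unfolding ints_def algebraic_int_altdef_ipoly by blast
  then show thesis
    using root_divides_integer[OF assms, of p] that by fastforce
qed

text \<open>A nonzero ideal contains a nonzero rational integer m, so representatives modulo m meet
  every class modulo I.\<close>

lemma finite_quotient:
  assumes I: "ideal I (ring_of_integers K)" "I \<noteq> {0}"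
  shows "finite (carrier (ring_of_integers K Quot I))"
proof -
  interpret I: ideal I "ring_of_integers K" by (rule I(1))
  have "0 \<in> I" using I.zero_closed by simp
  then obtain x where x: "x \<in> I" "x \<noteq> 0" using I(2) by blast
  then have "x \<in> ints" using I.Icarr by simp
  then obtain m y where m: "m \<noteq> 0" "y \<in> ints" "of_int m = x * y"
    using ints_divide_integer x(2) by blast
  obtain F where F: "finite F" "F \<subseteq> ints" "\<forall>x\<in>ints. \<exists>y\<in>F. \<exists>z\<in>ints. x = y + of_int m * z"
    using finite_residues_nonzero[OF m(1)] unfolding finite_residues_def by blast
  have "carrier (ring_of_integers K Quot I) \<subseteq> (\<lambda>y. I +>\<^bsub>ring_of_integers K\<^esub> y) ` F"
  proof
    fix C assume "C \<in> carrier (ring_of_integers K Quot I)"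
    then obtain w where w: "w \<in> ints" "C = I +>\<^bsub>ring_of_integers K\<^esub> w"
      unfolding FactRing_def A_RCOSETS_def' by auto
    obtain v z where v: "v \<in> F" "z \<in> ints" "w = v + of_int m * z" using F(3) w(1) by blast
    have "w - v = x * (y * z)" using v m(3) by simp
    moreover have "x * (y * z) \<in> I"
      using I.I_r_closed[OF x(1), of "y * z"] m(2) v(2) ints_closed by simp
    moreover have "v \<in> ints" using v(1) F(2) by blast
    ultimately have "C = I +>\<^bsub>ring_of_integers K\<^esub> v"
      using quotient_eq_iff_same_a_r_cos[OF I(1), of w v] w by simp
    then show "C \<in> (\<lambda>y. I +>\<^bsub>ring_of_integers K\<^esub> y) ` F" using v(1) by blast
  qed
  then show ?thesis using F(1) finite_subset by blast
qed

end

section \<open>Factorisation of ideals in rings of integers\<close>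

text \<open>The ideals above I correspond to ideals of the finite ring R/I, which are subsets of a
  finite set.\<close>

lemma (in ring) finite_ideals_containing:
  assumes "ideal I R" "finite (carrier (R Quot I))"
  shows "finite {J. ideal J R \<and> I \<subseteq> J}"
proof -
  have "{J. ideal J (R Quot I)} \<subseteq> Pow (carrier (R Quot I))"
    using additive_subgroup.a_subset ideal.axioms(1) by blast
  then have "finite {J. ideal J (R Quot I)}"
    using assms(2) finite_subset by blast
  then show ?thesis
    using quot_ideal_correspondence[OF assms(1)] bij_betw_finite by blast
qed

text \<open>With finitely many ideals above I, a maximal proper one is found by inspection instead
  of Zorn's lemma.\<close>

lemma (in ring) exists_maximal_ideal_containing:
  assumes I: "ideal I R" "finite (carrier (R Quot I))" "I \<noteq> carrier R"
  obtains M where "maximalideal M R" "I \<subseteq> M"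
proof -
  define S where "S = {J. ideal J R \<and> I \<subseteq> J \<and> J \<noteq> carrier R}"
  have "finite S"
    using finite_ideals_containing[OF I(1,2)] by (rule rev_finite_subset) (auto simp: S_def)
  moreover have "I \<in> S"
    using I by (simp add: S_def)
  ultimately obtain M where "M \<in> S" and S_max: "\<And>J. J \<in> S \<Longrightarrow> M \<subseteq> J \<Longrightarrow> M = J"
    using finite_has_maximal[of S] by blast
  then have M: "ideal M R" "I \<subseteq> M" "M \<noteq> carrier R"
    by (auto simp: S_def)
  have "maximalideal M R"
  proof (rule maximalidealI[OF M(1)])
    fix J assume "ideal J R" "M \<subseteq> J"
    then show "J = M \<or> J = carrier R" using S_max[of J] M(2) unfolding S_def by blast
  qed (use M in auto)
  then show thesis using M(2) that by blast
qed

lemma ideal_prod_induct_closed: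
  assumes "x \<in> ideal_prod R I J" "\<And>i j. i \<in> I \<Longrightarrow> j \<in> J \<Longrightarrow> i \<otimes>\<^bsub>R\<^esub> j \<in> C"
    and "\<And>x y. x \<in> C \<Longrightarrow> y \<in> C \<Longrightarrow> x \<oplus>\<^bsub>R\<^esub> y \<in> C"
  shows "x \<in> C"
  using assms(1) by (induction rule: ideal_prod.induct) (use assms in auto)

lemma ideal_prod_mono:
  assumes "I \<subseteq> I'" "J \<subseteq> J'"
  shows "ideal_prod R I J \<subseteq> ideal_prod R I' J'"
proof
  fix x assume "x \<in> ideal_prod R I J"
  then show "x \<in> ideal_prod R I' J'"
    by (rule ideal_prod_induct_closed) (use assms in \<open>auto intro: ideal_prod.intros\<close>)
qed

section \<open>Invertibility of ideals in the ring of integers\<close>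

context number_field_integers
begin

abbreviation R :: "'a ring" where "R \<equiv> ring_of_integers K"

lemma ideal_closed:
  assumes "ideal I R"
  shows "I \<subseteq> ints" "0 \<in> I" "x \<in> I \<Longrightarrow> y \<in> I \<Longrightarrow> x + y \<in> I" "x \<in> I \<Longrightarrow> - x \<in> I"
    "x \<in> I \<Longrightarrow> y \<in> ints \<Longrightarrow> x * y \<in> I" "x \<in> I \<Longrightarrow> y \<in> ints \<Longrightarrow> y * x \<in> I" "x \<in> I \<Longrightarrow> y \<in> I \<Longrightarrow> x - y \<in> I"
proof -
  interpret I: ideal I R by (rule assms)
  show *: "I \<subseteq> ints" "0 \<in> I" "x \<in> I \<Longrightarrow> y \<in> I \<Longrightarrow> x + y \<in> I"
    "x \<in> I \<Longrightarrow> y \<in> ints \<Longrightarrow> x * y \<in> I" "x \<in> I \<Longrightarrow> y \<in> ints \<Longrightarrow> y * x \<in> I" for x y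
    using I.a_subset I.zero_closed I.a_closed I.I_l_closed I.I_r_closed by simp_all
  show minus: "x \<in> I \<Longrightarrow> - x \<in> I" for x
    using I.a_inv_closed[of x] a_inv_integers[of x] *(1) by (metis subsetD)
  show "x \<in> I \<Longrightarrow> y \<in> I \<Longrightarrow> x - y \<in> I"
    using *(3)[of x "- y"] minus by simp
qed

lemma idealI_integers:
  assumes "I \<subseteq> ints" "0 \<in> I" "\<And>x y. x \<in> I \<Longrightarrow> y \<in> I \<Longrightarrow> x + y \<in> I"
    and "\<And>x y. x \<in> I \<Longrightarrow> y \<in> ints \<Longrightarrow> y * x \<in> I"
  shows "ideal I R"
proof (rule idealI)
  show "subgroup I (add_monoid R)"
  proof (rule add.subgroupI)
    fix x assume "x \<in> I"
    then show "\<ominus>\<^bsub>R\<^esub> x \<in> I"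
      using assms(1) assms(4)[of x "- 1"] ints_closed(2,3) by auto
  qed (use assms in auto)
qed (use assms ring_axioms in \<open>auto simp: mult.commute\<close>)

lemma coset_eq_iff:
  assumes "ideal I R" "x \<in> ints" "y \<in> ints"
  shows "I +>\<^bsub>R\<^esub> x = I +>\<^bsub>R\<^esub> y \<longleftrightarrow> x - y \<in> I"
  using quotient_eq_iff_same_a_r_cos[OF assms(1), of x y] assms(2,3) by simp

lemma finite_cosets:
  assumes "ideal I R" "I \<noteq> {0}"
  shows "finite ((\<lambda>x. I +>\<^bsub>R\<^esub> x) ` ints)"
proof -
  have "(\<lambda>x. I +>\<^bsub>R\<^esub> x) ` ints = carrier (R Quot I)"
    by (auto simp: FactRing_def A_RCOSETS_def')
  then show ?thesis using finite_quotient[OF assms] by simp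
qed

lemma ideal_principal: "a \<in> ints \<Longrightarrow> ideal ((*) a ` ints) R"
proof (rule idealI_integers)
  assume a: "a \<in> ints"
  show "0 \<in> (*) a ` ints" by (rule image_eqI[of _ _ 0]) (auto intro: ints_closed)
  show "x + y \<in> (*) a ` ints" if "x \<in> (*) a ` ints" "y \<in> (*) a ` ints" for x y
    using that by (auto simp: distrib_left[symmetric] intro: ints_closed)
  show "y * x \<in> (*) a ` ints" if "x \<in> (*) a ` ints" "y \<in> ints" for x y
    using that by (auto simp: mult.left_commute intro: ints_closed)
qed (auto intro: ints_closed)

lemma principal_nonzero: "a \<noteq> 0 \<Longrightarrow> (*) a ` ints \<noteq> {0}"
  using ints_closed(2) by (auto simp: image_iff set_eq_iff)

text \<open>By pigeonhole modulo \<open>j\<close>, two powers of \<open>g\<close> differ by an algebraic integer.\<close>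

lemma stable_imp_algebraic_int:
  assumes J: "J \<subseteq> ints" "j \<in> J" "j \<noteq> 0" "\<And>x. x \<in> J \<Longrightarrow> g * x \<in> J"
  shows "algebraic_int g"
proof -
  have j: "j \<in> ints" using J by blast
  have mem: "g ^ i * j \<in> J" for i
    by (induction i) (auto simp: J mult.assoc)
  \<comment> \<open>The powers of g are not known to be integral, but their products with j lie in
    J; hence these products are classified modulo j.\<close>
  define c where "c i = ((*) j ` ints) +>\<^bsub>R\<^esub> (g ^ i * j)" for i
  have "finite (range c)"
    using finite_cosets[OF ideal_principal[OF j] principal_nonzero[OF J(3)]] mem J(1)
    by (auto simp: c_def intro: finite_subset[rotated])
  then have "\<not> inj c"
    using range_inj_infinite by blast
  then obtain i k where ik: "i < k" "c i = c k"
    unfolding inj_on_def by (metis linorder_neqE_nat)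
  then have "g ^ k * j - g ^ i * j \<in> (*) j ` ints"
    using coset_eq_iff[OF ideal_principal[OF j], of "g ^ k * j" "g ^ i * j"] mem J(1) by (auto simp: c_def)
  then obtain y where y: "y \<in> ints" "g ^ k * j - g ^ i * j = j * y" by blast
  then have "j * (g ^ k - g ^ i) = j * y"
    by (simp add: algebra_simps)
  then have "g ^ k - g ^ i = y"
    using J(3) by simp
  then show ?thesis
    using y(1) ik(1) by (intro algebraic_int_power_diff_imp_algebraic_int[of g k i]) (auto simp: ints_def)
qed

text \<open>The fraction b/a will be an element of the inverse of P that is not in the ring. It
  comes from an element that survives localisation at P modulo a and generates as small an ideal
  there as possible: an argument in the style of Nakayama shows that P kills it up to factors
  outside P, and finitely many such factors suffice.\<close>

lemma maximal_ideal_annihilator: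
  assumes P: "maximalideal P R" and a: "a \<in> P" "a \<noteq> 0"
  obtains b where "b \<in> ints" "b \<notin> (*) a ` ints" "\<And>z. z \<in> P \<Longrightarrow> b * z \<in> (*) a ` ints"
proof -
  interpret P: maximalideal P R by (rule P)
  have prime: "primeideal P R" using maximalideal_prime[OF P] .
  have P_ideal: "ideal P R" by (rule P.is_ideal)
  note Pc = ideal_closed[OF P_ideal]
  have one: "1 \<notin> P" using P.one_imp_carrier P.I_notcarr by auto
  have P_mult: "x * y \<notin> P" if "x \<in> ints" "y \<in> ints" "x \<notin> P" "y \<notin> P" for x y
    using primeideal.I_prime[OF prime, of x y] that by auto
  have a': "a \<in> ints" using a Pc by blast
  define A where "A = (*) a ` ints"
  have A: "ideal A R" "A \<noteq> {0}" using ideal_principal[OF a'] principal_nonzero[OF a(2)] by (auto simp: A_def)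
  note Ac = ideal_closed[OF A(1)]
  have "A \<subseteq> P" using Pc(5)[OF a(1)] by (auto simp: A_def)
  \<comment> \<open>\<open>B b\<close> says that b stays nonzero modulo a after localisation at P.
    \<open>C b\<close> is the ideal generated by b in the residue ring modulo a, whose size is
    minimised.\<close>
  define B where "B b \<longleftrightarrow> b \<in> ints \<and> (\<forall>u\<in>ints. u \<notin> P \<longrightarrow> u * b \<notin> A)" for b
  define C where "C b = (\<lambda>y. A +>\<^bsub>R\<^esub> (b * y)) ` ints" for b
  have fin: "finite (C b)" if "b \<in> ints" for b
    using that by (intro finite_subset[OF _ finite_cosets[OF A]]) (auto simp: C_def intro: ints_closed)
  have "B 1" using \<open>A \<subseteq> P\<close> by (auto simp: B_def intro: ints_closed)
  then obtain b where b: "B b" and min: "\<And>b'. B b' \<Longrightarrow> card (C b) \<le> card (C b')"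
    using ex_has_least_nat[of B 1 "card \<circ> C"] by auto
  have "\<exists>u\<in>ints. u \<notin> P \<and> u * (b * z) \<in> A" if z: "z \<in> P" for z
  proof (rule ccontr)
    assume "\<not> ?thesis"
    moreover have z': "z \<in> ints" using z Pc by blast
    ultimately have "B (b * z)" using b by (auto simp: B_def intro: ints_closed)
    moreover have sub: "C (b * z) \<subseteq> C b"
    proof
      fix c assume "c \<in> C (b * z)"
      then obtain y where y: "y \<in> ints" "c = A +>\<^bsub>R\<^esub> (b * (z * y))" by (auto simp: C_def mult.assoc)
      moreover have "z * y \<in> ints" using z' y by (intro ints_closed)
      ultimately show "c \<in> C b" unfolding C_def by blast
    qed
    \<comment> \<open>By minimality b is a multiple b z y of b z modulo a, so (1 - z y) b lies in
      \<open>A\<close>. Then \<open>B b\<close> forces 1 - z y into P, and 1 with it.\<close>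
    ultimately have "C (b * z) = C b"
      using min fin b by (metis B_def card_seteq)
    moreover have "A +>\<^bsub>R\<^esub> (b * 1) \<in> C b" unfolding C_def using ints_closed(2) by blast
    ultimately have "A +>\<^bsub>R\<^esub> (b * 1) \<in> C (b * z)" by (simp only:)
    then obtain y where y: "y \<in> ints" "A +>\<^bsub>R\<^esub> b = A +>\<^bsub>R\<^esub> (b * z * y)"
      unfolding C_def by auto
    have "b \<in> ints" using b by (simp add: B_def)
    then have "b - b * z * y \<in> A"
      using coset_eq_iff[OF A(1), of b "b * z * y"] y z' by (auto intro: ints_closed)
    then have "(1 - z * y) * b \<in> A" by (simp add: algebra_simps)
    moreover have "1 - z * y \<in> ints" using y z' by (intro ints_closed)
    ultimately have "1 - z * y \<in> P" using b unfolding B_def by blast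
    moreover have "z * y \<in> P" using Pc(5)[OF z y(1)] .
    ultimately have "1 \<in> P" using Pc(3)[of "1 - z * y" "z * y"] by simp
    then show False using one by simp
  qed
  then obtain u where u: "\<And>z. z \<in> P \<Longrightarrow> u z \<in> ints \<and> u z \<notin> P \<and> u z * (b * z) \<in> A"
    by metis
  have "finite ((\<lambda>z. A +>\<^bsub>R\<^esub> z) ` P)"
    using finite_subset[OF image_mono[OF Pc(1)] finite_cosets[OF A]] .
  then obtain F where F: "F \<subseteq> P" "finite F" "(\<lambda>z. A +>\<^bsub>R\<^esub> z) ` P = (\<lambda>z. A +>\<^bsub>R\<^esub> z) ` F"
    by (metis finite_subset_image subset_refl)
  \<comment> \<open>One factor outside P for each class of P modulo a; their product still avoids P,
    and b s is killed by all of P.\<close>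
  define s where "s = prod u F"
  have prod_u: "prod u G \<in> ints \<and> prod u G \<notin> P" if "G \<subseteq> F" for G
    using finite_subset[OF that F(2)] that
  proof (induction G rule: finite_induct)
    case empty
    then show ?case using one ints_closed(2) by simp
  next
    case (insert z G)
    then show ?case using u[of z] F(1) P_mult by (auto intro: ints_closed)
  qed
  have s: "s \<in> ints" "s \<notin> P" using prod_u[of F] by (auto simp: s_def)
  have "b * s * z \<in> A" if z: "z \<in> P" for z
  proof -
    obtain w where w: "w \<in> F" "A +>\<^bsub>R\<^esub> z = A +>\<^bsub>R\<^esub> w" using F(3) z by blast
    have w': "w \<in> ints" "z \<in> ints" "b \<in> ints" using w F(1) Pc(1) z b by (auto simp: B_def)
    then have d: "z - w \<in> A" using coset_eq_iff[OF A(1), of z w] w by simp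
    have "s = u w * prod u (F - {w})" unfolding s_def using F(2) w(1) by (simp add: prod.remove)
    then have "b * s * w = (u w * (b * w)) * prod u (F - {w})" by (simp add: mult_ac)
    also have "\<dots> \<in> A" using u[of w] w(1) F(1) prod_u[of "F - {w}"] Ac(5) by blast
    finally have "b * s * w \<in> A" .
    moreover have "b * s * (z - w) \<in> A" using Ac(6)[OF d, of "b * s"] w' s ints_closed(5) by blast
    ultimately have "b * s * w + b * s * (z - w) \<in> A" by (rule Ac(3))
    then show ?thesis by (simp add: algebra_simps)
  qed
  moreover have "s * b \<notin> A" using b s by (auto simp: B_def)
  moreover have "b * s \<in> ints" using b s by (auto simp: B_def intro: ints_closed)
  ultimately show thesis using that[of "b * s"] by (simp add: A_def mult.commute)
qed

text \<open>With \<open>\<alpha> \<in> I\<close> and \<open>J = {\<beta>. \<beta> I \<subseteq> (\<alpha>)}\<close>, the ideal \<open>A = I J / \<alpha>\<close> is the whole ring: otherwise \<open>A\<close> lies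
  in a maximal ideal, which some non-integral \<open>g = b / \<alpha>\<close> maps into the ring, and then \<open>g J \<subseteq> J\<close>.\<close>

lemma ideal_has_principal_multiple:
  assumes I: "ideal I R" "I \<noteq> {0}"
  obtains J \<alpha> where "ideal J R" "\<alpha> \<in> ints" "\<alpha> \<noteq> 0" "ideal_prod R I J = (*) \<alpha> ` ints"
proof -
  note Ic = ideal_closed[OF I(1)]
  obtain \<alpha> where \<alpha>: "\<alpha> \<in> I" "\<alpha> \<noteq> 0" using I Ic(2) by blast
  have \<alpha>': "\<alpha> \<in> ints" using \<alpha> Ic by blast
  define J where "J = {\<beta> \<in> ints. \<forall>x\<in>I. \<beta> * x \<in> (*) \<alpha> ` ints}"
  note Pc = ideal_closed[OF ideal_principal[OF \<alpha>']]
  have J: "ideal J R"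
  proof (rule idealI_integers)
    show "0 \<in> J" using Pc(2) by (auto simp: J_def intro: ints_closed)
    show "x + y \<in> J" if "x \<in> J" "y \<in> J" for x y
      using that Pc(3) by (simp add: J_def ints_closed distrib_right)
    show "y * x \<in> J" if "x \<in> J" "y \<in> ints" for x y
      using that Pc(6) by (simp add: J_def ints_closed mult.assoc)
  qed (auto simp: J_def)
  note Jc = ideal_closed[OF J]
  have \<alpha>J: "\<alpha> \<in> J" using \<alpha>' Ic by (auto simp: J_def)
  define A where "A = {y \<in> ints. \<alpha> * y \<in> ideal_prod R I J}"
  have IJ: "ideal (ideal_prod R I J) R" using ideal_prod_is_ideal[OF I(1) J] .
  note IJc = ideal_closed[OF IJ]
  have A: "ideal A R"
  proof (rule idealI_integers)
    show "0 \<in> A" using IJc(2) by (auto simp: A_def intro: ints_closed)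
    show "x + y \<in> A" if "x \<in> A" "y \<in> A" for x y
      using that IJc(3) by (simp add: A_def ints_closed distrib_left)
    show "y * x \<in> A" if "x \<in> A" "y \<in> ints" for x y
      using that IJc(6)[of "\<alpha> * x" y] by (simp add: A_def ints_closed mult.left_commute)
  qed (auto simp: A_def)
  have mult_IJ: "i * j \<in> ideal_prod R I J" if "i \<in> I" "j \<in> J" for i j
    using ideal_prod.prod[OF that, of R] by simp
  have JA: "J \<subseteq> A" using mult_IJ \<alpha>(1) Jc(1) by (auto simp: A_def)
  have sub: "ideal_prod R I J \<subseteq> (*) \<alpha> ` ints"
  proof
    fix x assume "x \<in> ideal_prod R I J"
    then show "x \<in> (*) \<alpha> ` ints"
    proof (rule ideal_prod_induct_closed)
      fix i j assume "i \<in> I" "j \<in> J"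
      then have "j * i \<in> (*) \<alpha> ` ints" unfolding J_def by blast
      then show "i \<otimes>\<^bsub>R\<^esub> j \<in> (*) \<alpha> ` ints" by (simp add: mult.commute)
    qed (use Pc(3) in simp)
  qed
  have "A = ints"
  proof (rule ccontr)
    assume "A \<noteq> ints"
    have "A \<noteq> {0}" using \<alpha>J JA \<alpha>(2) by blast
    then obtain P where P: "maximalideal P R" "A \<subseteq> P"
      using exists_maximal_ideal_containing[OF A finite_quotient[OF A]] \<open>A \<noteq> ints\<close> by auto
    have aP: "\<alpha> \<in> P" using P \<alpha>J JA by blast
    obtain b where b: "b \<in> ints" "b \<notin> (*) \<alpha> ` ints" "\<And>z. z \<in> P \<Longrightarrow> b * z \<in> (*) \<alpha> ` ints"
      using maximal_ideal_annihilator[OF P(1) aP \<alpha>(2)] by blast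
    define g where "g = b / \<alpha>"
    have gP: "g * z \<in> ints" if "z \<in> P" for z
      using b(3)[OF that] \<alpha>(2) by (auto simp: g_def)
    have "g * \<beta> \<in> J" if \<beta>: "\<beta> \<in> J" for \<beta>
      unfolding J_def
    proof (intro CollectI conjI ballI)
      show "g * \<beta> \<in> ints" using gP \<beta> JA P(2) by blast
      fix x assume x: "x \<in> I"
      \<comment> \<open>The y obtained next is x \<beta> / \<alpha>. It lies in \<open>A\<close>,
        hence in P, and g is integral on P; multiplying back by \<alpha> gives the condition for g
        \<beta> to be in \<open>J\<close>.\<close>
      have "x * \<beta> \<in> (*) \<alpha> ` ints" using mult_IJ[OF x \<beta>] sub by blast
      then obtain y where y: "y \<in> ints" "x * \<beta> = \<alpha> * y" by blast
      then have "y \<in> A" using mult_IJ[OF x \<beta>] by (auto simp: A_def)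
      then have "g * y \<in> ints" using gP P(2) by blast
      moreover have "g * \<beta> * x = \<alpha> * (g * y)" using y(2) by (metis mult.assoc mult.commute)
      ultimately show "g * \<beta> * x \<in> (*) \<alpha> ` ints" by (metis image_eqI)
    qed
    then have "algebraic_int g" using stable_imp_algebraic_int[OF Jc(1) \<alpha>J \<alpha>(2)] by blast
    moreover have "g \<in> K" using b(1) \<alpha>' K_closed by (simp add: g_def ints_def divide_inverse)
    ultimately have "g \<in> ints" by (simp add: ints_def)
    moreover have "b = \<alpha> * g" using \<alpha>(2) by (simp add: g_def)
    ultimately show False using b(2) by blast
  qed
  then have "(*) \<alpha> ` ints \<subseteq> ideal_prod R I J" by (auto simp: A_def)
  then show thesis using that[OF J \<alpha>' \<alpha>(2)] sub by blast
qed

lemma ideal_prod_principal: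
  assumes "\<alpha> \<in> ints" "ideal V R"
  shows "ideal_prod R ((*) \<alpha> ` ints) V = (*) \<alpha> ` V"
proof
  note Vc = ideal_closed[OF assms(2)]
  show "ideal_prod R ((*) \<alpha> ` ints) V \<subseteq> (*) \<alpha> ` V"
  proof
    fix x assume "x \<in> ideal_prod R ((*) \<alpha> ` ints) V"
    then show "x \<in> (*) \<alpha> ` V"
    proof (rule ideal_prod_induct_closed)
      fix i j assume "i \<in> (*) \<alpha> ` ints" "j \<in> V"
      then show "i \<otimes>\<^bsub>R\<^esub> j \<in> (*) \<alpha> ` V" using Vc(6) by (auto simp: mult.assoc)
    next
      fix x y assume "x \<in> (*) \<alpha> ` V" "y \<in> (*) \<alpha> ` V"
      then show "x \<oplus>\<^bsub>R\<^esub> y \<in> (*) \<alpha> ` V" using Vc(3) by (auto simp: distrib_left[symmetric])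
    qed
  qed
  show "(*) \<alpha> ` V \<subseteq> ideal_prod R ((*) \<alpha> ` ints) V"
  proof
    fix x assume "x \<in> (*) \<alpha> ` V"
    then obtain y where y: "y \<in> V" "x = \<alpha> * y" by auto
    have "\<alpha> \<in> (*) \<alpha> ` ints" using ints_closed(2) by (intro image_eqI[of _ _ 1]) auto
    then show "x \<in> ideal_prod R ((*) \<alpha> ` ints) V" using ideal_prod.prod[OF _ y(1), of \<alpha> _ R] y(2) by simp
  qed
qed

text \<open>Multiplication by J replaces I by a principal ideal (\<alpha>), and multiplication by
  the nonzero number \<alpha> is injective.\<close>

lemma ideal_prod_cancel:
  assumes I: "ideal I R" "I \<noteq> {0}" and V: "ideal V R" and W: "ideal W R"
    and eq: "ideal_prod R I V = ideal_prod R I W"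
  shows "V = W"
proof -
  obtain J \<alpha> where J: "ideal J R" "\<alpha> \<in> ints" "\<alpha> \<noteq> 0" "ideal_prod R I J = (*) \<alpha> ` ints"
    using ideal_has_principal_multiple[OF I] by blast
  have "(*) \<alpha> ` V = ideal_prod R (ideal_prod R J I) V"
    using ideal_prod_principal[OF J(2) V] J(4) ideal_prod_commute[OF I(1) J(1)] by simp
  also have "\<dots> = ideal_prod R (ideal_prod R J I) W"
    using ideal_prod_assoc[OF J(1) I(1)] V W eq by simp
  also have "\<dots> = (*) \<alpha> ` W"
    using ideal_prod_principal[OF J(2) W] J(4) ideal_prod_commute[OF I(1) J(1)] by simp
  finally show ?thesis
    using J(3) by (simp add: inj_image_eq_iff inj_on_def)
qed

text \<open>The cofactor is V times the inverse of I. With I J = (\<alpha>) this is J V / \<alpha>,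
  integral because V \<subseteq> I puts J V into (\<alpha>).\<close>

lemma ideal_contains_imp_divides:
  assumes I: "ideal I R" "I \<noteq> {0}" and V: "ideal V R" "V \<subseteq> I"
  obtains C where "ideal C R" "V = ideal_prod R I C"
proof -
  obtain J \<alpha> where J: "ideal J R" "\<alpha> \<in> ints" "\<alpha> \<noteq> 0" "ideal_prod R I J = (*) \<alpha> ` ints"
    using ideal_has_principal_multiple[OF I] by blast
  define C where "C = {y \<in> ints. \<alpha> * y \<in> ideal_prod R J V}"
  have JX: "ideal (ideal_prod R J V) R" using ideal_prod_is_ideal[OF J(1) V(1)] .
  note JXc = ideal_closed[OF JX]
  have C: "ideal C R"
  proof (rule idealI_integers)
    show "0 \<in> C" using JXc(2) by (auto simp: C_def intro: ints_closed)
    show "x + y \<in> C" if "x \<in> C" "y \<in> C" for x y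
      using that JXc(3) by (simp add: C_def ints_closed distrib_left)
    show "y * x \<in> C" if "x \<in> C" "y \<in> ints" for x y
      using that JXc(6)[of "\<alpha> * x" y] by (simp add: C_def ints_closed mult.left_commute)
  qed (auto simp: C_def)
  have "ideal_prod R J V \<subseteq> ideal_prod R I J"
    using ideal_prod_mono[OF subset_refl V(2)] ideal_prod_commute[OF I(1) J(1)] by blast
  then have \<alpha>C: "(*) \<alpha> ` C = ideal_prod R J V"
    using J(4) by (auto simp: C_def)
  have "(*) \<alpha> ` ideal_prod R I C = ideal_prod R (ideal_prod R I C) ((*) \<alpha> ` ints)"
    using ideal_prod_principal[OF J(2)] ideal_prod_commute ideal_prod_is_ideal I(1) C ideal_principal[OF J(2)]
    by metis
  also have "\<dots> = ideal_prod R I ((*) \<alpha> ` C)"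
    using ideal_prod_principal[OF J(2) C] ideal_prod_commute[OF C ideal_principal[OF J(2)]]
      ideal_prod_assoc[OF I(1) C ideal_principal[OF J(2)]] by simp
  also have "\<dots> = ideal_prod R ((*) \<alpha> ` ints) V"
    using ideal_prod_assoc[OF I(1) J(1) V(1)] J(4) \<alpha>C by simp
  also have "\<dots> = (*) \<alpha> ` V"
    by (rule ideal_prod_principal[OF J(2) V(1)])
  finally have "V = ideal_prod R I C"
    using J(3) by (simp add: inj_image_eq_iff inj_on_def)
  then show thesis using C that by blast
qed

end

section \<open>Residue classes\<close>

lemma carrier_quotient: "carrier (R Quot n) = (\<lambda>x. n +>\<^bsub>R\<^esub> x) ` carrier R"
  by (auto simp: FactRing_def A_RCOSETS_def')

lemma class_rep_mem: "A \<noteq> {} \<Longrightarrow> class_rep A \<in> A"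
  unfolding class_rep_def by (simp add: some_in_eq)

text \<open>The natural map from R/n to R/l for n \<subseteq> l. The modulus n is not an argument,
  since a representative of the class suffices; its choice is immaterial when n \<subseteq>
  l.\<close>

definition reduce_class :: "('a, 'b) ring_scheme \<Rightarrow> 'a set \<Rightarrow> 'a set \<Rightarrow> 'a set" where
  "reduce_class R l A = l +>\<^bsub>R\<^esub> class_rep A"

context cring
begin

lemma quotient_ops:
  assumes "ideal n R" "x \<in> carrier R" "y \<in> carrier R"
  shows "(n +> x) \<otimes>\<^bsub>R Quot n\<^esub> (n +> y) = n +> (x \<otimes> y)"
    and "(n +> x) \<oplus>\<^bsub>R Quot n\<^esub> (n +> y) = n +> (x \<oplus> y)"
    and "\<one>\<^bsub>R Quot n\<^esub> = n +> \<one>" "\<zero>\<^bsub>R Quot n\<^esub> = n"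
    and "n +> x \<in> carrier (R Quot n)"
    and "n +> x = n +> y \<longleftrightarrow> x \<ominus> y \<in> n"
proof -
  interpret n: ideal n R by (rule assms)
  show "(n +> x) \<otimes>\<^bsub>R Quot n\<^esub> (n +> y) = n +> (x \<otimes> y)"
    using n.rcoset_mult_add assms by (simp add: FactRing_def)
  show "(n +> x) \<oplus>\<^bsub>R Quot n\<^esub> (n +> y) = n +> (x \<oplus> y)"
    using n.a_rcos_sum assms by (simp add: FactRing_def)
  show "n +> x = n +> y \<longleftrightarrow> x \<ominus> y \<in> n"
    using quotient_eq_iff_same_a_r_cos assms by blast
  show "n +> x \<in> carrier (R Quot n)"
    using assms by (simp add: carrier_quotient)
qed (simp_all add: FactRing_def)

lemma quotient_cring: "ideal n R \<Longrightarrow> cring (R Quot n)"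
  using ideal.quotient_is_cring is_cring by blast

lemma class_rep_quotient:
  assumes "ideal n R" "A \<in> carrier (R Quot n)"
  shows "class_rep A \<in> carrier R" "n +> class_rep A = A"
proof -
  interpret n: ideal n R by (rule assms)
  obtain x where x: "x \<in> carrier R" "A = n +> x"
    using assms(2) by (auto simp: carrier_quotient)
  then have "class_rep A \<in> A"
    using n.a_rcos_self[OF x(1)] by (intro class_rep_mem) auto
  then show 1: "class_rep A \<in> carrier R"
    using n.a_rcosets_carrier assms(2) by (auto simp: FactRing_def)
  show "n +> class_rep A = A"
    using \<open>class_rep A \<in> A\<close> x a_repr_independence[OF _ x(1) n.a_subgroup] by metis
qed

lemma quotient_cases:
  assumes "ideal n R" "A \<in> carrier (R Quot n)"
  obtains x where "x \<in> carrier R" "A = n +> x"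
  using class_rep_quotient[OF assms] by metis

lemma reduce_class_coset:
  assumes n: "ideal n R" and l: "ideal l R" and sub: "n \<subseteq> l" and x: "x \<in> carrier R"
  shows "reduce_class R l (n +> x) = l +> x"
proof -
  have A: "n +> x \<in> carrier (R Quot n)"
    using quotient_ops(5)[OF n x x] .
  have "class_rep (n +> x) \<ominus> x \<in> n"
    using class_rep_quotient[OF n A] quotient_ops(6)[OF n] x by blast
  then show ?thesis
    unfolding reduce_class_def
    using quotient_ops(6)[OF l class_rep_quotient(1)[OF n A] x] sub by blast
qed

lemma reduce_class_hom:
  assumes n: "ideal n R" and l: "ideal l R" and sub: "n \<subseteq> l"
  shows "ring_hom_cring (R Quot n) (R Quot l) (reduce_class R l)"
proof (rule ring_hom_cringI)
  show "reduce_class R l \<in> Ring.ring_hom (R Quot n) (R Quot l)"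
  proof (rule ring_hom_memI)
    fix A assume "A \<in> carrier (R Quot n)"
    then have "class_rep A \<in> carrier R" using class_rep_quotient(1)[OF n] by blast
    then show "reduce_class R l A \<in> carrier (R Quot l)"
      using quotient_ops(5)[OF l] unfolding reduce_class_def by blast
  next
    fix A B assume "A \<in> carrier (R Quot n)" "B \<in> carrier (R Quot n)"
    then obtain x y where xy: "x \<in> carrier R" "A = n +> x" "y \<in> carrier R" "B = n +> y"
      using quotient_cases[OF n] by metis
    show "reduce_class R l (A \<otimes>\<^bsub>R Quot n\<^esub> B) = reduce_class R l A \<otimes>\<^bsub>R Quot l\<^esub> reduce_class R l B"
      using xy by (simp add: quotient_ops[OF n] quotient_ops[OF l] reduce_class_coset[OF assms])
    show "reduce_class R l (A \<oplus>\<^bsub>R Quot n\<^esub> B) = reduce_class R l A \<oplus>\<^bsub>R Quot l\<^esub> reduce_class R l B"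
      using xy by (simp add: quotient_ops[OF n] quotient_ops[OF l] reduce_class_coset[OF assms])
  next
    show "reduce_class R l \<one>\<^bsub>R Quot n\<^esub> = \<one>\<^bsub>R Quot l\<^esub>"
      using quotient_ops(3)[OF n one_closed one_closed] quotient_ops(3)[OF l one_closed one_closed]
        reduce_class_coset[OF assms one_closed] by simp
  qed
qed (use quotient_cring n l in auto)

lemma diff_mem_swap:
  assumes "ideal I R" "x \<in> carrier R" "y \<in> carrier R" "x \<ominus> y \<in> I"
  shows "y \<ominus> x \<in> I"
  using quotient_ops(6)[OF assms(1)] assms by metis

lemma diff_mem_trans:
  assumes "ideal I R" "x \<in> carrier R" "y \<in> carrier R" "z \<in> carrier R" "x \<ominus> y \<in> I" "y \<ominus> z \<in> I"
  shows "x \<ominus> z \<in> I"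
  using quotient_ops(6)[OF assms(1)] assms by metis

lemma mem_of_diff_mem:
  assumes "ideal I R" "x \<in> carrier R" "y \<in> carrier R" "x \<ominus> y \<in> I" "y \<in> I"
  shows "x \<in> I"
proof -
  interpret I: ideal I R by (rule assms)
  have "x = (x \<ominus> y) \<oplus> y" using assms by (simp add: a_minus_def a_assoc l_neg)
  then show ?thesis using I.a_closed assms by metis
qed

lemma sum_eq_carrier_iff:
  assumes "ideal I R" "ideal J R"
  shows "I <+>\<^bsub>R\<^esub> J = carrier R \<longleftrightarrow> (\<exists>i\<in>I. \<exists>j\<in>J. i \<oplus> j = \<one>)"
proof -
  interpret S: ideal "I <+>\<^bsub>R\<^esub> J" R by (rule add_ideals[OF assms])
  have "I <+>\<^bsub>R\<^esub> J = carrier R \<longleftrightarrow> \<one> \<in> I <+>\<^bsub>R\<^esub> J"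
    using S.one_imp_carrier one_closed by blast
  also have "\<dots> \<longleftrightarrow> (\<exists>i\<in>I. \<exists>j\<in>J. i \<oplus> j = \<one>)"
    unfolding set_add_def' by simp metis
  finally show ?thesis .
qed

lemma ideal_sum_subset_iff:
  assumes "ideal I R" "ideal J R" "ideal L R"
  shows "I <+>\<^bsub>R\<^esub> J \<subseteq> L \<longleftrightarrow> I \<subseteq> L \<and> J \<subseteq> L"
proof -
  have "I \<union> J \<subseteq> carrier R"
    using assms additive_subgroup.a_subset[OF ideal.axioms(1)] by blast
  then show ?thesis
    using Idl_subset_ideal[OF assms(3), of "I \<union> J"] union_genideal[OF assms(1,2)] by simp
qed

lemma cgenideal_subset_iff:
  assumes "ideal L R" "x \<in> carrier R"
  shows "PIdl x \<subseteq> L \<longleftrightarrow> x \<in> L"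
  using cgenideal_minimal[OF assms(1)] cgenideal_self[OF assms(2)] by blast

lemma chinese_remainder:
  assumes I: "ideal I R" and J: "ideal J R" and IJ: "I <+>\<^bsub>R\<^esub> J = carrier R"
    and x: "x \<in> carrier R" and y: "y \<in> carrier R"
  obtains z where "z \<in> carrier R" "z \<ominus> x \<in> I" "z \<ominus> y \<in> J"
proof -
  interpret I: ideal I R by (rule I)
  interpret J: ideal J R by (rule J)
  obtain i j where ij: "i \<in> I" "j \<in> J" "i \<oplus> j = \<one>"
    using IJ sum_eq_carrier_iff[OF I J] by blast
  have c: "i \<in> carrier R" "j \<in> carrier R" using ij by auto
  have j: "j = \<one> \<ominus> i" using ij(3) c by (metis a_comm a_minus_def add.inv_solve_right' one_closed)
  have i: "i = \<one> \<ominus> j" using ij(3) c by (metis a_minus_def add.inv_solve_right' one_closed)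
  define z where "z = x \<otimes> j \<oplus> y \<otimes> i"
  have "z \<ominus> x = i \<otimes> (y \<ominus> x)"
    unfolding z_def j using x y c by algebra
  moreover have "z \<ominus> y = j \<otimes> (x \<ominus> y)"
    unfolding z_def i using x y c by algebra
  ultimately show thesis
    using that[of z] ij x y c I.I_r_closed J.I_r_closed by (simp add: z_def)
qed

lemma coset_unit_iff:
  assumes n: "ideal n R" and x: "x \<in> carrier R"
  shows "n +> x \<in> Units (R Quot n) \<longleftrightarrow> (\<exists>y\<in>carrier R. x \<otimes> y \<ominus> \<one> \<in> n)"
proof -
  interpret Q: cring "R Quot n" by (rule quotient_cring[OF n])
  note q = quotient_ops[OF n]
  have "n +> x \<in> Units (R Quot n) \<longleftrightarrow> (\<exists>A\<in>carrier (R Quot n). (n +> x) \<otimes>\<^bsub>R Quot n\<^esub> A = \<one>\<^bsub>R Quot n\<^esub>)"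
    using q(5)[OF x x] Q.m_comm by (auto simp: Units_def)
  also have "\<dots> \<longleftrightarrow> (\<exists>y\<in>carrier R. n +> (x \<otimes> y) = n +> \<one>)"
    using q(1)[OF x] q(3)[OF x x] by (auto simp: carrier_quotient)
  also have "\<dots> \<longleftrightarrow> (\<exists>y\<in>carrier R. x \<otimes> y \<ominus> \<one> \<in> n)"
    using q(6) x by auto
  finally show ?thesis .
qed

lemma coset_unit_iff_sum:
  assumes n: "ideal n R" and x: "x \<in> carrier R"
  shows "n +> x \<in> Units (R Quot n) \<longleftrightarrow> PIdl x <+>\<^bsub>R\<^esub> n = carrier R"
proof -
  interpret n: ideal n R by (rule n)
  have "PIdl x <+>\<^bsub>R\<^esub> n = carrier R \<longleftrightarrow> (\<exists>y\<in>carrier R. \<exists>j\<in>n. y \<otimes> x \<oplus> j = \<one>)"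
    using sum_eq_carrier_iff[OF cgenideal_ideal[OF x] n] by (auto simp: cgenideal_def)
  also have "\<dots> \<longleftrightarrow> (\<exists>y\<in>carrier R. x \<otimes> y \<ominus> \<one> \<in> n)"
  proof (rule bex_cong[OF refl])
    fix y assume y: "y \<in> carrier R"
    show "(\<exists>j\<in>n. y \<otimes> x \<oplus> j = \<one>) \<longleftrightarrow> x \<otimes> y \<ominus> \<one> \<in> n"
    proof
      assume "\<exists>j\<in>n. y \<otimes> x \<oplus> j = \<one>"
      then obtain j where j: "j \<in> n" "y \<otimes> x \<oplus> j = \<one>" by blast
      have "x \<otimes> y \<ominus> \<one> = x \<otimes> y \<ominus> (y \<otimes> x \<oplus> j)" using j(2) by simp
      also have "\<dots> = \<ominus> j" using x y n.Icarr[OF j(1)] by algebra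
      finally show "x \<otimes> y \<ominus> \<one> \<in> n" using j(1) by simp
    next
      assume h: "x \<otimes> y \<ominus> \<one> \<in> n"
      have "y \<otimes> x \<oplus> \<ominus> (x \<otimes> y \<ominus> \<one>) = \<one>" using x y by algebra
      then show "\<exists>j\<in>n. y \<otimes> x \<oplus> j = \<one>" using h by blast
    qed
  qed
  finally show ?thesis using coset_unit_iff[OF assms] by simp
qed

end

section \<open>Ideals in rings with finite quotients and unique ideal factorisation\<close>

locale dedekind = cring R for R (structure) +
  assumes finite_quot: "ideal I R \<Longrightarrow> I \<noteq> {\<zero>} \<Longrightarrow> finite (carrier (R Quot I))"
    and prod_cancel: "ideal I R \<Longrightarrow> I \<noteq> {\<zero>} \<Longrightarrow> ideal A R \<Longrightarrow> ideal B R \<Longrightarrow> I \<cdot> A = I \<cdot> B \<Longrightarrow> A = B"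
    and contains_imp_factor:
      "ideal I R \<Longrightarrow> I \<noteq> {\<zero>} \<Longrightarrow> ideal J R \<Longrightarrow> J \<subseteq> I \<Longrightarrow> \<exists>C. ideal C R \<and> J = I \<cdot> C"
begin

abbreviation nz :: "'a set \<Rightarrow> bool" where
  "nz I \<equiv> I \<in> nonzero_ideals R"

abbreviation primes :: "'a set set" where
  "primes \<equiv> nonzero_primes R"

lemma nzD: "nz I \<Longrightarrow> ideal I R" "nz I \<Longrightarrow> I \<noteq> {\<zero>}"
  by (auto simp: nonzero_ideals_def)

lemma ideal_zero_mem: "ideal I R \<Longrightarrow> \<zero> \<in> I"
  using additive_subgroup.zero_closed ideal.axioms(1) by blast

lemma ideal_subset: "ideal I R \<Longrightarrow> I \<subseteq> carrier R"
  using additive_subgroup.a_subset ideal.axioms(1) by blast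

lemma nz_superset: "nz n \<Longrightarrow> ideal e R \<Longrightarrow> n \<subseteq> e \<Longrightarrow> nz e"
  using ideal_zero_mem by (auto simp: nonzero_ideals_def)

text \<open>Cancellation excludes zero divisors among ideals: I J = 0 = I 0 gives J = 0.\<close>

lemma nz_prod: "nz I \<Longrightarrow> nz J \<Longrightarrow> nz (I \<cdot> J)"
  using prod_cancel[of I J "{\<zero>}"] ideal_prod_zero[of I] ideal_prod_is_ideal zeroideal
  by (auto simp: nonzero_ideals_def)

lemma prod_subset:
  assumes "ideal I R" "ideal J R"
  shows "I \<cdot> J \<subseteq> I" "I \<cdot> J \<subseteq> J"
  using ideal_prod_inter[OF assms] by auto

text \<open>Containment A \<subseteq> B is the equation A + B = B, and equations can be
  cancelled.\<close>

lemma prod_subset_cancel: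
  assumes "nz I" "ideal A R" "ideal B R" "I \<cdot> A \<subseteq> I \<cdot> B"
  shows "A \<subseteq> B"
proof -
  have sum_absorb: "U <+>\<^bsub>R\<^esub> V = V" if "ideal U R" "ideal V R" "U \<subseteq> V" for U V
    using that ideal_sum_subset_iff[of U V V] ideal_sum_subset_iff[of U V "U <+>\<^bsub>R\<^esub> V"] add_ideals by blast
  have "I \<cdot> (A <+>\<^bsub>R\<^esub> B) = I \<cdot> B"
    using assms sum_absorb ideal_prod_is_ideal nzD(1) by (simp add: ideal_prod_r_distr)
  then have "A <+>\<^bsub>R\<^esub> B = B"
    using assms prod_cancel[of I "A <+>\<^bsub>R\<^esub> B" B] add_ideals nzD by blast
  then show ?thesis
    using ideal_sum_subset_iff[of A B B] assms by blast
qed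

lemma ideals_set_simps [simp]:
  "carrier (ideals_set R) = {I. ideal I R}" "I \<otimes>\<^bsub>ideals_set R\<^esub> J = I \<cdot> J"
  "\<one>\<^bsub>ideals_set R\<^esub> = carrier R" "I \<oplus>\<^bsub>ideals_set R\<^esub> J = I <+>\<^bsub>R\<^esub> J" "\<zero>\<^bsub>ideals_set R\<^esub> = {\<zero>}"
  by (auto simp: ideals_set_def)

text \<open>Divisibility is handled as containment from here on, the divisor being the larger
  ideal.\<close>

lemma divides_iff:
  assumes "nz n" "ideal d R"
  shows "ideal_divides R d n \<longleftrightarrow> n \<subseteq> d"
proof
  assume "ideal_divides R d n"
  then show "n \<subseteq> d"
    using prod_subset(1)[OF assms(2)] by (auto simp: factor_def)
next
  assume sub: "n \<subseteq> d"
  then have "nz d" using nz_superset assms by blast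
  then obtain C where "ideal C R" "n = d \<cdot> C"
    using contains_imp_factor[of d n] sub nzD assms(1) by blast
  then show "ideal_divides R d n"
    by (auto simp: factor_def)
qed

lemma quotient_prod:
  assumes "nz d" "ideal c R"
  shows "ideal_quotient R (d \<cdot> c) d = c"
  unfolding ideal_quotient_def
  using assms prod_cancel nzD by (intro the_equality) blast+

lemma quotient_props:
  assumes "nz n" "ideal d R" "n \<subseteq> d"
  shows "nz (ideal_quotient R n d)" "n = d \<cdot> ideal_quotient R n d"
proof -
  have d: "nz d" using nz_superset assms by blast
  then obtain C where C: "ideal C R" "n = d \<cdot> C"
    using contains_imp_factor[of d n] nzD assms by blast
  have "C \<noteq> {\<zero>}" using C ideal_prod_zero[OF assms(2)] nzD(2)[OF assms(1)] by auto
  then show "nz (ideal_quotient R n d)" "n = d \<cdot> ideal_quotient R n d"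
    using quotient_prod[OF d C(1)] C by (simp_all add: nonzero_ideals_def)
qed

lemma finite_divisors: "nz n \<Longrightarrow> finite {e. ideal e R \<and> n \<subseteq> e}"
  using finite_ideals_containing finite_quot nzD by blast

lemma primesD:
  assumes "P \<in> primes"
  shows "primeideal P R" "nz P" "P \<noteq> carrier R" "\<one> \<notin> P" "ideal P R"
proof -
  show p: "primeideal P R" and "nz P" "ideal P R"
    using assms primeideal.axioms(1) by (auto simp: nonzero_primes_def nonzero_ideals_def)
  show "P \<noteq> carrier R" using primeideal.I_notcarr[OF p] by blast
  then show "\<one> \<notin> P" using ideal.one_imp_carrier[OF \<open>ideal P R\<close>] by blast
qed

lemma prime_prod_subset_iff:
  assumes "P \<in> primes" "ideal I R" "ideal J R"
  shows "I \<cdot> J \<subseteq> P \<longleftrightarrow> I \<subseteq> P \<or> J \<subseteq> P"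
  using primeideal_divides_ideal_prod[of P I J] primesD[OF assms(1)] assms prod_subset[OF assms(2,3)]
  by blast

lemma maximal_in_primes: "maximalideal M R \<Longrightarrow> nz M \<Longrightarrow> M \<in> primes"
  using maximalideal_prime nzD by (auto simp: nonzero_primes_def)

lemma exists_prime_containing:
  assumes "nz n" "n \<noteq> carrier R"
  obtains P where "P \<in> primes" "maximalideal P R" "n \<subseteq> P"
proof -
  obtain M where "maximalideal M R" "n \<subseteq> M"
    using exists_maximal_ideal_containing[OF nzD(1)[OF assms(1)] finite_quot[OF nzD[OF assms(1)]] assms(2)] .
  then show thesis
    using that maximal_in_primes nz_superset[OF assms(1)] maximalideal.axioms(1) by blast
qed

text \<open>Write P = I C. The prime P contains I, which is the claim, or it contains C. In the
  second case C = P = I C, and cancelling C leaves I = R.\<close>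

lemma prime_maximal:
  assumes P: "P \<in> primes" "ideal I R" "P \<subseteq> I" "I \<noteq> carrier R"
  shows "I = P"
proof -
  have I: "nz I" using nz_superset primesD P by blast
  have Pn: "nz P" using primesD P by blast
  obtain C where C: "nz C" "P = I \<cdot> C"
    using quotient_props[OF Pn P(2,3)] by blast
  have "I \<subseteq> P \<or> C \<subseteq> P"
    using prime_prod_subset_iff[OF P(1) P(2) nzD(1)[OF C(1)]] C by blast
  moreover have "\<not> C \<subseteq> P"
  proof
    assume "C \<subseteq> P"
    moreover have "P \<subseteq> C" using prod_subset[OF P(2) nzD(1)[OF C(1)]] C(2) by blast
    ultimately have "C \<cdot> carrier R = C \<cdot> I"
      using C ideal_prod_one[OF nzD(1)[OF C(1)]] ideal_prod_commute[OF P(2) nzD(1)[OF C(1)]] by auto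
    then show False
      using prod_cancel[OF nzD[OF C(1)] oneideal P(2)] P(4) by simp
  qed
  ultimately show ?thesis using P(3) by blast
qed

lemma sum_eq_carrier_iff_primes:
  assumes "nz I" "ideal J R"
  shows "I <+>\<^bsub>R\<^esub> J = carrier R \<longleftrightarrow> \<not> (\<exists>P\<in>primes. I \<subseteq> P \<and> J \<subseteq> P)"
proof -
  have sum: "ideal (I <+>\<^bsub>R\<^esub> J) R" "nz (I <+>\<^bsub>R\<^esub> J)"
    using add_ideals assms nzD ideal_sum_subset_iff[of I J "I <+>\<^bsub>R\<^esub> J"] nz_superset[OF assms(1)] by blast+
  have sub: "I <+>\<^bsub>R\<^esub> J \<subseteq> P \<longleftrightarrow> I \<subseteq> P \<and> J \<subseteq> P" if "P \<in> primes" for P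
    using ideal_sum_subset_iff[OF nzD(1)[OF assms(1)] assms(2) primesD(5)[OF that]] .
  show ?thesis
  proof (cases "I <+>\<^bsub>R\<^esub> J = carrier R")
    case True
    have "I <+>\<^bsub>R\<^esub> J \<noteq> carrier R" if "P \<in> primes" "I \<subseteq> P" "J \<subseteq> P" for P
      using sub[OF that(1)] that primesD(3,5)[OF that(1)] ideal_subset[of P] by auto
    then show ?thesis using True by blast
  next
    case False
    then obtain P where "P \<in> primes" "I <+>\<^bsub>R\<^esub> J \<subseteq> P"
      using exists_prime_containing[OF sum(2)] by metis
    then show ?thesis using False sub by auto
  qed
qed

lemma coset_unit_iff_primes:
  assumes n: "nz n" and x: "x \<in> carrier R"
  shows "n +> x \<in> Units (R Quot n) \<longleftrightarrow> (\<forall>P\<in>primes. n \<subseteq> P \<longrightarrow> x \<notin> P)"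
proof -
  have "PIdl x <+>\<^bsub>R\<^esub> n = n <+>\<^bsub>R\<^esub> PIdl x"
    using set_add_comm ideal_subset cgenideal_ideal[OF x] nzD(1)[OF n] by blast
  then show ?thesis
    using coset_unit_iff_sum[OF nzD(1)[OF n] x]
      sum_eq_carrier_iff_primes[OF n cgenideal_ideal[OF x]] cgenideal_subset_iff[OF primesD(5) x]
    by auto
qed

lemma nz_carrier: "nz I \<Longrightarrow> nz (carrier R)"
  using nz_superset oneideal ideal_subset nzD by blast

text \<open>A stand-in for prime factorisation. The number of divisors is the measure; it drops
  strictly when a prime is split off, as cancellation makes C differ from C P.\<close>

lemma nz_induct [consumes 1, case_names one prime_mult]:
  assumes "nz J" "Q (carrier R)"
    and step: "\<And>P C. P \<in> primes \<Longrightarrow> nz C \<Longrightarrow> Q C \<Longrightarrow> Q (C \<cdot> P)"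
  shows "Q J"
  using assms(1)
proof (induction "card {e. ideal e R \<and> J \<subseteq> e}" arbitrary: J rule: less_induct)
  case less
  show ?case
  proof (cases "J = carrier R")
    case False
    then obtain P where P: "P \<in> primes" "J \<subseteq> P"
      using exists_prime_containing less.prems by blast
    have Pi: "ideal P R" using primesD P by blast
    define C where "C = ideal_quotient R J P"
    have C: "nz C" "J = P \<cdot> C"
      using quotient_props[OF less.prems Pi P(2)] by (auto simp: C_def)
    have Ci: "ideal C R" using C nzD by blast
    have JCP: "J = C \<cdot> P" using C ideal_prod_commute[OF Pi Ci] by simp
    have sub: "J \<subseteq> C" using prod_subset[OF Pi Ci] C(2) by simp
    have "C \<noteq> J"
      using JCP prod_cancel[OF nzD[OF C(1)] oneideal Pi] ideal_prod_one[OF Ci] primesD[OF P(1)] by auto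
    then have "\<not> C \<subseteq> J" using sub by blast
    then have "{e. ideal e R \<and> C \<subseteq> e} \<subset> {e. ideal e R \<and> J \<subseteq> e}"
      using sub nzD(1)[OF less.prems] by auto
    then have "card {e. ideal e R \<and> C \<subseteq> e} < card {e. ideal e R \<and> J \<subseteq> e}"
      using finite_divisors[OF less.prems] by (rule psubset_card_mono[rotated])
    then show ?thesis
      using less.hyps C(1) step[OF P(1) C(1)] JCP by simp
  qed (use assms(2) in simp)
qed

end

section \<open>Multiplicativity of the ideal norm\<close>

lemma (in cring) card_reduce_fibre:
  assumes n: "ideal n R" and l: "ideal l R" and sub: "n \<subseteq> l" and z: "z \<in> carrier R"
  shows "card {A \<in> carrier (R Quot n). reduce_class R l A = l +> z}
       = card {A \<in> carrier (R Quot n). reduce_class R l A = l}"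
proof -
  interpret h: ring_hom_cring "R Quot n" "R Quot l" "reduce_class R l"
    by (rule reduce_class_hom[OF n l sub])
  let ?z = "n +> z"
  have zc: "?z \<in> carrier (R Quot n)" using quotient_ops(5)[OF n z z] .
  have red_z: "reduce_class R l ?z = l +> z" using reduce_class_coset[OF n l sub z] .
  have zero: "\<zero>\<^bsub>R Quot l\<^esub> = l" using quotient_ops(4)[OF l z z] .
  have lz: "l +> z \<in> carrier (R Quot l)" using quotient_ops(5)[OF l z z] .
  have "bij_betw (\<lambda>A. A \<oplus>\<^bsub>R Quot n\<^esub> ?z) {A \<in> carrier (R Quot n). reduce_class R l A = l}
      {A \<in> carrier (R Quot n). reduce_class R l A = l +> z}"
  proof (rule bij_betw_byWitness[where f' = "\<lambda>A. A \<ominus>\<^bsub>R Quot n\<^esub> ?z"])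
    show "\<forall>A\<in>{A \<in> carrier (R Quot n). reduce_class R l A = l}. A \<oplus>\<^bsub>R Quot n\<^esub> ?z \<ominus>\<^bsub>R Quot n\<^esub> ?z = A"
      using zc by (auto simp: a_minus_def h.R.a_assoc h.R.r_neg)
    show "\<forall>A\<in>{A \<in> carrier (R Quot n). reduce_class R l A = l +> z}. A \<ominus>\<^bsub>R Quot n\<^esub> ?z \<oplus>\<^bsub>R Quot n\<^esub> ?z = A"
      using zc by (auto simp: a_minus_def h.R.a_assoc h.R.l_neg)
    show "(\<lambda>A. A \<oplus>\<^bsub>R Quot n\<^esub> ?z) ` {A \<in> carrier (R Quot n). reduce_class R l A = l}
        \<subseteq> {A \<in> carrier (R Quot n). reduce_class R l A = l +> z}"
      using zc red_z zero lz h.S.l_zero[OF lz] by auto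
    show "(\<lambda>A. A \<ominus>\<^bsub>R Quot n\<^esub> ?z) ` {A \<in> carrier (R Quot n). reduce_class R l A = l +> z}
        \<subseteq> {A \<in> carrier (R Quot n). reduce_class R l A = l}"
      using zc red_z zero lz h.S.r_neg[OF lz] by (auto simp: a_minus_def)
  qed
  from bij_betw_same_card[OF this] show ?thesis by simp
qed

lemma card_eq_mult_if_const_fibres:
  assumes "finite S" "finite T" "g ` S \<subseteq> T" "\<And>y. y \<in> T \<Longrightarrow> card {x \<in> S. g x = y} = c"
  shows "card S = card T * c"
proof -
  have "card S = (\<Sum>y\<in>T. \<Sum>x\<in>{x \<in> S. g x = y}. 1)"
    using sum.group[OF assms(1-3), of "\<lambda>_. 1::nat"] by simp
  also have "\<dots> = (\<Sum>y\<in>T. c)"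
    using assms(4) by (intro sum.cong) auto
  finally show ?thesis by simp
qed

context dedekind
begin

lemma reduce_class_carrier:
  assumes "ideal n R" "ideal l R" "n \<subseteq> l" "A \<in> carrier (R Quot n)"
  shows "reduce_class R l A \<in> carrier (R Quot l)"
  using ring_hom_cring.axioms(2) reduce_class_hom[OF assms(1-3)] assms(4)
    ring_hom_closed[of "reduce_class R l" "R Quot n" "R Quot l"]
  by (metis ring_hom_cring.homh)

text \<open>Lagrange's index formula. As l is the zero of R/l, the classes that reduce to l form the
  kernel l/n of reduction, and all fibres are translates of it.\<close>

lemma norm_eq_norm_mult_index:
  assumes n: "nz n" and l: "ideal l R" "n \<subseteq> l"
  shows "ideal_norm R n = ideal_norm R l * card {A \<in> carrier (R Quot n). reduce_class R l A = l}"
  unfolding ideal_norm_def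
proof (rule card_eq_mult_if_const_fibres)
  note n' = nzD[OF n]
  show "finite (carrier (R Quot n))" using finite_quot[OF n'] .
  show "finite (carrier (R Quot l))" using finite_quot[OF nzD[OF nz_superset[OF n l]]] .
  show "reduce_class R l ` carrier (R Quot n) \<subseteq> carrier (R Quot l)"
    using reduce_class_carrier[OF n'(1) l] by blast
  fix B assume "B \<in> carrier (R Quot l)"
  then obtain z where z: "z \<in> carrier R" "B = l +> z" using quotient_cases[OF l(1)] by blast
  then show "card {A \<in> carrier (R Quot n). reduce_class R l A = B}
      = card {A \<in> carrier (R Quot n). reduce_class R l A = l}"
    using card_reduce_fibre[OF n'(1) l] by simp
qed

lemma norm_pos: "nz n \<Longrightarrow> ideal_norm R n > 0"
  unfolding ideal_norm_def using finite_quot[OF nzD] zero_closed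
  by (auto simp: card_gt_0_iff carrier_quotient)

text \<open>For a prime \<open>P\<close> there is no ideal strictly between \<open>I \<cdot> P\<close> and \<open>I\<close>, so multiplication by any
  \<open>\<alpha> \<in> I - I \<cdot> P\<close> induces a bijection from \<open>R/P\<close> onto \<open>I/(I \<cdot> P)\<close>.\<close>

lemma norm_prod_prime:
  assumes I: "nz I" and P: "P \<in> primes"
  shows "ideal_norm R (I \<cdot> P) = ideal_norm R I * ideal_norm R P"
proof -
  note Ii = nzD(1)[OF I] and Pi = primesD(5)[OF P]
  interpret I: ideal I R by (rule Ii)
  interpret P: ideal P R by (rule Pi)
  have IP: "nz (I \<cdot> P)" "ideal (I \<cdot> P) R" using nz_prod[OF I] primesD(2)[OF P] nzD by auto
  interpret IP: ideal "I \<cdot> P" R by (rule IP(2))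
  have sub: "I \<cdot> P \<subseteq> I" using prod_subset[OF Ii Pi] by blast
  have "I \<cdot> P \<noteq> I"
    using prod_cancel[OF nzD[OF I] Pi oneideal] ideal_prod_one[OF Ii] primesD[OF P] by auto
  then obtain \<alpha> where \<alpha>: "\<alpha> \<in> I" "\<alpha> \<notin> I \<cdot> P" using sub by blast
  have \<alpha>c: "\<alpha> \<in> carrier R" using \<alpha> by auto
  \<comment> \<open>The kernel of x \<mapsto> \<alpha> x from R to I/(I P). It contains P but not 1,
    so it is P by maximality: this is the injectivity.\<close>
  define D where "D = {x \<in> carrier R. \<alpha> \<otimes> x \<in> I \<cdot> P}"
  have D: "ideal D R" unfolding D_def by (rule IP.helper_max_prime[OF is_cring \<alpha>c])
  have "P \<subseteq> D" using \<alpha> ideal_prod.prod[of \<alpha> I _ P R] P.Icarr by (auto simp: D_def)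
  moreover have "\<one> \<notin> D" using \<alpha>(2) r_one[OF \<alpha>c] by (simp add: D_def)
  then have "D \<noteq> carrier R" using one_closed by blast
  ultimately have DP: "D = P" using prime_maximal[OF P D] by blast
  \<comment> \<open>An ideal between I P and I that contains \<alpha> and so differs from I P. That
    it is all of I gives the surjectivity.\<close>
  define L where "L = PIdl \<alpha> <+>\<^bsub>R\<^esub> I \<cdot> P"
  have P\<alpha>: "ideal (PIdl \<alpha>) R" using cgenideal_ideal[OF \<alpha>c] .
  have L: "ideal L R" unfolding L_def using add_ideals[OF P\<alpha> IP(2)] .
  have L_sub: "L \<subseteq> I" "PIdl \<alpha> \<subseteq> L" "I \<cdot> P \<subseteq> L"
    using ideal_sum_subset_iff[OF P\<alpha> IP(2) Ii] ideal_sum_subset_iff[OF P\<alpha> IP(2) L]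
      cgenideal_subset_iff[OF Ii \<alpha>c] \<alpha>(1) sub unfolding L_def by auto
  have "L = I"
  proof -
    obtain M where M: "ideal M R" "L = I \<cdot> M"
      using contains_imp_factor[OF nzD[OF I] L L_sub(1)] by blast
    have "P \<subseteq> M" using prod_subset_cancel[OF I Pi M(1)] L_sub(3) M(2) by simp
    moreover have "M \<noteq> P" using M(2) \<alpha> L_sub(2) cgenideal_self[OF \<alpha>c] by blast
    ultimately have "M = carrier R" using prime_maximal[OF P M(1)] by blast
    then show ?thesis using M ideal_prod_one[OF Ii] by simp
  qed
  have "bij_betw (\<lambda>A. I \<cdot> P +> \<alpha> \<otimes> class_rep A) (carrier (R Quot P))
      {A \<in> carrier (R Quot (I \<cdot> P)). reduce_class R I A = I}"
  proof (rule bij_betwI')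
    fix A B assume A: "A \<in> carrier (R Quot P)" and B: "B \<in> carrier (R Quot P)"
    note a = class_rep_quotient[OF Pi A] and b = class_rep_quotient[OF Pi B]
    have "I \<cdot> P +> \<alpha> \<otimes> class_rep A = I \<cdot> P +> \<alpha> \<otimes> class_rep B
        \<longleftrightarrow> \<alpha> \<otimes> class_rep A \<ominus> \<alpha> \<otimes> class_rep B \<in> I \<cdot> P"
      using quotient_ops(6)[OF IP(2)] \<alpha>c a b by simp
    also have "\<alpha> \<otimes> class_rep A \<ominus> \<alpha> \<otimes> class_rep B = \<alpha> \<otimes> (class_rep A \<ominus> class_rep B)"
      using \<alpha>c a(1) b(1) by algebra
    also have "\<dots> \<in> I \<cdot> P \<longleftrightarrow> class_rep A \<ominus> class_rep B \<in> P"
      using DP a(1) b(1) by (auto simp: D_def)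
    also have "\<dots> \<longleftrightarrow> A = B"
      using quotient_ops(6)[OF Pi a(1) b(1)] a(2) b(2) by simp
    finally show "I \<cdot> P +> \<alpha> \<otimes> class_rep A = I \<cdot> P +> \<alpha> \<otimes> class_rep B \<longleftrightarrow> A = B" .
  next
    fix A assume A: "A \<in> carrier (R Quot P)"
    note a = class_rep_quotient[OF Pi A]
    have "\<alpha> \<otimes> class_rep A \<in> I" using \<alpha>(1) a(1) by (rule I.I_r_closed)
    then have "reduce_class R I (I \<cdot> P +> \<alpha> \<otimes> class_rep A) = I"
      using reduce_class_coset[OF IP(2) Ii sub, of "\<alpha> \<otimes> class_rep A"] \<alpha>c a a_rcos_zero[OF Ii] by simp
    then show "I \<cdot> P +> \<alpha> \<otimes> class_rep A \<in> {A \<in> carrier (R Quot (I \<cdot> P)). reduce_class R I A = I}"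
      using quotient_ops(5)[OF IP(2), of "\<alpha> \<otimes> class_rep A" "\<alpha>"] \<alpha>c a(1) by simp
  next
    fix C assume C: "C \<in> {A \<in> carrier (R Quot (I \<cdot> P)). reduce_class R I A = I}"
    then obtain w where w: "w \<in> carrier R" "C = I \<cdot> P +> w" using quotient_cases[OF IP(2)] by blast
    then have "I +> w = I" using C reduce_class_coset[OF IP(2) Ii sub w(1)] by simp
    then have "w \<in> I" using I.rcos_const_imp_mem[OF w(1)] by blast
    then have "w \<in> L" using \<open>L = I\<close> by blast
    then obtain x m where x: "x \<in> carrier R" "m \<in> I \<cdot> P" "w = x \<otimes> \<alpha> \<oplus> m"
      unfolding L_def set_add_def' cgenideal_def by auto
    have Px: "P +> x \<in> carrier (R Quot P)" using quotient_ops(5)[OF Pi x(1) x(1)] .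
    note y = class_rep_quotient[OF Pi Px]
    have "x \<ominus> class_rep (P +> x) \<in> P" using quotient_ops(6)[OF Pi x(1) y(1)] y(2) by simp
    then have "\<alpha> \<otimes> (x \<ominus> class_rep (P +> x)) \<in> I \<cdot> P" using ideal_prod.prod[OF \<alpha>(1), of _ P R] by blast
    then have "\<alpha> \<otimes> (x \<ominus> class_rep (P +> x)) \<oplus> m \<in> I \<cdot> P" using x(2) by simp
    also have "\<alpha> \<otimes> (x \<ominus> class_rep (P +> x)) \<oplus> m = w \<ominus> \<alpha> \<otimes> class_rep (P +> x)"
      unfolding x(3) using \<alpha>c x(1) y(1) IP.Icarr[OF x(2)] by algebra
    finally have "C = I \<cdot> P +> \<alpha> \<otimes> class_rep (P +> x)"
      using quotient_ops(6)[OF IP(2) w(1), of "\<alpha> \<otimes> class_rep (P +> x)"] w(2) \<alpha>c y(1) by simp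
    then show "\<exists>A\<in>carrier (R Quot P). C = I \<cdot> P +> \<alpha> \<otimes> class_rep A" using Px by blast
  qed
  then have "ideal_norm R P = card {A \<in> carrier (R Quot (I \<cdot> P)). reduce_class R I A = I}"
    unfolding ideal_norm_def by (rule bij_betw_same_card)
  then show ?thesis using norm_eq_norm_mult_index[OF IP(1) Ii sub] by simp
qed

lemma norm_carrier: "ideal_norm R (carrier R) = 1"
proof -
  have "carrier R +> x = carrier R" if "x \<in> carrier R" for x
    using a_rcos_zero[OF oneideal that] .
  then have "carrier (R Quot (carrier R)) = {carrier R}"
    using one_closed by (auto simp: carrier_quotient)
  then show ?thesis by (simp add: ideal_norm_def)
qed

lemma norm_prod:
  assumes "nz I" "nz J"
  shows "ideal_norm R (I \<cdot> J) = ideal_norm R I * ideal_norm R J"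
  using assms(2)
proof (induction rule: nz_induct)
  case one
  then show ?case using ideal_prod_one[OF nzD(1)[OF assms(1)]] by (simp add: norm_carrier)
next
  case (prime_mult P C)
  have "I \<cdot> (C \<cdot> P) = (I \<cdot> C) \<cdot> P"
    using ideal_prod_assoc[of I C P] assms(1) prime_mult primesD(5) nzD by simp
  then show ?case
    using norm_prod_prime[of "I \<cdot> C" P] norm_prod_prime[of C P] nz_prod[OF assms(1)] prime_mult by simp
qed

text \<open>The index formula and multiplicativity both write the norm of n as the norm of l times a
  factor, and the norm of l is positive.\<close>

lemma card_reduce_kernel:
  assumes "nz n" "ideal l R" "n \<subseteq> l"
  shows "card {A \<in> carrier (R Quot n). reduce_class R l A = l} = ideal_norm R (ideal_quotient R n l)"
proof -
  have l: "nz l" using nz_superset assms by blast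
  have "ideal_norm R n = ideal_norm R l * ideal_norm R (ideal_quotient R n l)"
    using norm_prod[OF l quotient_props(1)[OF assms]] quotient_props(2)[OF assms] by simp
  then show ?thesis
    using norm_eq_norm_mult_index[OF assms] norm_pos[OF l] by simp
qed

end

context dedekind
begin

section \<open>Units of residue rings\<close>

text \<open>One prime at a time: the Chinese remainder theorem makes the residue 1 modulo P, and
  continuing modulo e P keeps both this and the class modulo e. The induction therefore has to vary
  e and r.\<close>

lemma exists_residue_avoiding_primes:
  assumes "finite S" "S \<subseteq> primes" "nz e" "r \<in> carrier R" "\<And>P. P \<in> S \<Longrightarrow> \<not> e \<subseteq> P"
  shows "\<exists>t\<in>carrier R. t \<ominus> r \<in> e \<and> (\<forall>P\<in>S. t \<notin> P)"
  using assms
proof (induction S arbitrary: e r rule: finite_induct)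
  case empty
  then show ?case
    using ideal_zero_mem[OF nzD(1)] by (intro bexI[of _ r]) (auto simp: a_minus_def r_neg)
next
  case (insert P S)
  note e = nzD(1)[OF insert.prems(2)]
  have P: "P \<in> primes" "ideal P R" using insert.prems(1) primesD(5) by auto
  have eq: "Q = P" if "Q \<in> primes" "P \<subseteq> Q" for Q
    using prime_maximal[OF P(1)] primesD(3,5)[OF that(1)] that(2) by blast
  then have "e <+>\<^bsub>R\<^esub> P = carrier R"
    using sum_eq_carrier_iff_primes[OF insert.prems(2) P(2)] insert.prems(4) by blast
  then obtain r' where r': "r' \<in> carrier R" "r' \<ominus> r \<in> e" "r' \<ominus> \<one> \<in> P"
    using chinese_remainder[OF e P(2) _ insert.prems(3) one_closed] by blast
  have eP: "nz (e \<cdot> P)" using nz_prod insert.prems(2) primesD(2)[OF P(1)] by blast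
  have "\<exists>t\<in>carrier R. t \<ominus> r' \<in> e \<cdot> P \<and> (\<forall>Q\<in>S. t \<notin> Q)"
  proof (rule insert.IH)
    fix Q assume Q: "Q \<in> S"
    then have Q': "Q \<in> primes" "Q \<noteq> P" using insert.prems(1) insert.hyps(2) by auto
    have "\<not> e \<subseteq> Q" using insert.prems(4)[of Q] Q by simp
    then show "\<not> e \<cdot> P \<subseteq> Q"
      using prime_prod_subset_iff[OF Q'(1) e P(2)] eq[OF Q'(1)] Q'(2) by blast
  qed (use insert.prems eP r' in auto)
  then obtain t where t: "t \<in> carrier R" "t \<ominus> r' \<in> e \<cdot> P" "\<forall>Q\<in>S. t \<notin> Q" by blast
  have "t \<ominus> r \<in> e"
    using diff_mem_trans[OF e t(1) r'(1) insert.prems(3)] t(2) r'(2) prod_subset[OF e P(2)] by blast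
  moreover have t1: "t \<ominus> \<one> \<in> P"
    using diff_mem_trans[OF P(2) t(1) r'(1) one_closed] t(2) r'(3) prod_subset[OF e P(2)] by blast
  have "t \<notin> P"
    using mem_of_diff_mem[OF P(2) one_closed t(1)] diff_mem_swap[OF P(2) t(1) one_closed t1]
      primesD(4)[OF P(1)] by blast
  ultimately show ?case using t by blast
qed

text \<open>Surjectivity of reduction on units. An arbitrary lift of a unit modulo e can fail to be
  a unit modulo n only at the finitely many primes that divide n but not e, and these can be
  avoided.\<close>

lemma unit_lift:
  assumes n: "nz n" and e: "ideal e R" "n \<subseteq> e" and r: "r \<in> carrier R" "e +> r \<in> Units (R Quot e)"
  obtains t where "t \<in> carrier R" "n +> t \<in> Units (R Quot n)" "t \<ominus> r \<in> e"
proof -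
  have e': "nz e" using nz_superset[OF n e] .
  define S where "S = {P \<in> primes. n \<subseteq> P \<and> \<not> e \<subseteq> P}"
  have "finite S"
    by (rule finite_subset[OF _ finite_divisors[OF n]]) (auto simp: S_def primesD)
  moreover have "S \<subseteq> primes" "\<And>P. P \<in> S \<Longrightarrow> \<not> e \<subseteq> P"
    by (simp_all add: S_def)
  ultimately obtain t where t: "t \<in> carrier R" "t \<ominus> r \<in> e" "\<forall>P\<in>S. t \<notin> P"
    using exists_residue_avoiding_primes[OF _ _ e' r(1)] by metis
  have "t \<notin> P" if P: "P \<in> primes" "n \<subseteq> P" for P
  proof (cases "e \<subseteq> P")
    case True
    then have "r \<notin> P" using coset_unit_iff_primes[OF e' r(1)] r(2) P(1) by blast
    moreover have "r \<ominus> t \<in> P" using diff_mem_swap[OF e(1) t(1) r(1) t(2)] True by blast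
    ultimately show ?thesis using mem_of_diff_mem[OF primesD(5)[OF P(1)] r(1) t(1)] by blast
  next
    case False
    then show ?thesis using t P by (auto simp: S_def)
  qed
  then have "n +> t \<in> Units (R Quot n)" using coset_unit_iff_primes[OF n t(1)] by blast
  then show thesis using that t by blast
qed

lemma finite_Units: "nz n \<Longrightarrow> finite (Units (R Quot n))"
  using finite_quot[OF nzD] by (rule finite_subset[rotated]) (auto simp: Units_def)

lemma Units_sub: "Units (R Quot n) \<subseteq> carrier (R Quot n)"
  by (auto simp: Units_def)

lemma reduce_class_unit:
  assumes n: "nz n" and e: "ideal e R" "n \<subseteq> e" and A: "A \<in> Units (R Quot n)"
  shows "reduce_class R e A \<in> Units (R Quot e)"
proof -
  have e': "nz e" using nz_superset[OF n e] .
  obtain x where x: "x \<in> carrier R" "A = n +> x" using quotient_cases[OF nzD(1)[OF n]] A Units_sub by blast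
  then show ?thesis
    using A e coset_unit_iff_primes[OF n x(1)] coset_unit_iff_primes[OF e' x(1)]
      reduce_class_coset[OF nzD(1)[OF n] e x(1)] by auto
qed

lemma totient_pos: "nz n \<Longrightarrow> ideal_totient R n > 0"
  using finite_Units monoid.Units_one_closed[OF ring.is_monoid[OF cring.axioms(1)[OF quotient_cring[OF nzD(1)]]]]
  by (auto simp: ideal_totient_def card_gt_0_iff)

text \<open>Multiplication by a unit lift of B carries the fibre over 1 onto the fibre over B, so
  all fibres of reduction on units have the same size.\<close>

lemma card_unit_fibre:
  assumes n: "nz n" and e: "ideal e R" "n \<subseteq> e" and B: "B \<in> Units (R Quot e)"
  shows "ideal_totient R n = ideal_totient R e * card {A \<in> Units (R Quot n). reduce_class R e A = B}"
proof -
  note n' = nzD(1)[OF n]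
  have e': "nz e" using nz_superset[OF n e] .
  interpret h: ring_hom_cring "R Quot n" "R Quot e" "reduce_class R e"
    by (rule reduce_class_hom[OF n' e])
  define F where "F B = {A \<in> Units (R Quot n). reduce_class R e A = B}" for B
  have card_F: "card (F B) = card (F \<one>\<^bsub>R Quot e\<^esub>)" if B: "B \<in> Units (R Quot e)" for B
  proof -
    have Bc: "B \<in> carrier (R Quot e)" using B Units_sub by blast
    obtain r where r: "r \<in> carrier R" "B = e +> r" using quotient_cases[OF e(1) Bc] by blast
    obtain t where t: "t \<in> carrier R" "n +> t \<in> Units (R Quot n)" "t \<ominus> r \<in> e"
      using unit_lift[OF n e r(1)] B r(2) by blast
    define T where "T = n +> t"
    have T: "T \<in> Units (R Quot n)" using t by (simp add: T_def)
    then have Tc: "T \<in> carrier (R Quot n)" using Units_sub by blast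
    have redT: "reduce_class R e T = B"
      using reduce_class_coset[OF n' e t(1)] quotient_ops(6)[OF e(1) t(1) r(1)] t(3) r(2) by (simp add: T_def)
    have invT: "inv\<^bsub>R Quot n\<^esub> T \<in> Units (R Quot n)" "inv\<^bsub>R Quot n\<^esub> T \<in> carrier (R Quot n)"
      using T h.R.Units_inv_Units h.R.Units_inv_closed by blast+
    have red_inv: "B \<otimes>\<^bsub>R Quot e\<^esub> reduce_class R e (inv\<^bsub>R Quot n\<^esub> T) = \<one>\<^bsub>R Quot e\<^esub>"
      using h.hom_mult[OF Tc invT(2)] redT h.R.Units_r_inv[OF T] h.hom_one by simp
    have "bij_betw (\<lambda>A. A \<otimes>\<^bsub>R Quot n\<^esub> T) (F \<one>\<^bsub>R Quot e\<^esub>) (F B)"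
    proof (rule bij_betw_byWitness[where f' = "\<lambda>A. A \<otimes>\<^bsub>R Quot n\<^esub> inv\<^bsub>R Quot n\<^esub> T"])
      show "\<forall>A\<in>F \<one>\<^bsub>R Quot e\<^esub>. A \<otimes>\<^bsub>R Quot n\<^esub> T \<otimes>\<^bsub>R Quot n\<^esub> inv\<^bsub>R Quot n\<^esub> T = A"
        using T Tc invT Units_sub by (auto simp: F_def h.R.m_assoc)
      show "\<forall>A\<in>F B. A \<otimes>\<^bsub>R Quot n\<^esub> inv\<^bsub>R Quot n\<^esub> T \<otimes>\<^bsub>R Quot n\<^esub> T = A"
        using T Tc invT Units_sub by (auto simp: F_def h.R.m_assoc)
      show "(\<lambda>A. A \<otimes>\<^bsub>R Quot n\<^esub> T) ` F \<one>\<^bsub>R Quot e\<^esub> \<subseteq> F B"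
      proof
        fix C assume "C \<in> (\<lambda>A. A \<otimes>\<^bsub>R Quot n\<^esub> T) ` F \<one>\<^bsub>R Quot e\<^esub>"
        then obtain A where A: "A \<in> Units (R Quot n)" "reduce_class R e A = \<one>\<^bsub>R Quot e\<^esub>"
          "C = A \<otimes>\<^bsub>R Quot n\<^esub> T" by (auto simp: F_def)
        then show "C \<in> F B"
          using h.hom_mult[OF h.R.Units_closed[OF A(1)] Tc] redT Bc T h.R.Units_m_closed by (simp add: F_def)
      qed
      show "(\<lambda>A. A \<otimes>\<^bsub>R Quot n\<^esub> inv\<^bsub>R Quot n\<^esub> T) ` F B \<subseteq> F \<one>\<^bsub>R Quot e\<^esub>"
      proof
        fix C assume "C \<in> (\<lambda>A. A \<otimes>\<^bsub>R Quot n\<^esub> inv\<^bsub>R Quot n\<^esub> T) ` F B"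
        then obtain A where A: "A \<in> Units (R Quot n)" "reduce_class R e A = B"
          "C = A \<otimes>\<^bsub>R Quot n\<^esub> inv\<^bsub>R Quot n\<^esub> T" by (auto simp: F_def)
        then show "C \<in> F \<one>\<^bsub>R Quot e\<^esub>"
          using h.hom_mult[OF h.R.Units_closed[OF A(1)] invT(2)] red_inv invT h.R.Units_m_closed
          by (simp add: F_def)
      qed
    qed
    from bij_betw_same_card[OF this] show ?thesis by simp
  qed
  show ?thesis
    unfolding ideal_totient_def
  proof (rule card_eq_mult_if_const_fibres)
    show "reduce_class R e ` Units (R Quot n) \<subseteq> Units (R Quot e)"
      using reduce_class_unit[OF n e] by blast
    show "card {A \<in> Units (R Quot n). reduce_class R e A = B'}
        = card {A \<in> Units (R Quot n). reduce_class R e A = B}" if "B' \<in> Units (R Quot e)" for B'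
      using card_F[OF that] card_F[OF B] by (simp add: F_def)
  qed (use finite_Units n e' in auto)
qed

text \<open>By \<open>rad\<close> a class is a unit modulo n as soon as its reductions modulo d and
  m are units. The fibre is therefore a full fibre of reduction modulo d m = d \<inter> m, and the
  Chinese remainder theorem provides the class it lies over.\<close>

lemma card_pair_fibre:
  assumes n: "nz n" and d: "ideal d R" "n \<subseteq> d" and m: "ideal m R" "n \<subseteq> m"
    and coprime: "d <+>\<^bsub>R\<^esub> m = carrier R"
    and rad: "\<And>P. P \<in> primes \<Longrightarrow> n \<subseteq> P \<Longrightarrow> d \<subseteq> P \<or> m \<subseteq> P"
    and B: "B \<in> Units (R Quot d)" and B': "B' \<in> Units (R Quot m)"
  shows "card {A \<in> Units (R Quot n). reduce_class R d A = B \<and> reduce_class R m A = B'}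
    = ideal_norm R (ideal_quotient R n (d \<cdot> m))"
proof -
  note n' = nzD(1)[OF n]
  have nzd: "nz d" "nz m" using nz_superset n d m by blast+
  define l where "l = d \<cdot> m"
  have l: "ideal l R" "l = d \<inter> m" "n \<subseteq> l"
    using ideal_prod_is_ideal[OF d(1) m(1)] ideal_prod_eq_inter[OF d(1) m(1) coprime] d m by (auto simp: l_def)
  obtain x where x: "x \<in> carrier R" "B = d +> x" using quotient_cases[OF d(1)] B Units_sub by blast
  obtain y where y: "y \<in> carrier R" "B' = m +> y" using quotient_cases[OF m(1)] B' Units_sub by blast
  obtain z where z: "z \<in> carrier R" "z \<ominus> x \<in> d" "z \<ominus> y \<in> m"
    using chinese_remainder[OF d(1) m(1) coprime x(1) y(1)] by blast
  have Bz: "B = d +> z" "B' = m +> z"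
    using quotient_ops(6)[OF d(1) z(1) x(1)] quotient_ops(6)[OF m(1) z(1) y(1)] z x y by auto
  have "A \<in> Units (R Quot n) \<and> reduce_class R d A = B \<and> reduce_class R m A = B'
      \<longleftrightarrow> A \<in> carrier (R Quot n) \<and> reduce_class R l A = l +> z" for A
  proof (cases "A \<in> carrier (R Quot n)")
    case True
    then obtain w where w: "w \<in> carrier R" "A = n +> w" using quotient_cases[OF n'] by blast
    have red: "reduce_class R d A = d +> w" "reduce_class R m A = m +> w" "reduce_class R l A = l +> w"
      using reduce_class_coset[OF n' _ _ w(1)] d m l w(2) by blast+
    have "A \<in> Units (R Quot n)" if "d +> w = B" "m +> w = B'"
    proof -
      have "w \<notin> P" if P: "P \<in> primes" "n \<subseteq> P" for P
        using rad[OF P] coset_unit_iff_primes[OF nzd(1) w(1)] coset_unit_iff_primes[OF nzd(2) w(1)]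
          \<open>d +> w = B\<close> \<open>m +> w = B'\<close> B B' P(1) by auto
      then show ?thesis using coset_unit_iff_primes[OF n w(1)] w(2) by blast
    qed
    moreover have "d +> w = B \<and> m +> w = B' \<longleftrightarrow> l +> w = l +> z"
      using quotient_ops(6)[OF d(1) w(1) z(1)] quotient_ops(6)[OF m(1) w(1) z(1)]
        quotient_ops(6)[OF l(1) w(1) z(1)] Bz l(2) by auto
    ultimately show ?thesis using True red by metis
  next
    case False
    then show ?thesis using Units_sub by blast
  qed
  then have "{A \<in> Units (R Quot n). reduce_class R d A = B \<and> reduce_class R m A = B'}
      = {A \<in> carrier (R Quot n). reduce_class R l A = l +> z}" by auto
  then show ?thesis
    using card_reduce_fibre[OF n' l(1,3) z(1)] card_reduce_kernel[OF n l(1,3)] by (simp add: l_def)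
qed

lemma Units_trivial_quotient:
  assumes "B \<in> Units (R Quot (carrier R))"
  shows "B = carrier R"
proof -
  obtain x where "x \<in> carrier R" "B = carrier R +> x"
    using quotient_cases[OF oneideal] assms Units_sub by blast
  then show ?thesis using a_rcos_zero[OF oneideal] by simp
qed

text \<open>The preceding fibre count with m = R, whose residue ring has a single class, which is a
  unit.\<close>

lemma totient_same_radical:
  assumes n: "nz n" and d: "ideal d R" "n \<subseteq> d"
    and rad: "\<And>P. P \<in> primes \<Longrightarrow> n \<subseteq> P \<Longrightarrow> d \<subseteq> P"
  shows "ideal_totient R n = ideal_totient R d * ideal_norm R (ideal_quotient R n d)"
  unfolding ideal_totient_def
proof (rule card_eq_mult_if_const_fibres)
  have nR: "n \<subseteq> carrier R" using ideal_subset nzD n by blast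
  have sum: "d <+>\<^bsub>R\<^esub> carrier R = carrier R"
    using ideal_sum_subset_iff[OF d(1) oneideal add_ideals[OF d(1) oneideal]]
      ideal_subset[OF add_ideals[OF d(1) oneideal]] by blast
  show "reduce_class R d ` Units (R Quot n) \<subseteq> Units (R Quot d)"
    using reduce_class_unit[OF n d] by blast
  fix B assume B: "B \<in> Units (R Quot d)"
  have u: "carrier R +> \<one> \<in> Units (R Quot (carrier R))"
    using coset_unit_iff[OF oneideal one_closed] one_closed by (metis m_closed minus_closed)
  have one: "reduce_class R (carrier R) A = carrier R +> \<one>" if "A \<in> Units (R Quot n)" for A
    using Units_trivial_quotient reduce_class_unit[OF n oneideal nR that] u by metis
  have "{A \<in> Units (R Quot n). reduce_class R d A = B}
      = {A \<in> Units (R Quot n). reduce_class R d A = B \<and> reduce_class R (carrier R) A = carrier R +> \<one>}"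
    using one by blast
  then show "card {A \<in> Units (R Quot n). reduce_class R d A = B} = ideal_norm R (ideal_quotient R n d)"
    using card_pair_fibre[OF n d oneideal nR sum _ B u] rad ideal_prod_one[OF d(1)] by simp
qed (use finite_Units n nz_superset[OF n d] in auto)

section \<open>Moebius inversion\<close>

lemma comm_monoid_ideals: "comm_monoid (ideals_set R)"
  by (rule ideals_set_is_comm_monoid)

abbreviation PI :: "'a set set \<Rightarrow> 'a set" where
  "PI S \<equiv> (\<Otimes>\<^bsub>ideals_set R\<^esub>p\<in>S. p)"

lemma PI_empty: "PI {} = carrier R"
proof -
  interpret M: comm_monoid "ideals_set R" by (rule comm_monoid_ideals)
  show ?thesis by simp
qed

lemma PI_props:
  assumes "finite S" "S \<subseteq> primes"
  shows PI_ideal: "ideal (PI S) R"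
    and PI_insert: "P \<in> primes \<Longrightarrow> P \<notin> S \<Longrightarrow> PI (insert P S) = P \<cdot> PI S"
proof -
  interpret M: comm_monoid "ideals_set R" by (rule comm_monoid_ideals)
  have m: "(\<lambda>p. p) \<in> S \<rightarrow> carrier (ideals_set R)" using assms(2) primesD(5) by auto
  show "ideal (PI S) R" using M.finprod_closed[OF m] by simp
  show "PI (insert P S) = P \<cdot> PI S" if "P \<in> primes" "P \<notin> S"
    using M.finprod_insert[OF assms(1) that(2) m] primesD(5)[OF that(1)] by simp
qed

lemma PI_subset_prime_iff:
  assumes "finite S" "S \<subseteq> primes" "Q \<in> primes"
  shows "PI S \<subseteq> Q \<longleftrightarrow> Q \<in> S"
  using assms(1,2)
proof (induction S rule: finite_induct)
  case empty
  then show ?case using PI_empty primesD(3)[OF assms(3)] ideal_subset[OF primesD(5)[OF assms(3)]] by auto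
next
  case (insert P S)
  have P: "P \<in> primes" "ideal P R" using insert.prems primesD(5) by auto
  have "P \<subseteq> Q \<longleftrightarrow> Q = P"
    using prime_maximal[OF P(1) primesD(5)[OF assms(3)]] primesD(3)[OF assms(3)] by blast
  then show ?case
    using PI_insert[OF insert.hyps(1) _ P(1) insert.hyps(2)] insert
      prime_prod_subset_iff[OF assms(3) P(2) PI_ideal[OF insert.hyps(1)]] by auto
qed

text \<open>Distinct primes are coprime by maximality, so their product is their
  intersection.\<close>

lemma subset_PI_iff:
  assumes "finite S" "S \<subseteq> primes" "nz n"
  shows "n \<subseteq> PI S \<longleftrightarrow> (\<forall>P\<in>S. n \<subseteq> P)"
  using assms(1,2)
proof (induction S rule: finite_induct)
  case empty
  then show ?case using PI_empty ideal_subset nzD assms(3) by simp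
next
  case (insert P S)
  have P: "P \<in> primes" "ideal P R" "nz P" using insert.prems primesD by auto
  have S: "ideal (PI S) R" using PI_ideal insert by simp
  have "P <+>\<^bsub>R\<^esub> PI S = carrier R"
  proof -
    have "\<not> (P \<subseteq> Q \<and> PI S \<subseteq> Q)" if Q: "Q \<in> primes" for Q
      using prime_maximal[OF P(1) primesD(5)[OF Q]] primesD(3)[OF Q]
        PI_subset_prime_iff[OF insert.hyps(1) _ Q] insert by auto
    then show ?thesis using sum_eq_carrier_iff_primes[OF P(3) S] by blast
  qed
  then have "PI (insert P S) = P \<inter> PI S"
    using PI_insert[OF insert.hyps(1) _ P(1) insert.hyps(2)] ideal_prod_eq_inter[OF P(2) S] insert.prems by simp
  then show ?case using insert by auto
qed

text \<open>A set of primes is recovered from its product as the set of primes containing that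
  product. This uniqueness gives the definite description in \<open>ideal_moebius\<close> its
  meaning.\<close>

lemma prime_product_iff:
  assumes "finite S" "S \<subseteq> primes"
  shows "prime_product R T (PI S) \<longleftrightarrow> T = S"
proof
  assume T: "prime_product R T (PI S)"
  then have "Q \<in> T \<longleftrightarrow> Q \<in> S" if "Q \<in> primes" for Q
    using PI_subset_prime_iff[OF assms that] PI_subset_prime_iff[of T, OF _ _ that]
    by (auto simp: prime_product_def)
  then show "T = S" using T assms by (auto simp: prime_product_def)
qed (use assms in \<open>auto simp: prime_product_def\<close>)

lemma moebius_PI:
  assumes "finite S" "S \<subseteq> primes"
  shows "ideal_moebius R (PI S) = (-1) ^ card S"
  using prime_product_iff[OF assms] by (simp add: ideal_moebius_def)

lemma moebius_eq_0: "(\<And>S. finite S \<Longrightarrow> S \<subseteq> primes \<Longrightarrow> a \<noteq> PI S) \<Longrightarrow> ideal_moebius R a = 0"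
  by (auto simp: ideal_moebius_def prime_product_def)

text \<open>Only products of sets of primes above g contribute, each set once. Summing the signs
  over all subsets of \<open>T\<close> is the expansion of a product with a factor -1 + 1 for each
  prime in \<open>T\<close>.\<close>

lemma sum_moebius:
  assumes g: "nz g"
  shows "(\<Sum>e | ideal e R \<and> g \<subseteq> e. ideal_moebius R e) = (if g = carrier R then 1 else 0)"
proof -
  define T where "T = {P \<in> primes. g \<subseteq> P}"
  have T: "finite T" "T \<subseteq> primes"
    by (rule finite_subset[OF _ finite_divisors[OF g]]) (auto simp: T_def primesD)
  have sub: "finite S \<and> S \<subseteq> primes" if "S \<subseteq> T" for S
    using that T finite_subset by blast
  have inj: "inj_on PI (Pow T)"
  proof (rule inj_onI)
    fix S S' assume "S \<in> Pow T" "S' \<in> Pow T" and eq: "PI S = PI S'"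
    then have S: "finite S" "S \<subseteq> primes" "finite S'" "S' \<subseteq> primes" using sub by auto
    then have "prime_product R S' (PI S)" using prime_product_iff[OF S(3,4)] eq by simp
    then show "S = S'" using prime_product_iff[OF S(1,2)] by simp
  qed
  have "(\<Sum>e | ideal e R \<and> g \<subseteq> e. ideal_moebius R e) = (\<Sum>e\<in>PI ` Pow T. ideal_moebius R e)"
  proof (rule sum.mono_neutral_right[OF finite_divisors[OF g]])
    show "PI ` Pow T \<subseteq> {e. ideal e R \<and> g \<subseteq> e}"
    proof
      fix e assume "e \<in> PI ` Pow T"
      then obtain S where S: "S \<subseteq> T" "e = PI S" by blast
      then have "finite S" "S \<subseteq> primes" using sub by auto
      moreover have "\<forall>P\<in>S. g \<subseteq> P" using S(1) unfolding T_def by blast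
      ultimately show "e \<in> {e. ideal e R \<and> g \<subseteq> e}"
        using PI_ideal subset_PI_iff[OF _ _ g] S(2) by blast
    qed
    show "\<forall>e\<in>{e. ideal e R \<and> g \<subseteq> e} - PI ` Pow T. ideal_moebius R e = 0"
    proof
      fix e assume e: "e \<in> {e. ideal e R \<and> g \<subseteq> e} - PI ` Pow T"
      show "ideal_moebius R e = 0"
      proof (rule moebius_eq_0)
        fix S assume S: "finite S" "S \<subseteq> primes"
        show "e \<noteq> PI S"
        proof
          assume eq: "e = PI S"
          then have "S \<subseteq> T" using e subset_PI_iff[OF S g] S(2) unfolding T_def by blast
          then show False using e eq by blast
        qed
      qed
    qed
  qed
  also have "\<dots> = (\<Sum>S\<in>Pow T. ideal_moebius R (PI S))"
    using inj by (simp add: sum.reindex)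
  also have "\<dots> = (\<Sum>S\<in>Pow T. (\<Prod>P\<in>S. (-1)) * (\<Prod>P\<in>T - S. 1))"
    using sub by (intro sum.cong) (auto simp: moebius_PI)
  also have "\<dots> = (\<Prod>P\<in>T. (-1) + 1)"
    by (rule prod_add[OF T(1), symmetric])
  also have "\<dots> = (if T = {} then 1 else 0)"
    using T(1) by (simp add: card_gt_0_iff power_0_left)
  also have "T = {} \<longleftrightarrow> g = carrier R"
  proof
    show "g = carrier R" if "T = {}"
      using exists_prime_containing[OF g] that by (auto simp: T_def)
    show "T = {}" if "g = carrier R"
      using that primesD(3,5) ideal_subset by (fastforce simp: T_def)
  qed
  finally show ?thesis .
qed

lemma divisors_eq:
  assumes "nz n"
  shows "{e \<in> nonzero_ideals R. ideal_divides R e n} = {e. ideal e R \<and> n \<subseteq> e}"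
  using divides_iff[OF assms] nz_superset[OF assms] nzD by blast

text \<open>Regrouping the pairs \<delta> | e | g by c = e/\<delta> lets \<delta> run over the
  divisors of g/c. The Moebius sum over these vanishes unless g/c = R, that is c = g.\<close>

lemma moebius_inversion:
  assumes g: "nz g"
  shows "f g = (\<Sum>e | ideal e R \<and> g \<subseteq> e. ideal_convolution R (ideal_moebius R) f e)"
proof -
  let ?D = "\<lambda>g. {e. ideal e R \<and> g \<subseteq> e}"
  let ?\<mu> = "ideal_moebius R"
  let ?q = "ideal_quotient R"
  have nzg: "nz e" if "e \<in> ?D g" for e using nz_superset[OF g] that by blast
  have "(\<Sum>e\<in>?D g. ideal_convolution R ?\<mu> f e) = (\<Sum>e\<in>?D g. \<Sum>\<delta>\<in>?D e. ?\<mu> \<delta> * f (?q e \<delta>))"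
    using divisors_eq[OF nzg] by (intro sum.cong) (auto simp: ideal_convolution_def)
  also have "\<dots> = (\<Sum>(e, \<delta>)\<in>Sigma (?D g) ?D. ?\<mu> \<delta> * f (?q e \<delta>))"
    using finite_divisors[OF g] finite_divisors[OF nzg] by (intro sum.Sigma) auto
  also have "\<dots> = (\<Sum>(c, \<delta>)\<in>Sigma (?D g) (\<lambda>c. ?D (?q g c)). f c * ?\<mu> \<delta>)"
  proof (rule sum.reindex_bij_witness[where i = "\<lambda>(c, \<delta>). (\<delta> \<cdot> c, \<delta>)" and j = "\<lambda>(e, \<delta>). (?q e \<delta>, \<delta>)"])
    fix p assume "p \<in> Sigma (?D g) ?D"
    then obtain e \<delta> where p: "p = (e, \<delta>)" "ideal e R" "g \<subseteq> e" "ideal \<delta> R" "e \<subseteq> \<delta>" by auto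
    have e: "nz e" "nz \<delta>" using nzg[of e] nzg[of \<delta>] p by auto
    define c where "c = ?q e \<delta>"
    have c: "nz c" "e = \<delta> \<cdot> c" using quotient_props[OF e(1) p(4,5)] by (auto simp: c_def)
    have ci: "ideal c R" using nzD c by blast
    have gc: "g \<subseteq> c" using p(3) c(2) prod_subset[OF p(4) ci] by blast
    define h where "h = ?q g c"
    have h: "nz h" "g = c \<cdot> h" using quotient_props[OF g ci gc] by (auto simp: h_def)
    have "c \<cdot> h \<subseteq> c \<cdot> \<delta>" using p(3) c(2) h(2) ideal_prod_commute[OF p(4) ci] by simp
    then have "h \<subseteq> \<delta>" using prod_subset_cancel[OF c(1) nzD(1)[OF h(1)] p(4)] by blast
    then show "(case (case p of (e, \<delta>) \<Rightarrow> (?q e \<delta>, \<delta>)) of (c, \<delta>) \<Rightarrow> (\<delta> \<cdot> c, \<delta>)) = p"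
      and "(case p of (e, \<delta>) \<Rightarrow> (?q e \<delta>, \<delta>)) \<in> Sigma (?D g) (\<lambda>c. ?D (?q g c))"
      using p(1,4) ci gc c(2) \<open>h \<subseteq> \<delta>\<close> quotient_prod[OF e(2) ci] by (simp_all add: h_def)
    show "(case case p of (e, \<delta>) \<Rightarrow> (?q e \<delta>, \<delta>) of (c, \<delta>) \<Rightarrow> f c * ?\<mu> \<delta>) = (case p of (e, \<delta>) \<Rightarrow> ?\<mu> \<delta> * f (?q e \<delta>))"
      using p by simp
  next
    fix p assume "p \<in> Sigma (?D g) (\<lambda>c. ?D (?q g c))"
    then obtain c \<delta> where p: "p = (c, \<delta>)" "ideal c R" "g \<subseteq> c" "ideal \<delta> R" "?q g c \<subseteq> \<delta>" by auto
    have h: "nz (?q g c)" "g = c \<cdot> ?q g c" using quotient_props[OF g p(2,3)] by auto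
    have \<delta>: "nz \<delta>" using nz_superset[OF h(1) p(4,5)] .
    have "g \<subseteq> c \<cdot> \<delta>" using h(2) ideal_prod_mono[OF subset_refl p(5), of R c] by simp
    then have "g \<subseteq> \<delta> \<cdot> c" using ideal_prod_commute[OF p(2,4)] by simp
    then show "(case case p of (c, \<delta>) \<Rightarrow> (\<delta> \<cdot> c, \<delta>) of (e, \<delta>) \<Rightarrow> (?q e \<delta>, \<delta>)) = p"
      and "(case p of (c, \<delta>) \<Rightarrow> (\<delta> \<cdot> c, \<delta>)) \<in> Sigma (?D g) ?D"
      using p quotient_prod[OF \<delta> p(2)] ideal_prod_is_ideal[OF p(4,2)] prod_subset[OF p(4,2)] by auto
  qed
  also have "\<dots> = (\<Sum>c\<in>?D g. \<Sum>\<delta>\<in>?D (?q g c). f c * ?\<mu> \<delta>)"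
    using finite_divisors[OF g] finite_divisors[OF quotient_props(1)[OF g]] by (intro sum.Sigma[symmetric]) auto
  also have "\<dots> = (\<Sum>c\<in>?D g. if c = g then f c else 0)"
  proof (rule sum.cong[OF refl])
    fix c assume c: "c \<in> ?D g"
    then have q: "nz (?q g c)" "g = c \<cdot> ?q g c" using quotient_props[OF g] by blast+
    have "?q g c = carrier R \<longleftrightarrow> c = g"
    proof
      assume "?q g c = carrier R"
      then show "c = g" using q(2) ideal_prod_one c by auto
    next
      assume "c = g"
      then have "g \<cdot> ?q g c = g \<cdot> carrier R" using q(2) ideal_prod_one nzD(1)[OF g] by metis
      then show "?q g c = carrier R" using prod_cancel[OF nzD[OF g] nzD(1)[OF q(1)] oneideal] by blast
    qed
    then show "(\<Sum>\<delta>\<in>?D (?q g c). f c * ?\<mu> \<delta>) = (if c = g then f c else 0)"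
      using sum_moebius[OF q(1)] by (simp add: sum_distrib_left[symmetric])
  qed
  also have "\<dots> = f g"
    using finite_divisors[OF g] nzD(1)[OF g] by simp
  finally show ?thesis by simp
qed

end

section \<open>Character sums over tuples of units\<close>

text \<open>Fibres are chosen independently in each coordinate, so a pair of target tuples has c to
  the power |I| preimages. \<open>restrict\<close> makes the image tuples extensional, as members of
  the target product sets must be.\<close>

lemma sum_PiE_pair_fibres:
  fixes F :: "('i \<Rightarrow> 'b) \<Rightarrow> ('i \<Rightarrow> 'c) \<Rightarrow> complex"
  assumes I: "finite I" and fin: "finite A" "finite B" "finite C"
    and maps: "\<And>x. x \<in> A \<Longrightarrow> g x \<in> B" "\<And>x. x \<in> A \<Longrightarrow> h x \<in> C"
    and fibre: "\<And>y z. y \<in> B \<Longrightarrow> z \<in> C \<Longrightarrow> card {x \<in> A. g x = y \<and> h x = z} = c"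
  shows "(\<Sum>a\<in>I \<rightarrow>\<^sub>E A. F (restrict (g \<circ> a) I) (restrict (h \<circ> a) I))
    = of_nat (c ^ card I) * (\<Sum>b\<in>I \<rightarrow>\<^sub>E B. \<Sum>b'\<in>I \<rightarrow>\<^sub>E C. F b b')"
proof -
  let ?p = "\<lambda>a. (restrict (g \<circ> a) I, restrict (h \<circ> a) I)"
  have card: "card {a \<in> I \<rightarrow>\<^sub>E A. ?p a = (b, b')} = c ^ card I"
    if b: "b \<in> I \<rightarrow>\<^sub>E B" "b' \<in> I \<rightarrow>\<^sub>E C" for b b'
  proof -
    have "{a \<in> I \<rightarrow>\<^sub>E A. ?p a = (b, b')} = (\<Pi>\<^sub>E i\<in>I. {x \<in> A. g x = b i \<and> h x = b' i})"
    proof (intro equalityI subsetI)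
      fix a assume "a \<in> {a \<in> I \<rightarrow>\<^sub>E A. ?p a = (b, b')}"
      then have a: "a \<in> I \<rightarrow>\<^sub>E A" "restrict (g \<circ> a) I = b" "restrict (h \<circ> a) I = b'" by auto
      then show "a \<in> (\<Pi>\<^sub>E i\<in>I. {x \<in> A. g x = b i \<and> h x = b' i})"
        by (auto simp: PiE_iff)
    next
      fix a assume a: "a \<in> (\<Pi>\<^sub>E i\<in>I. {x \<in> A. g x = b i \<and> h x = b' i})"
      then have "restrict (g \<circ> a) I = b" "restrict (h \<circ> a) I = b'"
        using b by (auto simp: PiE_iff fun_eq_iff extensional_def restrict_def)
      then show "a \<in> {a \<in> I \<rightarrow>\<^sub>E A. ?p a = (b, b')}"
        using a by (auto simp: PiE_iff)
    qed
    also have "card \<dots> = (\<Prod>i\<in>I. c)"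
      unfolding card_PiE[OF I] using b by (intro prod.cong fibre) (auto simp: PiE_iff)
    finally show ?thesis by simp
  qed
  let ?S = "I \<rightarrow>\<^sub>E A" and ?T = "(I \<rightarrow>\<^sub>E B) \<times> (I \<rightarrow>\<^sub>E C)"
  have finS: "finite ?S" "finite ?T" using I fin by (auto intro: finite_PiE)
  have "(\<Sum>a\<in>?S. case ?p a of (b, b') \<Rightarrow> F b b') = (\<Sum>q\<in>?T. \<Sum>a\<in>{a \<in> ?S. ?p a = q}. case ?p a of (b, b') \<Rightarrow> F b b')"
    using maps by (intro sum.group[OF finS, symmetric]) (auto simp: PiE_iff)
  also have "\<dots> = (\<Sum>q\<in>?T. of_nat (c ^ card I) * (case q of (b, b') \<Rightarrow> F b b'))"
  proof (rule sum.cong[OF refl])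
    fix q assume q: "q \<in> ?T"
    have "(\<Sum>a\<in>{a \<in> ?S. ?p a = q}. case ?p a of (b, b') \<Rightarrow> F b b')
        = (\<Sum>a\<in>{a \<in> ?S. ?p a = q}. case q of (b, b') \<Rightarrow> F b b')"
      by (rule sum.cong) auto
    then show "(\<Sum>a\<in>{a \<in> ?S. ?p a = q}. case ?p a of (b, b') \<Rightarrow> F b b')
        = of_nat (c ^ card I) * (case q of (b, b') \<Rightarrow> F b b')"
      using q card by (cases q) auto
  qed
  also have "\<dots> = of_nat (c ^ card I) * (\<Sum>b\<in>I \<rightarrow>\<^sub>E B. \<Sum>b'\<in>I \<rightarrow>\<^sub>E C. F b b')"
    by (simp add: sum_distrib_left sum.cartesian_product)
  finally show ?thesis by simp
qed

text \<open>Both sides are obtained from the sum of \<open>\<chi> (c \<otimes> a 1)\<close> over all units \<open>c\<close> and all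
  tuples \<open>a\<close> with \<open>c \<otimes> (a 1 \<oplus> \<dots> \<oplus> a k) \<in> T\<close>.\<close>

lemma (in cring) unit_sum_tuples_twisted_sum:
  fixes \<chi> :: "'a \<Rightarrow> complex"
  assumes fin: "finite (Units R)"
    and mult: "\<And>x y. x \<in> Units R \<Longrightarrow> y \<in> Units R \<Longrightarrow> \<chi> (x \<otimes> y) = \<chi> x * \<chi> y"
    and nonzero: "\<And>x. x \<in> Units R \<Longrightarrow> \<chi> x \<noteq> 0"
    and k: "k \<ge> 1"
  shows "of_nat (card (Units R)) * (\<Sum>a\<in>unit_sum_tuples R k. if (\<Oplus>i\<in>{1..k}. a i) \<in> T then \<chi> (a 1) else 0)
    = (\<Sum>a\<in>unit_sum_tuples R k. \<chi> (a 1) / \<chi> (\<Oplus>i\<in>{1..k}. a i)) * (\<Sum>t\<in>Units R. if t \<in> T then \<chi> t else 0)"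
proof -
  let ?X = "unit_sum_tuples R k"
  let ?s = "\<lambda>a. \<Oplus>i\<in>{1..k}. a i"
  define act where "act c a = (\<lambda>i\<in>{1..k}. c \<otimes> a i)" for c and a :: "nat \<Rightarrow> 'a"
  have X: "a i \<in> Units R" "a i \<in> carrier R" if "a \<in> ?X" "i \<in> {1..k}" for a i
    using that Units_closed by (auto simp: unit_sum_tuples_def PiE_iff)
  have sX: "?s a \<in> Units R" if "a \<in> ?X" for a
    using that by (auto simp: unit_sum_tuples_def)
  have s_act: "?s (act c a) = c \<otimes> ?s a" if "a \<in> ?X" "c \<in> carrier R" for a c
  proof -
    have "?s (act c a) = (\<Oplus>i\<in>{1..k}. c \<otimes> a i)"
      using X[OF that(1)] that(2) by (intro finsum_cong') (auto simp: act_def)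
    also have "\<dots> = c \<otimes> ?s a"
      using X[OF that(1)] that(2) by (intro finsum_rdistr[symmetric]) auto
    finally show ?thesis .
  qed
  have act_X: "act c a \<in> ?X" if a: "a \<in> ?X" and c: "c \<in> Units R" for a c
  proof -
    have "act c a \<in> {1..k} \<rightarrow>\<^sub>E Units R"
      using X(1)[OF a] c by (auto simp: act_def)
    moreover have "?s (act c a) \<in> Units R"
      using s_act[OF a Units_closed[OF c]] sX[OF a] c by simp
    ultimately show ?thesis by (simp add: unit_sum_tuples_def)
  qed
  have act_inv: "act c' (act c a) = a" if a: "a \<in> ?X" and c: "c \<in> Units R" "c' \<in> Units R" "c' \<otimes> c = \<one>" for a c c'
  proof
    fix i show "act c' (act c a) i = a i"
    proof (cases "i \<in> {1..k}")
      case True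
      then have "act c' (act c a) i = c' \<otimes> (c \<otimes> a i)"
        by (simp add: act_def)
      also have "\<dots> = a i"
        using X[OF a True] c by (simp add: m_assoc[symmetric] Units_closed)
      finally show ?thesis .
    next
      case False
      then show ?thesis using a by (auto simp: act_def unit_sum_tuples_def PiE_iff extensional_def)
    qed
  qed
  let ?G = "\<lambda>a. if ?s a \<in> T then \<chi> (a 1) else 0"
  have shift: "sum ?G ?X = (\<Sum>a\<in>?X. if c \<otimes> ?s a \<in> T then \<chi> c * \<chi> (a 1) else 0)" if c: "c \<in> Units R" for c
  proof -
    have inv: "inv c \<in> Units R" "inv c \<otimes> c = \<one>" "c \<otimes> inv c = \<one>" using c by auto
    have "sum ?G ?X = (\<Sum>a\<in>?X. ?G (act c a))"
      by (rule sum.reindex_bij_witness[where i = "act c" and j = "act (inv c)"])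
        (use act_X act_inv c inv in auto)
    also have "\<dots> = (\<Sum>a\<in>?X. if c \<otimes> ?s a \<in> T then \<chi> c * \<chi> (a 1) else 0)"
      using s_act[OF _ Units_closed[OF c]] mult[OF c] X(1) k by (intro sum.cong) (auto simp: act_def)
    finally show ?thesis .
  qed
  have "of_nat (card (Units R)) * sum ?G ?X = (\<Sum>c\<in>Units R. sum ?G ?X)"
    by simp
  also have "\<dots> = (\<Sum>c\<in>Units R. \<Sum>a\<in>?X. if c \<otimes> ?s a \<in> T then \<chi> c * \<chi> (a 1) else 0)"
    using shift by (rule sum.cong[OF refl])
  also have "\<dots> = (\<Sum>a\<in>?X. \<Sum>c\<in>Units R. if c \<otimes> ?s a \<in> T then \<chi> c * \<chi> (a 1) else 0)"
    by (rule sum.swap)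
  also have "\<dots> = (\<Sum>a\<in>?X. \<chi> (a 1) / \<chi> (?s a) * (\<Sum>t\<in>Units R. if t \<in> T then \<chi> t else 0))"
  proof (rule sum.cong[OF refl])
    fix a assume a: "a \<in> ?X"
    let ?u = "?s a"
    have u: "?u \<in> Units R" using sX[OF a] .
    \<comment> \<open>Substituting t for c times the tuple sum u turns \<chi>(c) \<chi>(a_1) into
      \<chi>(a_1)/\<chi>(u) times \<chi>(t), which separates the tuple from the condition on
      t.\<close>
    have "(\<Sum>c\<in>Units R. if c \<otimes> ?u \<in> T then \<chi> c * \<chi> (a 1) else 0)
        = (\<Sum>t\<in>Units R. if t \<in> T then \<chi> (a 1) / \<chi> ?u * \<chi> t else 0)"
    proof (rule sum.reindex_bij_witness[where i = "\<lambda>t. t \<otimes> inv ?u" and j = "\<lambda>c. c \<otimes> ?u"])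
      fix c assume c: "c \<in> Units R"
      show "c \<otimes> ?u \<otimes> inv ?u = c" "c \<otimes> inv ?u \<otimes> ?u = c"
        using c u by (auto simp: m_assoc Units_closed)
      show "c \<otimes> ?u \<in> Units R" "c \<otimes> inv ?u \<in> Units R" using c u by auto
      show "(if c \<otimes> ?u \<in> T then \<chi> (a 1) / \<chi> ?u * \<chi> (c \<otimes> ?u) else 0) = (if c \<otimes> ?u \<in> T then \<chi> c * \<chi> (a 1) else 0)"
        using mult[OF c u] nonzero[OF u] by simp
    qed
    also have "\<dots> = \<chi> (a 1) / \<chi> ?u * (\<Sum>t\<in>Units R. if t \<in> T then \<chi> t else 0)"
      unfolding sum_distrib_left by (rule sum.cong) auto
    finally show "(\<Sum>c\<in>Units R. if c \<otimes> ?u \<in> T then \<chi> c * \<chi> (a 1) else 0)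
        = \<chi> (a 1) / \<chi> ?u * (\<Sum>t\<in>Units R. if t \<in> T then \<chi> t else 0)" .
  qed
  finally show ?thesis by (simp add: sum_distrib_right)
qed

lemma sum_PiE_Suc:
  fixes F :: "(nat \<Rightarrow> 'b) \<Rightarrow> complex"
  shows "(\<Sum>a\<in>{1..Suc k} \<rightarrow>\<^sub>E U. F a) = (\<Sum>v\<in>U. \<Sum>a\<in>{1..k} \<rightarrow>\<^sub>E U. F (a(Suc k := v)))"
proof -
  have "(\<Sum>a\<in>{1..Suc k} \<rightarrow>\<^sub>E U. F a) = (\<Sum>(v, a)\<in>U \<times> ({1..k} \<rightarrow>\<^sub>E U). F (a(Suc k := v)))"
  proof (rule sum.reindex_bij_witness[where j = "\<lambda>a. (a (Suc k), restrict a {1..k})"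
        and i = "\<lambda>(v, a). a(Suc k := v)"])
    fix a assume a: "a \<in> {1..Suc k} \<rightarrow>\<^sub>E U"
    show *: "(case (a (Suc k), restrict a {1..k}) of (v, a) \<Rightarrow> a(Suc k := v)) = a"
      using a by (auto simp: PiE_iff fun_eq_iff extensional_def restrict_def le_Suc_eq)
    show "(a (Suc k), restrict a {1..k}) \<in> U \<times> ({1..k} \<rightarrow>\<^sub>E U)"
      using a by (simp add: PiE_iff)
    show "(case (a (Suc k), restrict a {1..k}) of (v, a) \<Rightarrow> F (a(Suc k := v))) = F a"
      using * by simp
  next
    fix p assume "p \<in> U \<times> ({1..k} \<rightarrow>\<^sub>E U)"
    then obtain v a where p: "p = (v, a)" "v \<in> U" "a \<in> {1..k} \<rightarrow>\<^sub>E U" by auto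
    then show "((case p of (v, a) \<Rightarrow> a(Suc k := v)) (Suc k),
        restrict (case p of (v, a) \<Rightarrow> a(Suc k := v)) {1..k}) = p"
      by (auto simp: PiE_iff fun_eq_iff extensional_def restrict_def)
    show "(case p of (v, a) \<Rightarrow> a(Suc k := v)) \<in> {1..Suc k} \<rightarrow>\<^sub>E U"
      using p by (auto simp: PiE_iff extensional_def le_Suc_eq)
  qed
  then show ?thesis by (simp add: sum.cartesian_product)
qed

section \<open>Sums of characters over residue classes and over tuples\<close>

context dedekind
begin

lemma character_props:
  assumes "ideal n R" "dirichlet_char R n \<chi>"
  shows "\<And>A B. A \<in> Units (R Quot n) \<Longrightarrow> B \<in> Units (R Quot n) \<Longrightarrow> \<chi> (A \<otimes>\<^bsub>R Quot n\<^esub> B) = \<chi> A * \<chi> B"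
    and "\<And>A. A \<in> Units (R Quot n) \<Longrightarrow> \<chi> A \<noteq> 0"
proof -
  have hom: "\<chi> \<in> hom (units_of (R Quot n)) (units_of (ring_of_type_algebra :: complex ring))"
    using assms(2) by (simp add: dirichlet_char_def)
  show "\<chi> (A \<otimes>\<^bsub>R Quot n\<^esub> B) = \<chi> A * \<chi> B" if "A \<in> Units (R Quot n)" "B \<in> Units (R Quot n)" for A B
    using hom_mult[OF hom, of A B] that by (simp add: units_of_def)
  show "\<chi> A \<noteq> 0" if "A \<in> Units (R Quot n)" for A
    using hom_in_carrier[OF hom, of A] that by (auto simp: units_of_def Units_def)
qed

lemma reduce_class_self: "ideal n R \<Longrightarrow> A \<in> carrier (R Quot n) \<Longrightarrow> reduce_class R n A = A"
  using class_rep_quotient(2) by (simp add: reduce_class_def)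

text \<open>If e is not an induced modulus, some unit u congruent to 1 modulo e has \<chi>(u)
  \<noteq> 1. Multiplication by u permutes the units over B and multiplies their character sum by
  \<chi>(u).\<close>

lemma character_sum_coset_eq_0:
  assumes n: "nz n" and \<chi>: "dirichlet_char R n \<chi>" and e: "ideal e R" "n \<subseteq> e"
    and not_induced: "\<not> induced_modulus R n \<chi> e"
  shows "(\<Sum>A\<in>Units (R Quot n). if reduce_class R e A = B then \<chi> A else 0) = 0"
proof -
  note n' = nzD(1)[OF n]
  note \<chi>' = character_props[OF n' \<chi>]
  interpret h: ring_hom_cring "R Quot n" "R Quot e" "reduce_class R e"
    by (rule reduce_class_hom[OF n' e])
  let ?U = "Units (R Quot n)"
  obtain x y where xy: "x \<in> carrier R" "y \<in> carrier R" "n +> x \<in> ?U" "n +> y \<in> ?U"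
    "x \<ominus> y \<in> e" "\<chi> (n +> x) \<noteq> \<chi> (n +> y)"
    using not_induced divides_iff[OF n e(1)] e by (auto simp: induced_modulus_def)
  define u where "u = (n +> x) \<otimes>\<^bsub>R Quot n\<^esub> inv\<^bsub>R Quot n\<^esub> (n +> y)"
  have u: "u \<in> ?U" using xy by (simp add: u_def)
  have uy: "u \<otimes>\<^bsub>R Quot n\<^esub> (n +> y) = n +> x"
    using xy by (simp add: u_def h.R.m_assoc h.R.Units_closed)
  have \<chi>u: "\<chi> u \<noteq> 1"
    using \<chi>'(1)[OF u xy(4)] uy xy(6) by auto
  have red_xy: "reduce_class R e (n +> x) = reduce_class R e (n +> y)"
    using reduce_class_coset[OF n' e] quotient_ops(6)[OF e(1) xy(1,2)] xy by simp
  have red_u: "reduce_class R e u = \<one>\<^bsub>R Quot e\<^esub>"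
  proof -
    have "reduce_class R e u = reduce_class R e (n +> y) \<otimes>\<^bsub>R Quot e\<^esub> reduce_class R e (inv\<^bsub>R Quot n\<^esub> (n +> y))"
      using xy red_xy by (simp add: u_def h.R.Units_closed)
    also have "\<dots> = reduce_class R e ((n +> y) \<otimes>\<^bsub>R Quot n\<^esub> inv\<^bsub>R Quot n\<^esub> (n +> y))"
      using xy by (simp add: h.R.Units_closed del: h.R.Units_r_inv)
    finally show ?thesis using xy by simp
  qed
  have red_mult: "reduce_class R e (u \<otimes>\<^bsub>R Quot n\<^esub> A) = reduce_class R e A" if "A \<in> ?U" for A
    using h.hom_mult[OF h.R.Units_closed[OF u] h.R.Units_closed[OF that]] red_u
      h.hom_closed[OF h.R.Units_closed[OF that]] by simp
  let ?S = "\<Sum>A\<in>?U. if reduce_class R e A = B then \<chi> A else 0"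
  have "?S = (\<Sum>A\<in>?U. if reduce_class R e A = B then \<chi> u * \<chi> A else 0)"
  proof (rule sum.reindex_bij_witness[where i = "\<lambda>A. u \<otimes>\<^bsub>R Quot n\<^esub> A" and j = "\<lambda>A. inv\<^bsub>R Quot n\<^esub> u \<otimes>\<^bsub>R Quot n\<^esub> A"])
    fix A assume A: "A \<in> ?U"
    have iu: "inv\<^bsub>R Quot n\<^esub> u \<in> ?U" using u by simp
    show 1: "u \<otimes>\<^bsub>R Quot n\<^esub> (inv\<^bsub>R Quot n\<^esub> u \<otimes>\<^bsub>R Quot n\<^esub> A) = A"
      and "inv\<^bsub>R Quot n\<^esub> u \<otimes>\<^bsub>R Quot n\<^esub> (u \<otimes>\<^bsub>R Quot n\<^esub> A) = A"
      using u A by (simp_all add: h.R.m_assoc[symmetric] h.R.Units_closed)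
    show 2: "inv\<^bsub>R Quot n\<^esub> u \<otimes>\<^bsub>R Quot n\<^esub> A \<in> ?U" and "u \<otimes>\<^bsub>R Quot n\<^esub> A \<in> ?U" using u iu A by simp_all
    show "(if reduce_class R e (inv\<^bsub>R Quot n\<^esub> u \<otimes>\<^bsub>R Quot n\<^esub> A) = B then \<chi> u * \<chi> (inv\<^bsub>R Quot n\<^esub> u \<otimes>\<^bsub>R Quot n\<^esub> A) else 0)
        = (if reduce_class R e A = B then \<chi> A else 0)"
      using red_mult[OF 2] \<chi>'(1)[OF u 2] 1 by simp
  qed
  also have "\<dots> = \<chi> u * ?S"
    unfolding sum_distrib_left by (rule sum.cong) auto
  finally show ?thesis using \<chi>u by simp
qed

text \<open>Congruence modulo e implies congruence modulo the induced modulus d, so \<chi> is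
  constant on the fibre over r, which has \<phi>(n)/\<phi>(e) elements.\<close>

lemma character_sum_coset:
  assumes n: "nz n" and \<chi>: "dirichlet_char R n \<chi>" and e: "ideal e R" "n \<subseteq> e"
    and d: "induced_modulus R n \<chi> d" "e \<subseteq> d"
    and r: "r \<in> carrier R" "n +> r \<in> Units (R Quot n)"
  shows "(\<Sum>A\<in>Units (R Quot n). if reduce_class R e A = e +> r then \<chi> A else 0)
    = \<chi> (n +> r) * of_nat (ideal_totient R n) / of_nat (ideal_totient R e)"
proof -
  note n' = nzD(1)[OF n]
  let ?F = "{A \<in> Units (R Quot n). reduce_class R e A = e +> r}"
  have "\<chi> A = \<chi> (n +> r)" if A: "A \<in> ?F" for A
  proof -
    obtain x where x: "x \<in> carrier R" "A = n +> x" using quotient_cases[OF n'] A Units_sub by blast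
    then have "x \<ominus> r \<in> e"
      using A reduce_class_coset[OF n' e x(1)] quotient_ops(6)[OF e(1) x(1) r(1)] by simp
    then show ?thesis
      using d x A r unfolding induced_modulus_def by blast
  qed
  then have "(\<Sum>A\<in>?F. \<chi> A) = of_nat (card ?F) * \<chi> (n +> r)"
    by simp
  moreover have "(\<Sum>A\<in>?F. \<chi> A) = (\<Sum>A\<in>Units (R Quot n). if reduce_class R e A = e +> r then \<chi> A else 0)"
    using finite_Units[OF n] by (simp add: sum.inter_filter)
  moreover have "e +> r \<in> Units (R Quot e)"
    using reduce_class_unit[OF n e r(2)] reduce_class_coset[OF n' e r(1)] by simp
  then have "ideal_totient R n = ideal_totient R e * card ?F"
    by (rule card_unit_fibre[OF n e])
  moreover have "ideal_totient R e > 0" using totient_pos[OF nz_superset[OF n e]] .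
  ultimately show ?thesis by (simp add: field_simps)
qed

text \<open>For a representative x of A, the \<delta> modulo which A vanishes are the divisors of
  gcd(x, d). Their Moebius sum tests whether this gcd is R.\<close>

lemma unit_indicator:
  assumes d: "nz d" and A: "A \<in> carrier (R Quot d)"
  shows "(\<Sum>\<delta> | ideal \<delta> R \<and> d \<subseteq> \<delta>. if reduce_class R \<delta> A = \<delta> then ideal_moebius R \<delta> else 0)
    = (if A \<in> Units (R Quot d) then 1 else 0)"
proof -
  note d' = nzD(1)[OF d]
  obtain x where x: "x \<in> carrier R" "A = d +> x" using quotient_cases[OF d' A] by blast
  define g where "g = PIdl x <+>\<^bsub>R\<^esub> d"
  note Px = cgenideal_ideal[OF x(1)]
  have sub: "g \<subseteq> \<delta> \<longleftrightarrow> x \<in> \<delta> \<and> d \<subseteq> \<delta>" if "ideal \<delta> R" for \<delta>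
    using ideal_sum_subset_iff[OF Px d' that] cgenideal_subset_iff[OF that x(1)] by (simp add: g_def)
  have gi: "ideal g R" unfolding g_def by (rule add_ideals[OF Px d'])
  then have g: "nz g" using nz_superset[OF d] sub[OF gi] by blast
  have red: "reduce_class R \<delta> A = \<delta> \<longleftrightarrow> x \<in> \<delta>" if "ideal \<delta> R" "d \<subseteq> \<delta>" for \<delta>
    using reduce_class_coset[OF d' that x(1)] x(2) a_rcos_zero[OF that(1)]
      ideal.rcos_const_imp_mem[OF that(1) x(1)] by auto
  have "(\<Sum>\<delta> | ideal \<delta> R \<and> d \<subseteq> \<delta>. if reduce_class R \<delta> A = \<delta> then ideal_moebius R \<delta> else 0)
      = (\<Sum>\<delta> | (ideal \<delta> R \<and> d \<subseteq> \<delta>) \<and> reduce_class R \<delta> A = \<delta>. ideal_moebius R \<delta>)"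
    using finite_divisors[OF d] by (simp add: sum.inter_filter[symmetric])
  also have "\<dots> = (\<Sum>\<delta> | ideal \<delta> R \<and> g \<subseteq> \<delta>. ideal_moebius R \<delta>)"
  proof (rule sum.cong[OF _ refl])
    show "{\<delta>. (ideal \<delta> R \<and> d \<subseteq> \<delta>) \<and> reduce_class R \<delta> A = \<delta>} = {\<delta>. ideal \<delta> R \<and> g \<subseteq> \<delta>}"
      using sub red by blast
  qed
  also have "\<dots> = (if g = carrier R then 1 else 0)" by (rule sum_moebius[OF g])
  also have "g = carrier R \<longleftrightarrow> A \<in> Units (R Quot d)"
    using coset_unit_iff_sum[OF d' x(1)] x(2) by (simp add: g_def)
  finally show ?thesis .
qed

text \<open>With w = u - v the sum runs over units w such that u - w is a unit too. Detecting the
  latter by Moebius leaves, for each \<delta> | d, the sum of \<psi> over w congruent to u modulo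
  \<delta>. Primitivity kills it for \<delta> \<noteq> d, and \<delta> = d leaves w = u. The
  extension \<open>\<psi>0\<close> by zero is used because u - v may be a non-unit, where \<psi> is
  arbitrary.\<close>

lemma primitive_sum_shift:
  assumes d: "nz d" and \<psi>: "primitive_char R d \<psi>" and u: "u \<in> carrier (R Quot d)"
  defines "\<psi>0 \<equiv> \<lambda>w. if w \<in> Units (R Quot d) then \<psi> w else 0"
  shows "(\<Sum>v\<in>Units (R Quot d). \<psi>0 (u \<ominus>\<^bsub>R Quot d\<^esub> v)) = ideal_moebius R d * \<psi>0 u"
proof -
  note d' = nzD(1)[OF d]
  interpret Q: cring "R Quot d" by (rule quotient_cring[OF d'])
  let ?Q = "R Quot d" and ?\<mu> = "ideal_moebius R"
  let ?C = "carrier ?Q" and ?U = "Units ?Q"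
  let ?D = "{\<delta>. ideal \<delta> R \<and> d \<subseteq> \<delta>}"
  have dir: "dirichlet_char R d \<psi>" using \<psi> by (simp add: primitive_char_def)
  have fin: "finite ?C" using finite_quot[OF nzD[OF d]] .
  have UC: "?U \<subseteq> ?C" using Units_sub .
  have inner: "(\<Sum>w\<in>?U. if reduce_class R \<delta> w = reduce_class R \<delta> u then \<psi> w else 0)
      = (if \<delta> = d then \<psi>0 u else 0)" if \<delta>: "\<delta> \<in> ?D" for \<delta>
  proof (cases "\<delta> = d")
    case True
    then have "(\<Sum>w\<in>?U. if reduce_class R \<delta> w = reduce_class R \<delta> u then \<psi> w else 0)
        = (\<Sum>w\<in>?U. if w = u then \<psi> w else 0)"
      using reduce_class_self[OF d'] UC u by (intro sum.cong) auto
    then show ?thesis using True finite_Units[OF d] by (simp add: \<psi>0_def)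
  next
    case False
    then have "\<not> induced_modulus R d \<psi> \<delta>" using \<psi> by (auto simp: primitive_char_def)
    then show ?thesis using character_sum_coset_eq_0[OF d dir] \<delta> False by simp
  qed
  have "(\<Sum>v\<in>?U. \<psi>0 (u \<ominus>\<^bsub>?Q\<^esub> v)) = (\<Sum>v\<in>?C. if v \<in> ?U then \<psi>0 (u \<ominus>\<^bsub>?Q\<^esub> v) else 0)"
    using fin UC by (simp add: sum.inter_restrict[symmetric] Int_absorb1)
  also have "\<dots> = (\<Sum>w\<in>?C. if u \<ominus>\<^bsub>?Q\<^esub> w \<in> ?U then \<psi>0 w else 0)"
  proof -
    have invol: "u \<ominus>\<^bsub>?Q\<^esub> (u \<ominus>\<^bsub>?Q\<^esub> v) = v" if "v \<in> ?C" for v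
      using u that by (simp add: a_minus_def Q.minus_add Q.a_assoc[symmetric] Q.r_neg)
    show ?thesis
      by (rule sum.reindex_bij_witness[where i = "\<lambda>w. u \<ominus>\<^bsub>?Q\<^esub> w" and j = "\<lambda>w. u \<ominus>\<^bsub>?Q\<^esub> w"])
        (use u invol in auto)
  qed
  also have "\<dots> = (\<Sum>w\<in>?U. (if u \<ominus>\<^bsub>?Q\<^esub> w \<in> ?U then 1 else 0) * \<psi> w)"
    using fin UC by (intro sum.mono_neutral_cong_right) (auto simp: \<psi>0_def)
  also have "\<dots> = (\<Sum>w\<in>?U. \<Sum>\<delta>\<in>?D. ?\<mu> \<delta> * (if reduce_class R \<delta> w = reduce_class R \<delta> u then \<psi> w else 0))"
  proof (rule sum.cong[OF refl])
    fix w assume "w \<in> ?U"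
    then have w: "w \<in> ?C" using UC by blast
    have uw: "u \<ominus>\<^bsub>?Q\<^esub> w \<in> ?C" using u w by simp
    have red: "reduce_class R \<delta> (u \<ominus>\<^bsub>?Q\<^esub> w) = \<delta> \<longleftrightarrow> reduce_class R \<delta> w = reduce_class R \<delta> u" if \<delta>: "\<delta> \<in> ?D" for \<delta>
    proof -
      obtain x y where xy: "x \<in> carrier R" "u = d +> x" "y \<in> carrier R" "w = d +> y"
        using quotient_cases[OF d'] u w by metis
      interpret h: ring_hom_cring ?Q "R Quot \<delta>" "reduce_class R \<delta>"
        using \<delta> by (intro reduce_class_hom[OF d']) auto
      have "\<zero>\<^bsub>R Quot \<delta>\<^esub> = \<delta>" using quotient_ops(4)[of \<delta> \<zero> \<zero>] \<delta> by simp
      moreover have "reduce_class R \<delta> (u \<ominus>\<^bsub>?Q\<^esub> w) = reduce_class R \<delta> u \<ominus>\<^bsub>R Quot \<delta>\<^esub> reduce_class R \<delta> w"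
        using u w by (simp add: a_minus_def)
      ultimately show ?thesis
        using h.S.r_right_minus_eq[of "reduce_class R \<delta> u" "reduce_class R \<delta> w"] u w by auto
    qed
    show "(if u \<ominus>\<^bsub>?Q\<^esub> w \<in> ?U then 1 else 0) * \<psi> w
        = (\<Sum>\<delta>\<in>?D. ?\<mu> \<delta> * (if reduce_class R \<delta> w = reduce_class R \<delta> u then \<psi> w else 0))"
      unfolding unit_indicator[OF d uw, symmetric] sum_distrib_right
      using red by (intro sum.cong) auto
  qed
  also have "\<dots> = (\<Sum>\<delta>\<in>?D. ?\<mu> \<delta> * (\<Sum>w\<in>?U. if reduce_class R \<delta> w = reduce_class R \<delta> u then \<psi> w else 0))"
    unfolding sum_distrib_left by (rule sum.swap)
  also have "\<dots> = (\<Sum>\<delta>\<in>?D. if \<delta> = d then ?\<mu> d * \<psi>0 u else 0)"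
    using inner by (intro sum.cong) auto
  also have "\<dots> = ?\<mu> d * \<psi>0 u"
    using finite_divisors[OF d] d' by simp
  finally show ?thesis .
qed

text \<open>Splitting off the last entry v leaves a shorter tuple with sum u - v, and summing over v
  yields one factor \<mu>(d). A single entry yields none, hence the exponent k - 1. Since u - v need
  not be a unit, the induction covers all classes u.\<close>

lemma primitive_sum_tuples:
  assumes d: "nz d" and \<psi>: "primitive_char R d \<psi>" and k: "k \<ge> 1" and u: "u \<in> carrier (R Quot d)"
  shows "(\<Sum>a\<in>{1..k} \<rightarrow>\<^sub>E Units (R Quot d). if (\<Oplus>\<^bsub>R Quot d\<^esub>i\<in>{1..k}. a i) = u then \<psi> (a 1) else 0)
    = ideal_moebius R d ^ (k - 1) * (if u \<in> Units (R Quot d) then \<psi> u else 0)"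
  using k u
proof (induction k arbitrary: u rule: dec_induct)
  note d' = nzD(1)[OF d]
  interpret Q: cring "R Quot d" by (rule quotient_cring[OF d'])
  let ?Q = "R Quot d"
  let ?U = "Units ?Q"
  {
    case base
    have "(\<Oplus>\<^bsub>?Q\<^esub>i\<in>{1..1::nat}. a i) = a 1" if "a 1 \<in> carrier ?Q" for a :: "nat \<Rightarrow> 'a set"
      using that by simp
    then have "(\<Sum>a\<in>{1..1::nat} \<rightarrow>\<^sub>E ?U. if (\<Oplus>\<^bsub>?Q\<^esub>i\<in>{1..1}. a i) = u then \<psi> (a 1) else 0)
        = (\<Sum>a\<in>{1..1::nat} \<rightarrow>\<^sub>E ?U. if a 1 = u then \<psi> (a 1) else 0)"
      using Units_sub by (intro sum.cong) (auto simp: PiE_iff)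
    also have "\<dots> = (\<Sum>v\<in>?U. \<Sum>a\<in>{1..0::nat} \<rightarrow>\<^sub>E ?U.
        if (a(Suc 0 := v)) 1 = u then \<psi> ((a(Suc 0 := v)) 1) else 0)"
      using sum_PiE_Suc[of "\<lambda>a. if a 1 = u then \<psi> (a 1) else 0" 0 ?U] by (simp only: One_nat_def)
    also have "\<dots> = (\<Sum>v\<in>?U. if v = u then \<psi> v else 0)"
      by (rule sum.cong[OF refl]) simp
    also have "\<dots> = (if u \<in> ?U then \<psi> u else 0)"
      using finite_Units[OF d] by simp
    finally show ?case by simp
  next
    case (step k)
    have eq: "(\<Oplus>\<^bsub>?Q\<^esub>i\<in>{1..Suc k}. (a(Suc k := v)) i) = u \<longleftrightarrow> (\<Oplus>\<^bsub>?Q\<^esub>i\<in>{1..k}. a i) = u \<ominus>\<^bsub>?Q\<^esub> v"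
      if v: "v \<in> ?U" and a: "a \<in> {1..k} \<rightarrow>\<^sub>E ?U" for v a
    proof -
      have a': "a i \<in> carrier ?Q" if "i \<in> {1..k}" for i using a that Units_sub by (auto simp: PiE_iff)
      have v': "v \<in> carrier ?Q" using v Units_sub by blast
      have s: "(\<Oplus>\<^bsub>?Q\<^esub>i\<in>{1..k}. a i) \<in> carrier ?Q" using a' by auto
      have "(\<Oplus>\<^bsub>?Q\<^esub>i\<in>{1..Suc k}. (a(Suc k := v)) i) = (\<Oplus>\<^bsub>?Q\<^esub>i\<in>insert (Suc k) {1..k}. (a(Suc k := v)) i)"
        by (simp add: atLeastAtMostSuc_conv)
      also have "\<dots> = v \<oplus>\<^bsub>?Q\<^esub> (\<Oplus>\<^bsub>?Q\<^esub>i\<in>{1..k}. (a(Suc k := v)) i)"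
        using a' v' by (subst Q.finsum_insert) auto
      also have "(\<Oplus>\<^bsub>?Q\<^esub>i\<in>{1..k}. (a(Suc k := v)) i) = (\<Oplus>\<^bsub>?Q\<^esub>i\<in>{1..k}. a i)"
        using a' by (intro Q.finsum_cong') auto
      finally have "(\<Oplus>\<^bsub>?Q\<^esub>i\<in>{1..Suc k}. (a(Suc k := v)) i) = v \<oplus>\<^bsub>?Q\<^esub> (\<Oplus>\<^bsub>?Q\<^esub>i\<in>{1..k}. a i)" .
      moreover have "v \<oplus>\<^bsub>?Q\<^esub> s = u \<longleftrightarrow> s = u \<ominus>\<^bsub>?Q\<^esub> v" if "s \<in> carrier ?Q" for s
        using that v' step.prems by (metis Q.add.inv_solve_right Q.a_comm a_minus_def)
      ultimately show ?thesis using s by simp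
    qed
    have "(\<Sum>a\<in>{1..Suc k} \<rightarrow>\<^sub>E ?U. if (\<Oplus>\<^bsub>?Q\<^esub>i\<in>{1..Suc k}. a i) = u then \<psi> (a 1) else 0)
        = (\<Sum>v\<in>?U. \<Sum>a\<in>{1..k} \<rightarrow>\<^sub>E ?U. if (\<Oplus>\<^bsub>?Q\<^esub>i\<in>{1..Suc k}. (a(Suc k := v)) i) = u
            then \<psi> ((a(Suc k := v)) 1) else 0)"
      by (rule sum_PiE_Suc)
    also have "\<dots> = (\<Sum>v\<in>?U. \<Sum>a\<in>{1..k} \<rightarrow>\<^sub>E ?U. if (\<Oplus>\<^bsub>?Q\<^esub>i\<in>{1..k}. a i) = u \<ominus>\<^bsub>?Q\<^esub> v then \<psi> (a 1) else 0)"
    proof (rule sum.cong[OF refl], rule sum.cong[OF refl])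
      fix v a assume va: "v \<in> ?U" "a \<in> {1..k} \<rightarrow>\<^sub>E ?U"
      \<comment> \<open>The induction starts at 1, so the overwritten entry is never the one that
        \<psi> sees.\<close>
      have "(a(Suc k := v)) 1 = a 1" using step.hyps by simp
      then show "(if (\<Oplus>\<^bsub>?Q\<^esub>i\<in>{1..Suc k}. (a(Suc k := v)) i) = u then \<psi> ((a(Suc k := v)) 1) else 0)
          = (if (\<Oplus>\<^bsub>?Q\<^esub>i\<in>{1..k}. a i) = u \<ominus>\<^bsub>?Q\<^esub> v then \<psi> (a 1) else 0)"
        by (simp only: eq[OF va])
    qed
    also have "\<dots> = (\<Sum>v\<in>?U. ideal_moebius R d ^ (k - 1) * (if u \<ominus>\<^bsub>?Q\<^esub> v \<in> ?U then \<psi> (u \<ominus>\<^bsub>?Q\<^esub> v) else 0))"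
      using step.IH step.prems Units_sub by (intro sum.cong) auto
    also have "\<dots> = ideal_moebius R d ^ (k - 1) * (ideal_moebius R d * (if u \<in> ?U then \<psi> u else 0))"
      using primitive_sum_shift[OF d \<psi> step.prems] by (simp add: sum_distrib_left[symmetric])
    also have "\<dots> = ideal_moebius R d ^ (Suc k - 1) * (if u \<in> ?U then \<psi> u else 0)"
      using step.hyps by (cases k) (auto simp: mult_ac)
    finally show ?case .
  }
qed

text \<open>Grouping the tuples by their sum u, each of the \<phi>(d) units u contributes
  \<mu>(d)^(k-1) \<psi>(u)/\<psi>(u).\<close>

lemma primitive_jacobi_sum:
  assumes d: "nz d" and \<psi>: "primitive_char R d \<psi>" and k: "k \<ge> 1"
  shows "(\<Sum>a\<in>unit_sum_tuples (R Quot d) k. \<psi> (a 1) / \<psi> (\<Oplus>\<^bsub>R Quot d\<^esub>i\<in>{1..k}. a i))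
    = of_nat (ideal_totient R d) * ideal_moebius R d ^ (k - 1)"
proof -
  note d' = nzD(1)[OF d]
  let ?Q = "R Quot d"
  let ?U = "Units ?Q" and ?P = "{1..k} \<rightarrow>\<^sub>E Units ?Q" and ?s = "\<lambda>a. \<Oplus>\<^bsub>?Q\<^esub>i\<in>{1..k}. a i"
  have dir: "dirichlet_char R d \<psi>" using \<psi> by (simp add: primitive_char_def)
  have nonzero: "\<psi> A \<noteq> 0" if "A \<in> ?U" for A using character_props(2)[OF d' dir that] .
  have finP: "finite ?P" using finite_Units[OF d] by (intro finite_PiE) auto
  have "(\<Sum>a\<in>unit_sum_tuples ?Q k. \<psi> (a 1) / \<psi> (?s a)) = (\<Sum>a\<in>?P. if ?s a \<in> ?U then \<psi> (a 1) / \<psi> (?s a) else 0)"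
    unfolding unit_sum_tuples_def by (rule sum.inter_filter[OF finP])
  also have "\<dots> = (\<Sum>a\<in>?P. \<Sum>u\<in>?U. (if ?s a = u then \<psi> (a 1) else 0) / \<psi> u)"
  proof (rule sum.cong[OF refl])
    fix a
    have "(\<Sum>u\<in>?U. (if ?s a = u then \<psi> (a 1) else 0) / \<psi> u) = (\<Sum>u\<in>?U. if ?s a = u then \<psi> (a 1) / \<psi> u else 0)"
      by (rule sum.cong) auto
    then show "(if ?s a \<in> ?U then \<psi> (a 1) / \<psi> (?s a) else 0) = (\<Sum>u\<in>?U. (if ?s a = u then \<psi> (a 1) else 0) / \<psi> u)"
      using finite_Units[OF d] by simp
  qed
  also have "\<dots> = (\<Sum>u\<in>?U. (\<Sum>a\<in>?P. if ?s a = u then \<psi> (a 1) else 0) / \<psi> u)"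
    unfolding sum_divide_distrib by (rule sum.swap)
  also have "\<dots> = (\<Sum>u\<in>?U. ideal_moebius R d ^ (k - 1))"
  proof (rule sum.cong[OF refl])
    fix u assume u: "u \<in> ?U"
    then have "u \<in> carrier ?Q" using Units_sub by blast
    then show "(\<Sum>a\<in>?P. if ?s a = u then \<psi> (a 1) else 0) / \<psi> u = ideal_moebius R d ^ (k - 1)"
      unfolding primitive_sum_tuples[OF d \<psi> k \<open>u \<in> carrier ?Q\<close>] using u nonzero[OF u] by simp
  qed
  finally show ?thesis by (simp add: ideal_totient_def)
qed

end

section \<open>Reduction of the Jacobi sum to the conductor\<close>

context dedekind
begin

text \<open>The summand depends only on the reductions b and b' of the tuple modulo d and m: \<chi>
  sees b alone, and the sum is a unit modulo n exactly if both reduced sums are units. Each pair (b,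
  b') occurs N(n/(d m))^k times, and the condition on b' counts \<phi>_k(m) tuples.\<close>

lemma jacobi_sum_reduction:
  assumes n: "nz n" and d: "ideal d R" "n \<subseteq> d" and m: "ideal m R" "n \<subseteq> m"
    and coprime: "d <+>\<^bsub>R\<^esub> m = carrier R"
    and rad: "\<And>P. P \<in> primes \<Longrightarrow> n \<subseteq> P \<Longrightarrow> d \<subseteq> P \<or> m \<subseteq> P"
    and \<chi>: "induces R d \<psi> n \<chi>" and k: "k \<ge> 1"
  shows "(\<Sum>a\<in>unit_sum_tuples (R Quot n) k. \<chi> (a 1) / \<chi> (\<Oplus>\<^bsub>R Quot n\<^esub>i\<in>{1..k}. a i))
    = of_nat (ideal_norm R (ideal_quotient R n (d \<cdot> m)) ^ k) * of_nat (ideal_totient_k k R m)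
      * (\<Sum>b\<in>unit_sum_tuples (R Quot d) k. \<psi> (b 1) / \<psi> (\<Oplus>\<^bsub>R Quot d\<^esub>i\<in>{1..k}. b i))"
proof -
  note n' = nzD(1)[OF n]
  have nzd: "nz d" "nz m" using nz_superset n d m by blast+
  interpret h: ring_hom_cring "R Quot n" "R Quot d" "reduce_class R d"
    by (rule reduce_class_hom[OF n' d])
  interpret g: ring_hom_cring "R Quot n" "R Quot m" "reduce_class R m"
    by (rule reduce_class_hom[OF n' m])
  let ?I = "{1..k}"
  let ?Un = "Units (R Quot n)" and ?Ud = "Units (R Quot d)" and ?Um = "Units (R Quot m)"
  let ?sn = "\<lambda>a. \<Oplus>\<^bsub>R Quot n\<^esub>i\<in>?I. a i" and ?sd = "\<lambda>a. \<Oplus>\<^bsub>R Quot d\<^esub>i\<in>?I. a i"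
    and ?sm = "\<lambda>a. \<Oplus>\<^bsub>R Quot m\<^esub>i\<in>?I. a i"
  define F where "F b b' = (if ?sd b \<in> ?Ud \<and> ?sm b' \<in> ?Um then \<psi> (b 1) / \<psi> (?sd b) else 0)" for b b'
  have fin: "finite (?I \<rightarrow>\<^sub>E ?Un)" "finite (?I \<rightarrow>\<^sub>E ?Ud)" "finite (?I \<rightarrow>\<^sub>E ?Um)"
    using finite_Units n nzd by (auto intro: finite_PiE)
  have unit_iff: "A \<in> ?Un \<longleftrightarrow> reduce_class R d A \<in> ?Ud \<and> reduce_class R m A \<in> ?Um"
    if A: "A \<in> carrier (R Quot n)" for A
  proof -
    obtain x where x: "x \<in> carrier R" "A = n +> x" using quotient_cases[OF n' A] by blast
    have "reduce_class R d A = d +> x" "reduce_class R m A = m +> x"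
      using reduce_class_coset[OF n' d x(1)] reduce_class_coset[OF n' m x(1)] x(2) by simp_all
    moreover have "n \<subseteq> P \<longleftrightarrow> d \<subseteq> P \<or> m \<subseteq> P" if "P \<in> primes" for P
      using rad[OF that] d(2) m(2) by blast
    ultimately show ?thesis
      unfolding x(2) using coset_unit_iff_primes[OF n x(1)] coset_unit_iff_primes[OF nzd(1) x(1)]
        coset_unit_iff_primes[OF nzd(2) x(1)] x(2) by (metis (no_types))
  qed
  have \<chi>_red: "\<chi> A = \<psi> (reduce_class R d A)" if A: "A \<in> ?Un" for A
  proof -
    obtain x where x: "x \<in> carrier R" "A = n +> x" using quotient_cases[OF n'] A Units_sub by blast
    then show ?thesis using \<chi> A reduce_class_coset[OF n' d x(1)] by (simp add: induces_def)
  qed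
  have "(\<Sum>a\<in>unit_sum_tuples (R Quot n) k. \<chi> (a 1) / \<chi> (?sn a))
      = (\<Sum>a\<in>?I \<rightarrow>\<^sub>E ?Un. if ?sn a \<in> ?Un then \<chi> (a 1) / \<chi> (?sn a) else 0)"
    unfolding unit_sum_tuples_def by (rule sum.inter_filter[OF fin(1)])
  also have "\<dots> = (\<Sum>a\<in>?I \<rightarrow>\<^sub>E ?Un. F (restrict (reduce_class R d \<circ> a) ?I) (restrict (reduce_class R m \<circ> a) ?I))"
  proof (rule sum.cong[OF refl])
    fix a assume a: "a \<in> ?I \<rightarrow>\<^sub>E ?Un"
    have aU: "a i \<in> ?Un" "a i \<in> carrier (R Quot n)" if "i \<in> ?I" for i
      using a that Units_sub by (auto simp: PiE_iff)
    have s: "?sn a \<in> carrier (R Quot n)" using aU by auto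
    have sd: "?sd (restrict (reduce_class R d \<circ> a) ?I) = reduce_class R d (?sn a)"
    proof -
      have "?sd (restrict (reduce_class R d \<circ> a) ?I) = ?sd (reduce_class R d \<circ> a)"
        using aU by (intro h.S.finsum_cong') auto
      also have "\<dots> = reduce_class R d (?sn a)"
        using aU by (intro h.hom_finsum[symmetric]) auto
      finally show ?thesis .
    qed
    have sm: "?sm (restrict (reduce_class R m \<circ> a) ?I) = reduce_class R m (?sn a)"
    proof -
      have "?sm (restrict (reduce_class R m \<circ> a) ?I) = ?sm (reduce_class R m \<circ> a)"
        using aU by (intro g.S.finsum_cong') auto
      also have "\<dots> = reduce_class R m (?sn a)"
        using aU by (intro g.hom_finsum[symmetric]) auto
      finally show ?thesis .
    qed
    have "1 \<in> ?I" using k by simp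
    then show "(if ?sn a \<in> ?Un then \<chi> (a 1) / \<chi> (?sn a) else 0)
        = F (restrict (reduce_class R d \<circ> a) ?I) (restrict (reduce_class R m \<circ> a) ?I)"
      unfolding F_def sd sm using unit_iff[OF s] \<chi>_red aU(1)[of 1] by simp
  qed
  also have "\<dots> = of_nat (ideal_norm R (ideal_quotient R n (d \<cdot> m)) ^ card ?I)
      * (\<Sum>b\<in>?I \<rightarrow>\<^sub>E ?Ud. \<Sum>b'\<in>?I \<rightarrow>\<^sub>E ?Um. F b b')"
    by (rule sum_PiE_pair_fibres)
      (use finite_Units n nzd reduce_class_unit[OF n d] reduce_class_unit[OF n m]
        card_pair_fibre[OF n d m coprime rad] in auto)
  also have "(\<Sum>b\<in>?I \<rightarrow>\<^sub>E ?Ud. \<Sum>b'\<in>?I \<rightarrow>\<^sub>E ?Um. F b b')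
      = (\<Sum>b\<in>?I \<rightarrow>\<^sub>E ?Ud. (if ?sd b \<in> ?Ud then \<psi> (b 1) / \<psi> (?sd b) else 0) * (\<Sum>b'\<in>?I \<rightarrow>\<^sub>E ?Um. if ?sm b' \<in> ?Um then 1 else 0))"
    unfolding sum_distrib_left by (intro sum.cong) (auto simp: F_def)
  also have "\<dots> = (\<Sum>b\<in>?I \<rightarrow>\<^sub>E ?Ud. if ?sd b \<in> ?Ud then \<psi> (b 1) / \<psi> (?sd b) else 0)
      * (\<Sum>b'\<in>?I \<rightarrow>\<^sub>E ?Um. if ?sm b' \<in> ?Um then 1 else 0)"
    by (rule sum_distrib_right[symmetric])
  also have "(\<Sum>b'\<in>?I \<rightarrow>\<^sub>E ?Um. if ?sm b' \<in> ?Um then 1 else (0::complex)) = of_nat (ideal_totient_k k R m)"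
    unfolding ideal_totient_k_def unit_sum_tuples_def sum.inter_filter[OF fin(3), symmetric] by simp
  also have "(\<Sum>b\<in>?I \<rightarrow>\<^sub>E ?Ud. if ?sd b \<in> ?Ud then \<psi> (b 1) / \<psi> (?sd b) else 0)
      = (\<Sum>b\<in>unit_sum_tuples (R Quot d) k. \<psi> (b 1) / \<psi> (?sd b))"
    unfolding unit_sum_tuples_def by (rule sum.inter_filter[OF fin(2), symmetric])
  finally show ?thesis by simp
qed

section \<open>Powers of ideals and the totient factor\<close>

lemma ideal_power_simps: "ideal_power R I 0 = carrier R" "ideal_power R I (Suc k) = ideal_power R I k \<cdot> I"
  by (simp_all add: nat_pow_def)

lemma ideal_power_nz: "nz I \<Longrightarrow> nz (ideal_power R I k)"
  by (induction k) (auto simp: ideal_power_simps nz_prod nz_carrier)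

lemma ideal_power_norm: "nz I \<Longrightarrow> ideal_norm R (ideal_power R I k) = ideal_norm R I ^ k"
  by (induction k) (auto simp: ideal_power_simps norm_carrier norm_prod ideal_power_nz)

lemma ideal_power_prod:
  assumes "ideal I R" "ideal J R"
  shows "ideal_power R (I \<cdot> J) k = ideal_power R I k \<cdot> ideal_power R J k"
proof -
  interpret M: comm_monoid "ideals_set R" by (rule comm_monoid_ideals)
  show ?thesis using M.nat_pow_distrib[of I J k] assms by simp
qed

lemma ideal_power_subset_prime:
  assumes "P \<in> primes" "nz I" "ideal_power R I k \<subseteq> P"
  shows "I \<subseteq> P"
  using assms(3)
proof (induction k)
  case 0
  then show ?case using primesD(3,5)[OF assms(1)] ideal_subset by (auto simp: ideal_power_simps)
next
  case (Suc k)
  then show ?case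
    using prime_prod_subset_iff[OF assms(1) nzD(1)[OF ideal_power_nz[OF assms(2)]] nzD(1)[OF assms(2)]]
    by (auto simp: ideal_power_simps)
qed

text \<open>With one factor d left after cancellation, the quotient is d c^k. By \<open>rad\<close>
  every prime above it lies above d, so the totient formula for ideals with the same primes
  applies.\<close>

lemma totient_power_quotient:
  assumes d: "nz d" and c: "nz c" and k: "k \<ge> 1"
    and rad: "\<And>P. P \<in> primes \<Longrightarrow> c \<subseteq> P \<Longrightarrow> d \<subseteq> P"
  shows "ideal_totient R (ideal_quotient R (ideal_power R (d \<cdot> c) k) (ideal_power R d (k - 1)))
    = ideal_totient R d * ideal_norm R c ^ k"
proof -
  note di = nzD(1)[OF d]
  let ?p = "ideal_power R"
  have ck: "nz (?p c k)" "ideal (?p c k) R" using ideal_power_nz[OF c] nzD by auto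
  have dk: "nz (?p d (k - 1))" "ideal (?p d (k - 1)) R" using ideal_power_nz[OF d] nzD by auto
  have dc: "nz (d \<cdot> ?p c k)" using nz_prod d ck by blast
  have "?p (d \<cdot> c) k = ?p d (k - 1) \<cdot> d \<cdot> ?p c k"
    using ideal_power_prod[OF di nzD(1)[OF c], of k] ideal_power_simps(2)[of d "k - 1"] k by simp
  also have "\<dots> = ?p d (k - 1) \<cdot> (d \<cdot> ?p c k)"
    using ideal_prod_assoc[OF dk(2) di ck(2)] .
  finally have "ideal_quotient R (?p (d \<cdot> c) k) (?p d (k - 1)) = d \<cdot> ?p c k"
    using quotient_prod[OF dk(1) nzD(1)[OF dc]] by simp
  moreover have "ideal_totient R (d \<cdot> ?p c k) = ideal_totient R d * ideal_norm R (ideal_quotient R (d \<cdot> ?p c k) d)"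
  proof (rule totient_same_radical[OF dc di])
    show "d \<cdot> ?p c k \<subseteq> d" using prod_subset[OF di ck(2)] by blast
    show "d \<subseteq> P" if "P \<in> primes" "d \<cdot> ?p c k \<subseteq> P" for P
      using prime_prod_subset_iff[OF that(1) di ck(2)] that ideal_power_subset_prime[OF that(1) c] rad by blast
  qed
  ultimately show ?thesis
    using quotient_prod[OF d ck(2)] ideal_power_norm[OF c] by simp
qed

section \<open>The gcd of residue classes and the assembly of the identity\<close>

text \<open>Moebius inversion only asks which e divide the gcd, and this splits into separate
  conditions on the classes A and b_j. Stated through \<open>reduce_class\<close>, the conditions no
  longer mention the chosen generators.\<close>

lemma class_gcd_props:
  assumes n: "nz n" and A: "A \<in> carrier (R Quot n)" and b: "b \<in> {1..s} \<rightarrow>\<^sub>E carrier (R Quot n)"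
  shows "nz (class_gcd R n s A b)" "n \<subseteq> class_gcd R n s A b"
    and "ideal e R \<Longrightarrow> n \<subseteq> e \<Longrightarrow> class_gcd R n s A b \<subseteq> e
      \<longleftrightarrow> reduce_class R e A = e \<and> (\<forall>j\<in>{1..s}. reduce_class R e (b j) = e)"
proof -
  note n' = nzD(1)[OF n]
  interpret M: semiring "ideals_set R" by (rule ideals_set_is_semiring)
  have rep: "class_rep A \<in> carrier R" using class_rep_quotient[OF n' A] by blast
  have rep_b: "class_rep (b j) \<in> carrier R" if "j \<in> {1..s}" for j
    using class_rep_quotient(1)[OF n'] b that by (auto simp: PiE_iff)
  define G where "G J = (\<Oplus>\<^bsub>ideals_set R\<^esub>j\<in>J. PIdl (class_rep (b j)))" for J
  have G: "ideal (G J) R \<and> (\<forall>e. ideal e R \<longrightarrow> (G J \<subseteq> e \<longleftrightarrow> (\<forall>j\<in>J. class_rep (b j) \<in> e)))"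
    if "J \<subseteq> {1..s}" for J
    using finite_subset[OF that finite_atLeastAtMost] that
  proof (induction J rule: finite_induct)
    case empty
    \<comment> \<open>The empty sum is the zero ideal, which lies in every ideal; s = 0 thus imposes
      no condition.\<close>
    then show ?case using zeroideal ideal_zero_mem by (auto simp: G_def)
  next
    case (insert j J)
    have Pj: "ideal (PIdl (class_rep (b j))) R" using cgenideal_ideal rep_b insert.prems by blast
    have "(\<lambda>j. PIdl (class_rep (b j))) \<in> J \<rightarrow> carrier (ideals_set R)"
      using cgenideal_ideal rep_b insert.prems by auto
    then have eq: "G (insert j J) = PIdl (class_rep (b j)) <+>\<^bsub>R\<^esub> G J"
      using insert.hyps Pj unfolding G_def by (subst M.finsum_insert) auto
    have GJ: "ideal (G J) R" using insert by simp
    show ?case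
      unfolding eq using insert ideal_sum_subset_iff[OF Pj GJ] add_ideals[OF Pj GJ]
        cgenideal_subset_iff[OF _ rep_b[of j]] by auto
  qed
  have gcd: "class_gcd R n s A b = PIdl (class_rep A) <+>\<^bsub>R\<^esub> G {1..s} <+>\<^bsub>R\<^esub> n"
    by (simp add: class_gcd_def G_def)
  note PA = cgenideal_ideal[OF rep]
  have G': "ideal (G {1..s}) R" using G by blast
  note PAG = add_ideals[OF PA G']
  have ideal: "ideal (class_gcd R n s A b) R" unfolding gcd by (rule add_ideals[OF PAG n'])
  have sub: "class_gcd R n s A b \<subseteq> e
      \<longleftrightarrow> class_rep A \<in> e \<and> (\<forall>j\<in>{1..s}. class_rep (b j) \<in> e) \<and> n \<subseteq> e" if e: "ideal e R" for e
  proof -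
    have "G {1..s} \<subseteq> e \<longleftrightarrow> (\<forall>j\<in>{1..s}. class_rep (b j) \<in> e)"
      using G[OF subset_refl] e by blast
    then show ?thesis
      unfolding gcd ideal_sum_subset_iff[OF PAG n' e] ideal_sum_subset_iff[OF PA G' e]
        cgenideal_subset_iff[OF e rep] by argo
  qed
  show "n \<subseteq> class_gcd R n s A b" using sub[OF ideal] by blast
  then show "nz (class_gcd R n s A b)" using nz_superset[OF n ideal] by blast
  show "class_gcd R n s A b \<subseteq> e
      \<longleftrightarrow> reduce_class R e A = e \<and> (\<forall>j\<in>{1..s}. reduce_class R e (b j) = e)"
    if e: "ideal e R" "n \<subseteq> e"
  proof -
    have "reduce_class R e C = e \<longleftrightarrow> class_rep C \<in> e" if "class_rep C \<in> carrier R" for C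
      using a_rcos_zero[OF e(1)] ideal.rcos_const_imp_mem[OF e(1) that] by (auto simp: reduce_class_def)
    then show ?thesis using sub[OF e(1)] e(2) rep rep_b by auto
  qed
qed

text \<open>The origin of the factor N(n/e)^s: each b_j runs over the kernel of reduction modulo
  e.\<close>

lemma card_tuples_divisible:
  assumes n: "nz n" and e: "ideal e R" "n \<subseteq> e"
  shows "card {b \<in> {1..s} \<rightarrow>\<^sub>E carrier (R Quot n). \<forall>j\<in>{1..s}. reduce_class R e (b j) = e}
    = ideal_norm R (ideal_quotient R n e) ^ s"
proof -
  have "{b \<in> {1..s} \<rightarrow>\<^sub>E carrier (R Quot n). \<forall>j\<in>{1..s}. reduce_class R e (b j) = e}
      = {1..s} \<rightarrow>\<^sub>E {B \<in> carrier (R Quot n). reduce_class R e B = e}"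
    by (intro equalityI subsetI) (auto simp: PiE_iff)
  then show ?thesis
    using card_reduce_kernel[OF assms] by (simp add: card_PiE)
qed

text \<open>The scaling identity is applied to the classes congruent to r modulo e. If e is not
  contained in d, then e cannot be an induced modulus, as the conductor divides all of these;
  otherwise \<chi> is constant on those classes. The nonzero factor \<phi>(n) cancels.\<close>

lemma tuple_character_sum:
  assumes n: "nz n" and e: "ideal e R" "n \<subseteq> e" and k: "k \<ge> 1"
    and \<chi>: "dirichlet_char R n \<chi>" and cond: "conductor R n \<chi> d"
    and r: "r \<in> carrier R" "n +> r \<in> Units (R Quot n)"
  shows "(\<Sum>a\<in>unit_sum_tuples (R Quot n) k.
        if reduce_class R e (\<Oplus>\<^bsub>R Quot n\<^esub>i\<in>{1..k}. a i) = e +> r then \<chi> (a 1) else 0)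
    = (if e \<subseteq> d then (\<Sum>a\<in>unit_sum_tuples (R Quot n) k. \<chi> (a 1) / \<chi> (\<Oplus>\<^bsub>R Quot n\<^esub>i\<in>{1..k}. a i))
        * \<chi> (n +> r) / of_nat (ideal_totient R e) else 0)" (is "?S = (if _ then ?J * _ / _ else 0)")
proof -
  note n' = nzD(1)[OF n]
  interpret Q: cring "R Quot n" by (rule quotient_cring[OF n'])
  have d: "induced_modulus R n \<chi> d" using cond by (simp add: conductor_def)
  have "of_nat (ideal_totient R n) * ?S
      = ?J * (\<Sum>t\<in>Units (R Quot n). if reduce_class R e t = e +> r then \<chi> t else 0)"
    using Q.unit_sum_tuples_twisted_sum[OF finite_Units[OF n], of \<chi> k "{t. reduce_class R e t = e +> r}"]
      character_props[OF n' \<chi>] k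
    by (simp add: ideal_totient_def)
  also have "(\<Sum>t\<in>Units (R Quot n). if reduce_class R e t = e +> r then \<chi> t else 0)
      = (if e \<subseteq> d then \<chi> (n +> r) * of_nat (ideal_totient R n) / of_nat (ideal_totient R e) else 0)"
  proof (cases "e \<subseteq> d")
    case True
    then show ?thesis using character_sum_coset[OF n \<chi> e d True r] by simp
  next
    case False
    have "ideal d R" using d by (simp add: induced_modulus_def)
    then have "\<not> induced_modulus R n \<chi> e"
      using cond False divides_iff[OF nz_superset[OF n e]] unfolding conductor_def by blast
    then show ?thesis using character_sum_coset_eq_0[OF n \<chi> e] False by simp
  qed
  also have "?J * \<dots> = of_nat (ideal_totient R n)
      * (if e \<subseteq> d then ?J * \<chi> (n +> r) / of_nat (ideal_totient R e) else 0)"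
    by simp
  finally have "of_nat (ideal_totient R n) * ?S = of_nat (ideal_totient R n)
      * (if e \<subseteq> d then ?J * \<chi> (n +> r) / of_nat (ideal_totient R e) else 0)" .
  moreover have "of_nat (ideal_totient R n) \<noteq> (0::complex)"
    using totient_pos[OF n] by simp
  ultimately show ?thesis
    by (rule mult_left_cancel[THEN iffD1, rotated])
qed

lemma menon_identity:
  assumes n: "nz n" and k: "k \<ge> 1"
    and \<chi>: "dirichlet_char R n \<chi>" and cond: "conductor R n \<chi> d"
    and \<psi>: "primitive_char R d \<psi>" and ind: "induces R d \<psi> n \<chi>"
    and n0: "ideal n\<^sub>0 R" "ideal_divides R n\<^sub>0 n"
    and rad: "\<forall>p\<in>primes. ideal_divides R p n\<^sub>0 \<longleftrightarrow> ideal_divides R p d"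
    and coprime: "n\<^sub>0 <+>\<^bsub>R\<^esub> ideal_quotient R n n\<^sub>0 = carrier R"
    and r: "r \<in> carrier R" "PIdl r <+>\<^bsub>R\<^esub> n = carrier R"
  shows
    "(\<Sum>(a, b) \<in> unit_sum_tuples (R Quot n) k \<times> ({1..s} \<rightarrow>\<^sub>E carrier (R Quot n)).
        f (class_gcd R n s ((\<Oplus>\<^bsub>R Quot n\<^esub>i\<in>{1..k}. a i) \<ominus>\<^bsub>R Quot n\<^esub> (n +> r)) b) * \<chi> (a 1))
     = ideal_moebius R d ^ (k - 1) * \<psi> (d +> r)
       * of_nat (ideal_totient R (ideal_quotient R (ideal_power R n\<^sub>0 k) (ideal_power R d (k - 1))))
       * of_nat (ideal_totient_k k R (ideal_quotient R n n\<^sub>0))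
       * (\<Sum>e \<in> {e \<in> nonzero_ideals R. ideal_divides R d e \<and> ideal_divides R e n}.
            ideal_convolution R (ideal_moebius R) f e / of_nat (ideal_totient R e)
            * of_nat (ideal_norm R (ideal_quotient R n e)) ^ s)"
proof -
  note n' = nzD(1)[OF n]
  have di: "ideal d R" "n \<subseteq> d"
    using cond divides_iff[OF n] by (auto simp: conductor_def induced_modulus_def)
  have d: "nz d" using nz_superset[OF n di] .
  have n0_sub: "n \<subseteq> n\<^sub>0" using divides_iff[OF n n0(1)] n0(2) by blast
  have nz0: "nz n\<^sub>0" using nz_superset[OF n n0(1) n0_sub] .
  define m where "m = ideal_quotient R n n\<^sub>0"
  have m: "nz m" "n = n\<^sub>0 \<cdot> m" using quotient_props[OF n n0(1) n0_sub] by (auto simp: m_def)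
  note mi = nzD(1)[OF m(1)]
  have nm: "n \<subseteq> m" using prod_subset[OF n0(1) mi] m(2) by blast
  have rad': "n\<^sub>0 \<subseteq> P \<longleftrightarrow> d \<subseteq> P" if "P \<in> primes" for P
    using rad that divides_iff[OF nz0 primesD(5)[OF that]] divides_iff[OF d primesD(5)[OF that]] by blast
  have dm: "d <+>\<^bsub>R\<^esub> m = carrier R"
    using coprime sum_eq_carrier_iff_primes[OF d mi] sum_eq_carrier_iff_primes[OF nz0 mi] rad'
    by (auto simp: m_def)
  \<comment> \<open>Multiply d + m = R by \<open>n\<^sub>0\<close>: both \<open>n\<^sub>0\<close> d
    and \<open>n\<^sub>0\<close> m = n lie in d.\<close>
  have "n\<^sub>0 \<subseteq> d"
  proof -
    have "n\<^sub>0 = n\<^sub>0 \<cdot> (d <+>\<^bsub>R\<^esub> m)" using dm ideal_prod_one[OF n0(1)] by simp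
    also have "\<dots> = n\<^sub>0 \<cdot> d <+>\<^bsub>R\<^esub> n" using ideal_prod_r_distr[OF n0(1) di(1) mi] m(2) by simp
    finally show ?thesis
      using ideal_sum_subset_iff[OF ideal_prod_is_ideal[OF n0(1) di(1)] n' di(1)]
        prod_subset[OF n0(1) di(1)] di(2) by blast
  qed
  then obtain c where c: "nz c" "n\<^sub>0 = d \<cdot> c" using quotient_props[OF nz0 di(1)] by blast
  note ci = nzD(1)[OF c(1)]
  \<comment> \<open>This identifies n/(d m) with c = \<open>n\<^sub>0\<close>/d, so that the fibre
    size in the Jacobi sum matches the norm in the totient formula.\<close>
  have n_eq: "n = d \<cdot> m \<cdot> c"
    using m(2) c(2) ideal_prod_assoc[OF di(1) ci mi] ideal_prod_assoc[OF di(1) mi ci] ideal_prod_commute[OF ci mi] by simp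
  have c_quot: "ideal_quotient R n (d \<cdot> m) = c"
    using n_eq quotient_prod[OF nz_prod[OF d m(1)] ci] by simp
  have rad_n: "d \<subseteq> P \<or> m \<subseteq> P" if "P \<in> primes" "n \<subseteq> P" for P
    using prime_prod_subset_iff[OF that(1) n0(1) mi] m(2) that(2) rad'[OF that(1)] by blast
  have rad_c: "d \<subseteq> P" if "P \<in> primes" "c \<subseteq> P" for P
    using rad'[OF that(1)] prod_subset[OF di(1) ci] c(2) that by blast
  \<comment> \<open>The value of the Jacobi sum J(n): the part of the right-hand side that involves
    neither e nor r.\<close>
  define M where "M = ideal_moebius R d ^ (k - 1)
      * of_nat (ideal_totient R (ideal_quotient R (ideal_power R n\<^sub>0 k) (ideal_power R d (k - 1))))
      * of_nat (ideal_totient_k k R m)"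
  let ?Q = "R Quot n"
  let ?X = "unit_sum_tuples ?Q k" and ?B = "{1..s} \<rightarrow>\<^sub>E carrier ?Q"
  let ?s = "\<lambda>a. \<Oplus>\<^bsub>?Q\<^esub>i\<in>{1..k}. a i"
  let ?D = "{e. ideal e R \<and> n \<subseteq> e}"
  let ?conv = "ideal_convolution R (ideal_moebius R) f"
  have jacobi: "(\<Sum>a\<in>?X. \<chi> (a 1) / \<chi> (?s a)) = M"
  proof -
    have "(\<Sum>a\<in>?X. \<chi> (a 1) / \<chi> (?s a))
        = of_nat (ideal_norm R (ideal_quotient R n (d \<cdot> m)) ^ k) * of_nat (ideal_totient_k k R m)
          * (\<Sum>b\<in>unit_sum_tuples (R Quot d) k. \<psi> (b 1) / \<psi> (\<Oplus>\<^bsub>R Quot d\<^esub>i\<in>{1..k}. b i))"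
      by (rule jacobi_sum_reduction[OF n di mi nm dm _ ind k]) (rule rad_n)
    moreover have "ideal_totient R (ideal_quotient R (ideal_power R n\<^sub>0 k) (ideal_power R d (k - 1)))
        = ideal_totient R d * ideal_norm R c ^ k"
      unfolding c(2) by (rule totient_power_quotient[OF d c(1) k]) (rule rad_c)
    ultimately show ?thesis
      unfolding M_def c_quot primitive_jacobi_sum[OF d \<psi> k] by (simp only: of_nat_mult mult_ac)
  qed
  interpret Q: cring ?Q by (rule quotient_cring[OF n'])
  have finB: "finite ?B" using finite_quot[OF nzD[OF n]] by (auto intro: finite_PiE)
  have r_unit: "n +> r \<in> Units ?Q" using coset_unit_iff_sum[OF n' r(1)] r(2) by blast
  then have \<chi>_r: "\<chi> (n +> r) = \<psi> (d +> r)" using ind r(1) by (simp add: induces_def)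
  have rc: "n +> r \<in> carrier ?Q" using r_unit Units_sub by blast
  have X: "?s a \<in> carrier ?Q" if "a \<in> ?X" for a
    using that Units_sub by (auto simp: unit_sum_tuples_def)
  have red: "reduce_class R e (A \<ominus>\<^bsub>?Q\<^esub> (n +> r)) = e \<longleftrightarrow> reduce_class R e A = e +> r"
    if e: "e \<in> ?D" and A: "A \<in> carrier ?Q" for e A
  proof -
    interpret h: ring_hom_cring ?Q "R Quot e" "reduce_class R e"
      using e by (intro reduce_class_hom[OF n']) auto
    have "\<zero>\<^bsub>R Quot e\<^esub> = e" using quotient_ops(4)[of e \<zero> \<zero>] e by simp
    moreover have "reduce_class R e (A \<ominus>\<^bsub>?Q\<^esub> (n +> r)) = reduce_class R e A \<ominus>\<^bsub>R Quot e\<^esub> reduce_class R e (n +> r)"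
      using A rc by (simp add: a_minus_def)
    moreover have "reduce_class R e (n +> r) = e +> r" using reduce_class_coset[OF n' _ _ r(1)] e by blast
    ultimately show ?thesis
      using h.S.r_right_minus_eq[of "reduce_class R e A" "reduce_class R e (n +> r)"]
        h.hom_closed[OF A] h.hom_closed[OF rc] by simp
  qed
  have f_expand: "f (class_gcd R n s (?s a \<ominus>\<^bsub>?Q\<^esub> (n +> r)) b)
      = (\<Sum>e\<in>?D. ?conv e * (if reduce_class R e (?s a) = e +> r then 1 else 0)
          * (if \<forall>j\<in>{1..s}. reduce_class R e (b j) = e then 1 else 0))"
    if a: "a \<in> ?X" and b: "b \<in> ?B" for a b
  proof -
    have A: "?s a \<ominus>\<^bsub>?Q\<^esub> (n +> r) \<in> carrier ?Q" using X[OF a] rc by simp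
    let ?g = "class_gcd R n s (?s a \<ominus>\<^bsub>?Q\<^esub> (n +> r)) b"
    note g = class_gcd_props[OF n A b]
    have "f ?g = (\<Sum>e | ideal e R \<and> ?g \<subseteq> e. ?conv e)" by (rule moebius_inversion[OF g(1)])
    also have "{e. ideal e R \<and> ?g \<subseteq> e} = {e \<in> ?D. ?g \<subseteq> e}" using g(2) by blast
    also have "(\<Sum>e\<in>{e \<in> ?D. ?g \<subseteq> e}. ?conv e) = (\<Sum>e\<in>?D. if ?g \<subseteq> e then ?conv e else 0)"
      by (rule sum.inter_filter[OF finite_divisors[OF n]])
    also have "\<dots> = (\<Sum>e\<in>?D. ?conv e * (if reduce_class R e (?s a) = e +> r then 1 else 0)
          * (if \<forall>j\<in>{1..s}. reduce_class R e (b j) = e then 1 else 0))"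
    proof (rule sum.cong[OF refl])
      fix e assume e: "e \<in> ?D"
      then have "?g \<subseteq> e \<longleftrightarrow> reduce_class R e (?s a) = e +> r \<and> (\<forall>j\<in>{1..s}. reduce_class R e (b j) = e)"
        using g(3)[of e] red[OF e X[OF a]] by blast
      then show "(if ?g \<subseteq> e then ?conv e else 0)
          = ?conv e * (if reduce_class R e (?s a) = e +> r then 1 else 0)
            * (if \<forall>j\<in>{1..s}. reduce_class R e (b j) = e then 1 else 0)" by auto
    qed
    finally show ?thesis .
  qed
  have "(\<Sum>(a, b)\<in>?X \<times> ?B. f (class_gcd R n s (?s a \<ominus>\<^bsub>?Q\<^esub> (n +> r)) b) * \<chi> (a 1))
      = (\<Sum>a\<in>?X. \<Sum>b\<in>?B. f (class_gcd R n s (?s a \<ominus>\<^bsub>?Q\<^esub> (n +> r)) b) * \<chi> (a 1))"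
    by (rule sum.cartesian_product[symmetric])
  also have "\<dots> = (\<Sum>a\<in>?X. \<Sum>b\<in>?B. \<Sum>e\<in>?D. ?conv e * (if reduce_class R e (?s a) = e +> r then \<chi> (a 1) else 0)
          * (if \<forall>j\<in>{1..s}. reduce_class R e (b j) = e then 1 else 0))"
    using f_expand by (intro sum.cong refl) (auto simp: sum_distrib_right intro!: sum.cong)
  also have "\<dots> = (\<Sum>a\<in>?X. \<Sum>e\<in>?D. \<Sum>b\<in>?B. ?conv e * (if reduce_class R e (?s a) = e +> r then \<chi> (a 1) else 0)
          * (if \<forall>j\<in>{1..s}. reduce_class R e (b j) = e then 1 else 0))"
    by (intro sum.cong refl sum.swap)
  also have "\<dots> = (\<Sum>e\<in>?D. \<Sum>a\<in>?X. \<Sum>b\<in>?B. ?conv e * (if reduce_class R e (?s a) = e +> r then \<chi> (a 1) else 0)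
          * (if \<forall>j\<in>{1..s}. reduce_class R e (b j) = e then 1 else 0))"
    by (rule sum.swap)
  \<comment> \<open>For fixed e the conditions on a and on b are independent, so the double sum
    factors.\<close>
  also have "\<dots> = (\<Sum>e\<in>?D. ?conv e * (\<Sum>a\<in>?X. if reduce_class R e (?s a) = e +> r then \<chi> (a 1) else 0)
          * (\<Sum>b\<in>?B. if \<forall>j\<in>{1..s}. reduce_class R e (b j) = e then 1 else 0))"
    unfolding sum_distrib_left sum_distrib_right by (intro sum.cong refl sum.swap)
  also have "\<dots> = (\<Sum>e\<in>?D. if e \<subseteq> d then M * \<psi> (d +> r) * (?conv e / of_nat (ideal_totient R e)
          * of_nat (ideal_norm R (ideal_quotient R n e)) ^ s) else 0)"
  proof (rule sum.cong[OF refl])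
    fix e assume "e \<in> ?D"
    then have e: "ideal e R" "n \<subseteq> e" by auto
    have count: "(\<Sum>b\<in>?B. if \<forall>j\<in>{1..s}. reduce_class R e (b j) = e then 1 else (0::complex))
        = of_nat (ideal_norm R (ideal_quotient R n e) ^ s)"
      unfolding card_tuples_divisible[OF n e, symmetric] sum.inter_filter[OF finB, symmetric] by simp
    have tuples: "(\<Sum>a\<in>?X. if reduce_class R e (?s a) = e +> r then \<chi> (a 1) else 0)
        = (if e \<subseteq> d then M * \<psi> (d +> r) / of_nat (ideal_totient R e) else 0)"
      using tuple_character_sum[OF n e k \<chi> cond r(1) r_unit] unfolding jacobi \<chi>_r .
    show "?conv e * (\<Sum>a\<in>?X. if reduce_class R e (?s a) = e +> r then \<chi> (a 1) else 0)
          * (\<Sum>b\<in>?B. if \<forall>j\<in>{1..s}. reduce_class R e (b j) = e then 1 else 0)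
        = (if e \<subseteq> d then M * \<psi> (d +> r) * (?conv e / of_nat (ideal_totient R e)
          * of_nat (ideal_norm R (ideal_quotient R n e)) ^ s) else 0)"
      unfolding count tuples by simp
  qed
  also have "\<dots> = (\<Sum>e | e \<in> ?D \<and> e \<subseteq> d. M * \<psi> (d +> r) * (?conv e / of_nat (ideal_totient R e)
          * of_nat (ideal_norm R (ideal_quotient R n e)) ^ s))"
    by (rule sum.inter_filter[OF finite_divisors[OF n], symmetric])
  also have "{e. e \<in> ?D \<and> e \<subseteq> d} = {e \<in> nonzero_ideals R. ideal_divides R d e \<and> ideal_divides R e n}"
    using divides_iff[OF n] divides_iff[OF _ di(1)] nzD(1) nz_superset[OF n] by blast
  finally show ?thesis
    unfolding M_def m_def by (simp add: sum_distrib_left mult_ac)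
qed

end

lemma (in number_field_integers) dedekind_integers: "dedekind (ring_of_integers K)"
proof unfold_locales
  fix I A B :: "'a set"
  assume I: "ideal I (ring_of_integers K)" "I \<noteq> {\<zero>\<^bsub>ring_of_integers K\<^esub>}"
  then have I0: "I \<noteq> {0}" by simp
  show "finite (carrier (ring_of_integers K Quot I))"
    by (rule finite_quotient[OF I(1) I0])
  show "A = B" if "ideal A (ring_of_integers K)" "ideal B (ring_of_integers K)"
    "ideal_prod (ring_of_integers K) I A = ideal_prod (ring_of_integers K) I B"
    using ideal_prod_cancel[OF I(1) I0 that] .
  show "\<exists>C. ideal C (ring_of_integers K) \<and> A = ideal_prod (ring_of_integers K) I C"
    if "ideal A (ring_of_integers K)" "A \<subseteq> I"
    using ideal_contains_imp_divides[OF I(1) I0 that] by blast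
qed

theorem theorem1p2:
  fixes K :: "'a::field_char_0 set" and R :: "'a ring"
    and n d n\<^sub>0 :: "'a set" and k s :: nat
    and \<chi> \<psi> f :: "'a set \<Rightarrow> complex" and r :: 'a
  assumes "number_field K" and "R = ring_of_integers K"
    and "n \<in> nonzero_ideals R" and "k \<ge> 1"
    and "dirichlet_char R n \<chi>" and "conductor R n \<chi> d"
    and "primitive_char R d \<psi>" and "induces R d \<psi> n \<chi>"
    and "ideal n\<^sub>0 R" and "ideal_divides R n\<^sub>0 n"
    and "\<forall>p\<in>nonzero_primes R. ideal_divides R p n\<^sub>0 \<longleftrightarrow> ideal_divides R p d"
    and "n\<^sub>0 <+>\<^bsub>R\<^esub> ideal_quotient R n n\<^sub>0 = carrier R"
    and "r \<in> carrier R" and "PIdl\<^bsub>R\<^esub> r <+>\<^bsub>R\<^esub> n = carrier R"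
  shows
    "(\<Sum>(a, b) \<in> unit_sum_tuples (R Quot n) k \<times> ({1..s} \<rightarrow>\<^sub>E carrier (R Quot n)).
        f (class_gcd R n s ((\<Oplus>\<^bsub>R Quot n\<^esub>i\<in>{1..k}. a i) \<ominus>\<^bsub>R Quot n\<^esub> (n +>\<^bsub>R\<^esub> r)) b) * \<chi> (a 1))
     = ideal_moebius R d ^ (k - 1) * \<psi> (d +>\<^bsub>R\<^esub> r)
       * of_nat (ideal_totient R (ideal_quotient R (ideal_power R n\<^sub>0 k) (ideal_power R d (k - 1))))
       * of_nat (ideal_totient_k k R (ideal_quotient R n n\<^sub>0))
       * (\<Sum>e \<in> {e \<in> nonzero_ideals R. ideal_divides R d e \<and> ideal_divides R e n}.
            ideal_convolution R (ideal_moebius R) f e / of_nat (ideal_totient R e)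
            * of_nat (ideal_norm R (ideal_quotient R n e)) ^ s)"
proof -
  interpret number_field_integers K
    by unfold_locales (rule assms(1))
  interpret D: dedekind R
    unfolding assms(2) by (rule dedekind_integers)
  show ?thesis
    by (rule D.menon_identity[OF assms(3-14)])
qed

end
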